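(* Let $(g,X)$ be a radial Kähler–Ricci soliton on a complex manifold $M$ of complex dimension $n\ge2$. If $g$ is induced either by an infinite dimensional flat space or by an infinite dimensional complex hyperbolic space (i.e. $(M,g)$ can be Kähler immersed into $(S^\infty_c,g^\infty_c)$ for some $c\le 0$), then the Kähler potential of $g$ is defined at the origin.
   Context: Radial metrics. A Kähler metric $g$ on a connected complex manifold $M$ of complex dimension $n$, with complex coordinates $z_1,\dots,z_n$, is radial if its Kähler form is $\omega=\frac{i}{2}\partial\bar\partial f(r)$, $r=|z_1|^2+\cdots+|z_n|^2$, for a smooth function $f:(r_{\inf},r_{\sup})\to\mathbb{R}$, $0\le r_{\inf}<r_{\sup}\le\infty$, where $(r_{\inf},r_{\sup})$ is the maximal domain where $f$ is defined. Components are defined by $\omega_{i\bar j}=\partial_{z_i}\partial_{\bar z_j}f$. The potential is defined at the origin if $r_{\inf}=0$ and $f$ extends smoothly to $[0,r_{\sup})$, defining the metric there. A Kähler–Ricci soliton (KRS) is a pair $(g,X)$ of a Kähler metric $g$ and a (real) holomorphic vector field $X$ such that $\rho=\lambda\omega+L_X\omega$ for some $\lambda\in\mathbb{R}$ (the solitonic constant), where $\rho$ is the Ricci form, with the convention $\rho_{i\bar j}=-\partial_{z_i}\partial_{\bar z_j}\log\det(\omega_{k\bar l})$. It is radial if $g$ is radial. Infinite dimensional non-elliptic complex space forms $(S^\infty_c,g^\infty_c)$, with Kähler form $\omega_c$: for $c=0$, $S^\infty_0=\ell^2(\mathbb{C})$ with $\omega_0=\frac i2\partial\bar\partial|z|^2$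 (flat space); for $c<0$, $S^\infty_c=\mathbb{C}\mathrm{H}^\infty$ is the unit ball of $\ell^2(\mathbb{C})$ with $\omega_c=\frac{i}{2c}\partial\bar\partial\log(1-|z|^2)$ (complex hyperbolic space). $(M,g)$ can be Kähler immersed into $(S^\infty_c,g^\infty_c)$ (equivalently, $g$ is induced by it) if there is a holomorphic map $\varphi:M\to S^\infty_c$ with $\varphi^*g^\infty_c=g$. *)

theory Defs
  imports "HOL-Analysis.Analysis"
begin

subsection \<open>Smooth and real-analytic functions\<close>

primrec C_k_on :: "nat \<Rightarrow> 'a::real_normed_vector set \<Rightarrow> ('a \<Rightarrow> 'b::real_normed_vector) \<Rightarrow> bool" where
  "C_k_on 0 S f \<longleftrightarrow> continuous_on S f"
| "C_k_on (Suc k) S f \<longleftrightarrow>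
     (\<forall>x\<in>S. f differentiable (at x)) \<and> (\<forall>v. C_k_on k S (\<lambda>x. frechet_derivative f (at x) v))"

text \<open>Only used for open sets \<open>S\<close>.\<close>

definition smooth_on :: "'a::real_normed_vector set \<Rightarrow> ('a \<Rightarrow> 'b::real_normed_vector) \<Rightarrow> bool" where
  "smooth_on S f \<longleftrightarrow> (\<forall>k. C_k_on k S f)"

definition real_analytic_on :: "real set \<Rightarrow> (real \<Rightarrow> real) \<Rightarrow> bool" where
  "real_analytic_on S f \<longleftrightarrow>
     (\<forall>x\<in>S. \<exists>e>0. \<exists>a::nat \<Rightarrow> real. \<forall>y. \<bar>y - x\<bar> < e \<longrightarrow> (\<lambda>k. a k * (y - x) ^ k) sums f y)"

subsection \<open>Wirtinger derivatives and the complex Hessian\<close>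

text \<open>The derivatives \<open>\<partial>/\<partial>\<zeta> = (\<partial>/\<partial>x - \<i> \<partial>/\<partial>y) / 2\<close> and
  \<open>(\<partial>/\<partial>x + \<i> \<partial>/\<partial>y) / 2\<close> of a function of \<open>\<zeta> = x + \<i> y\<close>, taken at \<open>\<zeta> = 0\<close>.\<close>

definition wirtinger :: "(complex \<Rightarrow> complex) \<Rightarrow> complex" where
  "wirtinger F =
     (vector_derivative (\<lambda>x::real. F (of_real x)) (at 0)
      - \<i> * vector_derivative (\<lambda>y::real. F (\<i> * of_real y)) (at 0)) / 2"

definition wirtinger_bar :: "(complex \<Rightarrow> complex) \<Rightarrow> complex" where
  "wirtinger_bar F =
     (vector_derivative (\<lambda>x::real. F (of_real x)) (at 0)
      + \<i> * vector_derivative (\<lambda>y::real. F (\<i> * of_real y)) (at 0)) / 2"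

definition mixed_wirtinger :: "(complex \<Rightarrow> complex \<Rightarrow> real) \<Rightarrow> complex" where
  "mixed_wirtinger G = wirtinger (\<lambda>\<alpha>. wirtinger_bar (\<lambda>\<beta>. complex_of_real (G \<alpha> \<beta>)))"

text \<open>The matrix with entries \<open>\<partial>\<^sub>i \<partial>\<^sub>j\<close>-bar of \<open>p\<close>. Here \<open>\<partial>\<^sub>i\<close> at \<open>z\<close> is the derivative
  of \<open>\<zeta> \<mapsto> p (z + \<zeta> e\<^sub>i)\<close> at 0.\<close>

definition ddbar :: "(complex^'n \<Rightarrow> real) \<Rightarrow> complex^'n \<Rightarrow> complex^'n^'n" where
  "ddbar p z = (\<chi> i j. mixed_wirtinger (\<lambda>\<alpha> \<beta>. p (z + \<alpha> *s axis i 1 + \<beta> *s axis j 1)))"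

subsection \<open>Kaehler metrics and Kaehler-Ricci solitons in coordinates\<close>

text \<open>A complex manifold carrying complex coordinates \<open>z\<^sub>1, \<dots>, z\<^sub>n\<close> is identified with the
  open subset \<open>M\<close> of complex n-space which is the range of these coordinates. A Hermitian
  metric is given by the matrix \<open>H\<close> of components of its fundamental form
  \<open>\<omega> = \<i>/2 \<Sum> H\<^sub>i\<^sub>j dz\<^sub>i \<and> dz\<^sub>j\<close>-bar; \<open>form11\<close> evaluates this form on two real tangent
  vectors.\<close>

definition form11 :: "complex^'n^'n \<Rightarrow> complex^'n \<Rightarrow> complex^'n \<Rightarrow> complex" where
  "form11 A u v =
     \<i> / 2 * (\<Sum>i\<in>UNIV. \<Sum>j\<in>UNIV. A $ i $ j * (u $ i * cnj (v $ j) - v $ i * cnj (u $ j)))"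

definition closed_form2 ::
  "(complex^'n) set \<Rightarrow> (complex^'n \<Rightarrow> complex^'n \<Rightarrow> complex^'n \<Rightarrow> complex) \<Rightarrow> bool" where
  "closed_form2 M w \<longleftrightarrow> (\<forall>z\<in>M. \<forall>u v t.
     frechet_derivative (\<lambda>x. w x v t) (at z) u
     + frechet_derivative (\<lambda>x. w x t u) (at z) v
     + frechet_derivative (\<lambda>x. w x u v) (at z) t = 0)"

definition kaehler_metric :: "(complex^'n) set \<Rightarrow> (complex^'n \<Rightarrow> complex^'n^'n) \<Rightarrow> bool" where
  "kaehler_metric M H \<longleftrightarrow>
     smooth_on M H \<and>
     (\<forall>z\<in>M. \<forall>i j. H z $ i $ j = cnj (H z $ j $ i)) \<and>
     (\<forall>z\<in>M. \<forall>u. u \<noteq> 0 \<longrightarrow>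
        0 < Re (\<Sum>i\<in>UNIV. \<Sum>j\<in>UNIV. H z $ i $ j * (u $ i * cnj (u $ j)))) \<and>
     closed_form2 M (\<lambda>z. form11 (H z))"

text \<open>The determinant of a positive definite Hermitian matrix is a positive real number.\<close>

definition ricci :: "(complex^'n \<Rightarrow> complex^'n^'n) \<Rightarrow> complex^'n \<Rightarrow> complex^'n^'n" where
  "ricci H z = - ddbar (\<lambda>w. ln (Re (det (H w)))) z"

text \<open>A real vector field is a function \<open>X\<close> into complex n-space (viewed as the real tangent
  space), and it is holomorphic if \<open>X\<close> is.\<close>

definition real_holomorphic_field :: "(complex^'n) set \<Rightarrow> (complex^'n \<Rightarrow> complex^'n) \<Rightarrow> bool" where
  "real_holomorphic_field M X \<longleftrightarrow> (\<forall>z\<in>M. X differentiable (at z) \<and>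
     (\<forall>u. frechet_derivative X (at z) (\<i> *s u) = \<i> *s frechet_derivative X (at z) u))"

definition lie_derivative ::
  "(complex^'n \<Rightarrow> complex^'n) \<Rightarrow> (complex^'n \<Rightarrow> complex^'n \<Rightarrow> complex^'n \<Rightarrow> complex) \<Rightarrow>
   complex^'n \<Rightarrow> complex^'n \<Rightarrow> complex^'n \<Rightarrow> complex" where
  "lie_derivative X w z u v =
     frechet_derivative (\<lambda>x. w x u v) (at z) (X z)
     + w z (frechet_derivative X (at z) u) v
     + w z u (frechet_derivative X (at z) v)"

definition kaehler_ricci_soliton ::
  "(complex^'n) set \<Rightarrow> (complex^'n \<Rightarrow> complex^'n^'n) \<Rightarrow> (complex^'n \<Rightarrow> complex^'n) \<Rightarrow> bool" where
  "kaehler_ricci_soliton M H X \<longleftrightarrow>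
     kaehler_metric M H \<and> real_holomorphic_field M X \<and>
     (\<exists>lam::real. \<forall>z\<in>M. \<forall>u v.
        form11 (ricci H z) u v =
        of_real lam * form11 (H z) u v + lie_derivative X (\<lambda>x. form11 (H x)) z u v)"

subsection \<open>Radial metrics\<close>

definition radii :: "(complex^'n) set \<Rightarrow> real set" where
  "radii M = (\<lambda>z. (norm z)\<^sup>2) ` (M - {0})"

text \<open>If \<open>0 \<in> M\<close>, the metric at the origin is determined by continuity.\<close>

definition radial_potential ::
  "(complex^'n) set \<Rightarrow> (complex^'n \<Rightarrow> complex^'n^'n) \<Rightarrow> (real \<Rightarrow> real) \<Rightarrow> bool" where
  "radial_potential M H f \<longleftrightarrow>
     smooth_on (radii M) f \<and> (\<forall>z\<in>M - {0}. H z = ddbar (\<lambda>w. f ((norm w)\<^sup>2)) z)"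

definition radial_interval :: "real \<Rightarrow> ereal \<Rightarrow> real set" where
  "radial_interval r_inf r_sup = {r. r_inf < r \<and> ereal r < r_sup}"

text \<open>A potential that is merely smooth has no well-defined maximal domain, and restricting the
  manifold shrinks the set of radii without changing the potential. The maximal
  domain of \<open>f\<close> is therefore the largest interval of positive radii to which its restriction to
  the radii \<open>J\<close> occurring on the manifold has a real-analytic continuation.\<close>

definition continuation ::
  "(real \<Rightarrow> real) \<Rightarrow> real set \<Rightarrow> (real \<Rightarrow> real) \<Rightarrow> real \<Rightarrow> ereal \<Rightarrow> bool" where
  "continuation f J F r_inf r_sup \<longleftrightarrow>
     0 \<le> r_inf \<and> J \<subseteq> radial_interval r_inf r_sup \<and>
     real_analytic_on (radial_interval r_inf r_sup) F \<and> (\<forall>r\<in>J. F r = f r)"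

definition maximal_continuation ::
  "(real \<Rightarrow> real) \<Rightarrow> real set \<Rightarrow> (real \<Rightarrow> real) \<Rightarrow> real \<Rightarrow> ereal \<Rightarrow> bool" where
  "maximal_continuation f J F r_inf r_sup \<longleftrightarrow>
     continuation f J F r_inf r_sup \<and>
     (\<forall>F' a b. continuation f J F' a b \<longrightarrow> r_inf \<le> a \<and> b \<le> r_sup)"

text \<open>The analytic continuation \<open>F\<close> of the potential lives on all positive radii below \<open>r_sup\<close>,
  it is smooth up to 0 (smoothness on a half-open interval being smoothness on an open
  neighbourhood), and it defines a Kaehler metric on the full ball, origin included. The type
  argument fixes the complex dimension.\<close>

definition potential_defined_at_origin ::
  "'n::finite itself \<Rightarrow> (real \<Rightarrow> real) \<Rightarrow> real set \<Rightarrow> bool" where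
  "potential_defined_at_origin TYPE('n) f J \<longleftrightarrow>
     (\<exists>F r_sup. maximal_continuation f J F 0 r_sup \<and>
        (\<exists>e>0. smooth_on (radial_interval (- e) r_sup) F) \<and>
        kaehler_metric {z::complex^'n. ereal ((norm z)\<^sup>2) < r_sup} (ddbar (\<lambda>w. F ((norm w)\<^sup>2))))"

subsection \<open>Infinite dimensional non-elliptic complex space forms\<close>

definition ell2 :: "(nat \<Rightarrow> complex) set" where
  "ell2 = {w. summable (\<lambda>k. (cmod (w k))\<^sup>2)}"

definition ell2_norm :: "(nat \<Rightarrow> complex) \<Rightarrow> real" where
  "ell2_norm w = sqrt (\<Sum>k. (cmod (w k))\<^sup>2)"

definition space_form :: "real \<Rightarrow> (nat \<Rightarrow> complex) set" where
  "space_form c = (if c = 0 then ell2 else {w \<in> ell2. ell2_norm w < 1})"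

definition space_form_potential :: "real \<Rightarrow> (nat \<Rightarrow> complex) \<Rightarrow> real" where
  "space_form_potential c w =
     (if c = 0 then (ell2_norm w)\<^sup>2 else 1 / c * ln (1 - (ell2_norm w)\<^sup>2))"

text \<open>The Hermitian form at \<open>w\<close> given by the complex Hessian of the potential.\<close>

definition space_form_metric ::
  "real \<Rightarrow> (nat \<Rightarrow> complex) \<Rightarrow> (nat \<Rightarrow> complex) \<Rightarrow> (nat \<Rightarrow> complex) \<Rightarrow> complex" where
  "space_form_metric c w u v =
     mixed_wirtinger (\<lambda>\<alpha> \<beta>. space_form_potential c (\<lambda>k. w k + \<alpha> * u k + \<beta> * v k))"

text \<open>Complex Frechet differentiability with respect to the norm of \<open>\<ell>\<^sup>2\<close>; a linear map on a
  finite dimensional space is automatically bounded.\<close>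

definition has_ell2_derivative ::
  "(complex^'n \<Rightarrow> nat \<Rightarrow> complex) \<Rightarrow> (complex^'n \<Rightarrow> nat \<Rightarrow> complex) \<Rightarrow> complex^'n \<Rightarrow> bool" where
  "has_ell2_derivative \<phi> L z \<longleftrightarrow>
     (\<forall>u. L u \<in> ell2) \<and>
     (\<forall>u v k. L (u + v) k = L u k + L v k) \<and>
     (\<forall>\<alpha> u k. L (\<alpha> *s u) k = \<alpha> * L u k) \<and>
     ((\<lambda>h. ell2_norm (\<lambda>k. \<phi> (z + h) k - \<phi> z k - L h k) / norm h) \<longlongrightarrow> 0) (at 0)"

definition kaehler_immersion ::
  "(complex^'n) set \<Rightarrow> (complex^'n \<Rightarrow> complex^'n^'n) \<Rightarrow> real \<Rightarrow> (complex^'n \<Rightarrow> nat \<Rightarrow> complex) \<Rightarrow> bool" where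
  "kaehler_immersion M H c \<phi> \<longleftrightarrow>
     \<phi> ` M \<subseteq> space_form c \<and>
     (\<forall>z\<in>M. \<exists>L. has_ell2_derivative \<phi> L z \<and>
        (\<forall>i j. H z $ i $ j = space_form_metric c (\<phi> z) (L (axis i 1)) (L (axis j 1))))"

end

theory Submission
  imports Defs "HOL-Complex_Analysis.Complex_Analysis"
begin

text \<open>Write \<open>g = f'\<close>, so that \<open>H = g \<delta>\<^sub>i\<^sub>j + g' cnj z\<^sub>i z\<^sub>j\<close>. Evaluating the metric on a vector orthogonal to
  \<open>p\<close> along the surface \<open>exp \<zeta> p + \<eta> v\<close>, an immersion into a flat space exhibits every derivative
  \<open>g\<^sup>(\<^sup>k\<^sup>)(|p|\<^sup>2 exp (2 Re \<zeta>))\<close> as a sum of squares of holomorphic functions of \<open>\<zeta>\<close>; the hyperbolic case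
  reduces to the flat one because \<open>- log (1 - x)\<close> has nonnegative coefficients. Hence, in the
  variable \<open>log r\<close>, the derivatives of \<open>g\<^sup>(\<^sup>k\<^sup>)\<close> form positive semidefinite Hankel matrices. This
  property survives analytic continuation and contains \<open>g\<^sup>(\<^sup>k\<^sup>) \<ge> 0\<close>, so Pringsheim's theorem
  continues \<open>g\<close> down to \<open>r = 0\<close>, where it has an expansion \<open>\<Sum> a\<^sub>k r\<^sup>k\<close> with \<open>a\<^sub>k \<ge> 0\<close>.

  Averaging the soliton equation over circles \<open>|\<eta>| = const\<close> gives
  \<open>- (log det H)' = \<lambda> g + (g (A + B r))'\<close>, a linear equation for \<open>det H\<close> whose coefficients are
  analytic at \<open>0\<close>. As \<open>det H\<close> is not identically zero, it does not vanish at \<open>0\<close>, that is \<open>a\<^sub>0 > 0\<close>.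
  Thus the metric is positive definite on the ball of convergence, and the radius of that ball is
  the maximal one, by Pringsheim's theorem again.\<close>

unbundle no fps_syntax

subsection \<open>Pringsheim's theorem\<close>

text \<open>Nonnegative derivatives alone do not lead to the origin. All derivatives of 1/(3/2 - r)
  - 1/r are nonnegative for 3/4 <= r < 3/2, yet this function is singular at 0: their sign need not
  persist to the left. The Hankel condition in log r can be transported in both directions. One
  transport inside the disc of radius log R - log y about log y reaches every y' > y^2 / R, and
  repeating this leaves no positive lower bound.

  The expansion at 0 does not yet settle the metric there. For f = r^2 the metric outside 0 is
  induced by a flat space, through the map with components z_i z_j, but it degenerates at 0. So it
  is the soliton equation that must exclude a vanishing constant term.

  The field X is not assumed to be radial. Restricting the equation to circles of constant radius
  and averaging removes everything from it but two real constants.\<close>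

lemma holomorphic_eq_if_eq_on_reals:
  fixes g h :: "complex \<Rightarrow> complex" and a b :: real
  assumes g: "g holomorphic_on S" and h: "h holomorphic_on S"
    and S: "open S" "connected S"
    and ab: "a < b" "\<And>x. a < x \<Longrightarrow> x < b \<Longrightarrow> complex_of_real x \<in> S"
    and eq: "\<And>x. a < x \<Longrightarrow> x < b \<Longrightarrow> g (of_real x) = h (of_real x)"
    and w: "w \<in> S"
  shows "g w = h w"
proof -
  define m where "m = (a + b) / 2"
  have m: "a < m" "m < b" using ab(1) by (auto simp: m_def)
  have "g w - h w = 0"
  proof (rule analytic_continuation[where f = "\<lambda>w. g w - h w" and S = S and \<xi> = "of_real m"
        and U = "complex_of_real ` {a<..<b}"])
    show "complex_of_real m islimpt complex_of_real ` {a<..<b}"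
    proof (rule islimpt_approachable[THEN iffD2], intro allI impI)
      fix e :: real assume e: "e > 0"
      define x where "x = m + min e (b - m) / 2"
      have "x \<in> {a<..<b}" "x \<noteq> m" "\<bar>x - m\<bar> < e"
        using m e unfolding x_def by (auto simp: min_def field_simps)
      then show "\<exists>x'\<in>complex_of_real ` {a<..<b}. x' \<noteq> of_real m \<and> dist x' (of_real m) < e"
        by (intro bexI[of _ "of_real x"]) (auto simp: dist_of_real dist_real_def)
    qed
  qed (use assms m in \<open>auto intro!: holomorphic_intros\<close>)
  then show ?thesis by simp
qed

lemma summable_diffs_funpow:
  fixes c :: "nat \<Rightarrow> 'a::{real_normed_field,banach}"
  assumes "\<And>z. norm z < r \<Longrightarrow> summable (\<lambda>k. c k * z ^ k)" and "norm z < r"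
  shows "summable (\<lambda>k. (diffs ^^ n) c k * z ^ k)"
  using assms(2)
proof (induction n arbitrary: z)
  case 0 then show ?case using assms(1) by simp
next
  case (Suc n)
  then show ?case using termdiff_converges[of z r "(diffs ^^ n) c"] by auto
qed

lemma higher_deriv_power_series:
  fixes c :: "nat \<Rightarrow> complex"
  assumes c: "\<And>z. norm z < r \<Longrightarrow> summable (\<lambda>k. c k * z ^ k)" and z: "norm z < r"
  shows "(deriv ^^ n) (\<lambda>z. \<Sum>k. c k * z ^ k) z = (\<Sum>k. (diffs ^^ n) c k * z ^ k)"
  using z
proof (induction n arbitrary: z)
  case 0 then show ?case by simp
next
  case (Suc n)
  have ev: "\<forall>\<^sub>F w in nhds z. (deriv ^^ n) (\<lambda>z. \<Sum>k. c k * z ^ k) w = (\<Sum>k. (diffs ^^ n) c k * w ^ k)"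
    using Suc by (intro eventually_nhds_in_open[of "ball 0 r" z, THEN eventually_mono]) auto
  have "(deriv ^^ Suc n) (\<lambda>z. \<Sum>k. c k * z ^ k) z = deriv (\<lambda>w. \<Sum>k. (diffs ^^ n) c k * w ^ k) z"
    using deriv_cong_ev[OF ev refl] by simp
  also have "\<dots> = (\<Sum>k. (diffs ^^ Suc n) c k * z ^ k)"
    using termdiffs_strong'[of r "(diffs ^^ n) c" z] summable_diffs_funpow[of r c] c Suc.prems
    by (auto intro!: DERIV_imp_deriv)
  finally show ?case .
qed

text \<open>\<open>diffs\<close> multiplies shifted coefficients by positive integers, so it
  preserves domination. This bounds the derivatives of a truncated series by those of the full
  one.\<close>

lemma diffs_funpow_mono:
  fixes a b :: "nat \<Rightarrow> real"
  assumes "\<And>k. 0 \<le> b k" "\<And>k. b k \<le> a k"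
  shows "0 \<le> (diffs ^^ n) b k \<and> (diffs ^^ n) b k \<le> (diffs ^^ n) a k"
  by (induction n arbitrary: k) (auto simp: assms diffs_def intro!: mult_left_mono)

lemma diffs_funpow_of_real:
  "(diffs ^^ n) (\<lambda>k. complex_of_real (a k)) k = of_real ((diffs ^^ n) a k)"
  by (induction n arbitrary: k) (auto simp: diffs_def)

lemma summable_of_real_power_series:
  fixes a :: "nat \<Rightarrow> real" and z :: complex
  assumes "\<And>x. 0 \<le> x \<Longrightarrow> x < r \<Longrightarrow> summable (\<lambda>k. a k * x ^ k)" and "norm z < r"
  shows "summable (\<lambda>k. of_real (a k) * z ^ k)"
proof -
  define x where "x = (norm z + r) / 2"
  have x: "norm z < x" "x < r" using assms(2) by (auto simp: x_def)
  have "0 \<le> norm z" by simp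
  with x have x0: "0 \<le> x" by linarith
  have "summable (\<lambda>k. complex_of_real (a k * x ^ k))"
    using assms(1)[OF x0 x(2)] by (rule summable_of_real)
  then have "summable (\<lambda>k. of_real (a k) * complex_of_real x ^ k)" by simp
  then show ?thesis by (rule powser_inside) (use x x0 in simp)
qed

lemma power_series_holomorphic_real:
  fixes a :: "nat \<Rightarrow> real"
  assumes "\<And>x. 0 \<le> x \<Longrightarrow> x < r \<Longrightarrow> summable (\<lambda>k. a k * x ^ k)"
  shows "(\<lambda>w. \<Sum>k. of_real (a k) * (w - z) ^ k) holomorphic_on ball z r"
proof (rule power_series_holomorphic)
  fix w assume "w \<in> ball z r"
  then have "summable (\<lambda>k. of_real (a k) * (w - z) ^ k)"
    by (intro summable_of_real_power_series[OF assms]) (auto simp: dist_norm norm_minus_commute)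
  then show "(\<lambda>k. of_real (a k) * (w - z) ^ k) sums (\<Sum>k. of_real (a k) * (w - z) ^ k)"
    by (rule summable_sums)
qed

lemma higher_deriv_power_series_real:
  fixes a :: "nat \<Rightarrow> real"
  assumes a: "\<And>x. 0 \<le> x \<Longrightarrow> x < r \<Longrightarrow> summable (\<lambda>k. a k * x ^ k)"
    and x: "0 \<le> x" "x < r"
  shows "(deriv ^^ n) (\<lambda>z. \<Sum>k. complex_of_real (a k) * z ^ k) (of_real x) =
    of_real (\<Sum>k. (diffs ^^ n) a k * x ^ k)" and "summable (\<lambda>k. (diffs ^^ n) a k * x ^ k)"
proof -
  have s: "summable (\<lambda>k. (diffs ^^ n) (\<lambda>k. complex_of_real (a k)) k * of_real x ^ k)"
    by (rule summable_diffs_funpow[where r = r])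
       (use x a summable_of_real_power_series[of r a] in auto)
  then have "summable (\<lambda>k. complex_of_real ((diffs ^^ n) a k * x ^ k))"
    by (simp add: diffs_funpow_of_real)
  then show s': "summable (\<lambda>k. (diffs ^^ n) a k * x ^ k)"
    by (simp only: summable_of_real_iff)
  have "(deriv ^^ n) (\<lambda>z. \<Sum>k. complex_of_real (a k) * z ^ k) (of_real x) =
      (\<Sum>k. (diffs ^^ n) (\<lambda>k. complex_of_real (a k)) k * of_real x ^ k)"
    by (rule higher_deriv_power_series[where r = r])
       (use x a summable_of_real_power_series[of r a] in auto)
  also have "\<dots> = of_real (\<Sum>k. (diffs ^^ n) a k * x ^ k)"
    by (simp add: diffs_funpow_of_real suminf_of_real[OF s'])
  finally show "(deriv ^^ n) (\<lambda>z. \<Sum>k. complex_of_real (a k) * z ^ k) (of_real x) =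
    of_real (\<Sum>k. (diffs ^^ n) a k * x ^ k)" .
qed

text \<open>Pringsheim: a power series with nonnegative coefficients is singular at the positive point
  of its circle of convergence. A partial sum has smaller Taylor coefficients than the whole
  series at a point inside the circle, so analyticity at the boundary point bounds the partial
  sums beyond it.\<close>

lemma pringsheim_boundary_point:
  fixes a :: "nat \<Rightarrow> real"
  assumes a: "\<And>k. 0 \<le> a k" and r: "0 < r"
    and sm: "\<And>x. 0 \<le> x \<Longrightarrow> x < r \<Longrightarrow> summable (\<lambda>k. a k * x ^ k)"
    and e: "0 < e" and g: "g holomorphic_on ball (of_real r) e"
    and eq: "\<And>x. 0 < x \<Longrightarrow> r - e < x \<Longrightarrow> x < r \<Longrightarrow> g (of_real x) = of_real (\<Sum>k. a k * x ^ k)"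
  shows "\<exists>x>r. summable (\<lambda>k. a k * x ^ k)"
proof -
  define e' where "e' = min e r"
  have e': "0 < e'" "e' \<le> e" "e' \<le> r" using e r by (auto simp: e'_def)
  define B where "B = ball (complex_of_real r) e'"
  have gB: "g holomorphic_on B"
    unfolding B_def by (rule holomorphic_on_subset[OF g]) (use e' in auto)
  \<comment> \<open>The disc of radius \<open>3 * e' / 4\<close> about \<open>x1\<close> stays in
    \<open>B\<close>, and it contains \<open>y\<close> because \<open>y - x1 = e' / 2\<close>. Thus
    the Taylor series of \<open>g\<close> at \<open>x1\<close> converges at a point beyond
    \<open>r\<close>.\<close>
  define x1 where "x1 = r - e' / 4"
  define y where "y = r + e' / 4"
  have x1: "0 < x1" "x1 < r" "r - e' < x1" using e' by (auto simp: x1_def)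
  define G where "G = (\<lambda>z. \<Sum>k. complex_of_real (a k) * z ^ k)"
  have Ghol: "G holomorphic_on ball 0 r"
    using power_series_holomorphic_real[of r a 0] sm by (simp add: G_def)
  have Greal: "G (of_real x) = of_real (\<Sum>k. a k * x ^ k)" if "0 \<le> x" "x < r" for x
    using higher_deriv_power_series_real(1)[of r a x 0] sm that by (simp add: G_def)
  have in0: "complex_of_real x \<in> ball 0 r" if "0 < x" "x < r" for x
    using that by simp
  have inB: "complex_of_real x \<in> B" if "r - e' < x" "x < r" for x
    using that by (simp add: B_def dist_of_real dist_real_def)
  have gG: "g w = G w" if "w \<in> B \<inter> ball 0 r" for w
  proof (rule holomorphic_eq_if_eq_on_reals[of g "B \<inter> ball 0 r" G "r - e'" r])
    show "connected (B \<inter> ball 0 r)"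
      unfolding B_def by (intro convex_connected convex_Int convex_ball)
    show "complex_of_real x \<in> B \<inter> ball 0 r" if "r - e' < x" "x < r" for x
      using in0 inB that e' by auto
    show "g (of_real x) = G (of_real x)" if "r - e' < x" "x < r" for x
    proof -
      have "0 < x" using that e' by linarith
      then show ?thesis using eq[of x] Greal[of x] that e' by auto
    qed
  qed (use gB Ghol that e' in \<open>auto simp: B_def intro: holomorphic_on_subset\<close>)
  have dG: "(deriv ^^ n) g (of_real x1) = of_real (\<Sum>k. (diffs ^^ n) a k * x1 ^ k)" for n
  proof -
    have ev: "\<forall>\<^sub>F w in nhds (complex_of_real x1). g w = G w"
      by (rule eventually_mono[OF eventually_nhds_in_open[of "B \<inter> ball 0 r"] gG])
         (use x1 inB in0 in \<open>auto simp: B_def\<close>)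
    have "(deriv ^^ n) g (of_real x1) = (deriv ^^ n) G (of_real x1)"
      by (rule higher_deriv_cong_ev[OF ev refl])
    then show ?thesis
      using higher_deriv_power_series_real(1)[of r a x1 n] sm x1 by (simp add: G_def)
  qed
  have yB: "complex_of_real y \<in> ball (of_real x1) (3 * e' / 4)"
    unfolding mem_ball dist_of_real dist_real_def using e' by (simp add: x1_def y_def)
  have sub: "ball (complex_of_real x1) (3 * e' / 4) \<subseteq> B"
    unfolding B_def by (rule ball_subset_ball_iff[THEN iffD2])
       (unfold dist_of_real dist_real_def, use e' in \<open>simp add: x1_def\<close>)
  have taylor: "(\<lambda>n. (\<Sum>k. (diffs ^^ n) a k * x1 ^ k) / fact n * (y - x1) ^ n) sums Re (g (of_real y))"
  proof -
    have "(\<lambda>n. (deriv ^^ n) g (of_real x1) / fact n * (of_real y - of_real x1) ^ n) sums g (of_real y)"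
      by (rule holomorphic_power_series[OF _ yB]) (use gB sub in \<open>rule holomorphic_on_subset\<close>)
    also have "(\<lambda>n. (deriv ^^ n) g (of_real x1) / fact n * (of_real y - of_real x1) ^ n) =
        (\<lambda>n. complex_of_real ((\<Sum>k. (diffs ^^ n) a k * x1 ^ k) / fact n * (y - x1) ^ n))"
      by (simp add: dG)
    finally have "(\<lambda>n. complex_of_real ((\<Sum>k. (diffs ^^ n) a k * x1 ^ k) / fact n * (y - x1) ^ n)) sums g (of_real y)" .
    from sums_Re[OF this] show ?thesis by (simp only: Re_complex_of_real)
  qed
  have bound: "(\<Sum>k<N. a k * y ^ k) \<le> Re (g (of_real y))" for N
  proof -
    \<comment> \<open>Truncating the coefficients keeps the partial sum in the form of a power
      series, so both families of Taylor coefficients at \<open>x1\<close> are given by iterated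
      \<open>diffs\<close> and can be compared.\<close>
    define b where "b = (\<lambda>k. if k < N then a k else 0)"
    have bs: "(\<lambda>k. complex_of_real (b k) * z ^ k) sums (\<Sum>k<N. of_real (a k) * z ^ k)" for z
    proof -
      have "(\<lambda>k. if k \<in> {..<N} then complex_of_real (a k) * z ^ k else 0) sums (\<Sum>k\<in>{..<N}. of_real (a k) * z ^ k)"
        by (rule sums_If_finite_set) simp
      also have "(\<lambda>k. if k \<in> {..<N} then complex_of_real (a k) * z ^ k else 0) = (\<lambda>k. complex_of_real (b k) * z ^ k)"
        by (auto simp: b_def)
      finally show ?thesis .
    qed
    have bsm: "summable (\<lambda>k. b k * x ^ k)" for x
      by (rule summable_finite[of "{..<N}"]) (auto simp: b_def)
    have h: "(\<lambda>z. \<Sum>k. complex_of_real (b k) * z ^ k) holomorphic_on UNIV"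
      using bs[THEN sums_unique, symmetric] by (auto intro!: holomorphic_intros)
    have "(\<lambda>n. (deriv ^^ n) (\<lambda>z. \<Sum>k. complex_of_real (b k) * z ^ k) (of_real x1) / fact n * (of_real y - of_real x1) ^ n)
        sums (\<Sum>k. complex_of_real (b k) * of_real y ^ k)"
      by (rule holomorphic_power_series[OF _ yB]) (use h in \<open>auto intro: holomorphic_on_subset\<close>)
    also have "(\<lambda>n. (deriv ^^ n) (\<lambda>z. \<Sum>k. complex_of_real (b k) * z ^ k) (of_real x1) / fact n * (of_real y - of_real x1) ^ n) =
        (\<lambda>n. complex_of_real ((\<Sum>k. (diffs ^^ n) b k * x1 ^ k) / fact n * (y - x1) ^ n))"
      using higher_deriv_power_series_real(1)[of "x1 + 1" b x1] bsm x1 by simp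
    also have "(\<Sum>k. complex_of_real (b k) * of_real y ^ k) = of_real (\<Sum>k<N. a k * y ^ k)"
      using bs[THEN sums_unique, symmetric, of "of_real y"] by simp
    finally have bsums: "(\<lambda>n. (\<Sum>k. (diffs ^^ n) b k * x1 ^ k) / fact n * (y - x1) ^ n) sums (\<Sum>k<N. a k * y ^ k)"
      by (simp only: sums_of_real_iff)
    have mono: "(\<Sum>k. (diffs ^^ n) b k * x1 ^ k) \<le> (\<Sum>k. (diffs ^^ n) a k * x1 ^ k)" for n
    proof (rule suminf_le)
      show "(diffs ^^ n) b k * x1 ^ k \<le> (diffs ^^ n) a k * x1 ^ k" for k
        using diffs_funpow_mono[of b a n k] a x1 by (auto simp: b_def intro!: mult_right_mono)
      show "summable (\<lambda>k. (diffs ^^ n) b k * x1 ^ k)"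
        using higher_deriv_power_series_real(2)[of "x1 + 1" b x1] bsm x1 by auto
      show "summable (\<lambda>k. (diffs ^^ n) a k * x1 ^ k)"
        using higher_deriv_power_series_real(2)[of r a x1] sm x1 by auto
    qed
    from mono have "(\<Sum>k. (diffs ^^ n) b k * x1 ^ k) / fact n * (y - x1) ^ n \<le>
        (\<Sum>k. (diffs ^^ n) a k * x1 ^ k) / fact n * (y - x1) ^ n" for n
      using e' by (intro mult_right_mono divide_right_mono zero_le_power) (auto simp: x1_def y_def)
    then show ?thesis
      using sums_le[OF _ bsums taylor] by blast
  qed
  have "summable (\<lambda>k. a k * y ^ k)"
    by (rule summableI_nonneg_bounded[OF _ bound]) (use a e' r in \<open>auto simp: y_def\<close>)
  then show ?thesis using e' by (intro exI[of _ y]) (auto simp: y_def)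
qed

text \<open>If the radius of convergence at \<open>y\<close> were smaller than \<open>R - y\<close>,
  its positive boundary point would lie on the given segment, where \<open>g\<close> is holomorphic,
  and \<open>pringsheim_boundary_point\<close> would enlarge the radius. Convexity of
  \<open>S\<close> makes its intersection with the disc connected, so the series represents
  \<open>g\<close> on all of it.\<close>

theorem pringsheim:
  fixes g :: "complex \<Rightarrow> complex" and y R :: real
  assumes g: "g holomorphic_on S" and S: "open S" "convex S"
    and yR: "y < R" and seg: "\<And>x. y \<le> x \<Longrightarrow> x < R \<Longrightarrow> complex_of_real x \<in> S"
    and nn: "\<And>k. (deriv ^^ k) g (of_real y) \<in> \<real>\<^sub>\<ge>\<^sub>0"
  obtains a where "\<And>k. 0 \<le> a k" "\<And>k. (deriv ^^ k) g (of_real y) = of_real (fact k * a k)"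
    "\<And>x. 0 \<le> x \<Longrightarrow> x < R - y \<Longrightarrow> summable (\<lambda>k. a k * x ^ k)"
    "\<And>w. w \<in> S \<Longrightarrow> w \<in> ball (of_real y) (R - y) \<Longrightarrow>
       (\<lambda>k. of_real (a k) * (w - of_real y) ^ k) sums g w"
proof -
  define a where "a k = Re ((deriv ^^ k) g (of_real y)) / fact k" for k
  have a0: "0 \<le> a k" for k using nn[of k] by (simp add: a_def complex_nonneg_Reals_iff)
  have da: "(deriv ^^ k) g (of_real y) = of_real (fact k * a k)" for k
    using nn[of k] by (simp add: a_def complex_nonneg_Reals_iff complex_eq_iff)
  obtain d where d: "d > 0" "ball (of_real y) d \<subseteq> S"
    using S(1) seg[of y] yR openE by (metis order_refl)
  have near: "(\<lambda>k. of_real (a k) * (w - of_real y) ^ k) sums g w" if "w \<in> ball (of_real y) d" for w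
    using holomorphic_power_series[OF holomorphic_on_subset[OF g d(2)] that] by (simp add: da)
  have disc: "(\<lambda>k. of_real (a k) * (w - of_real y) ^ k) sums g w"
    if sm: "\<And>x. 0 \<le> x \<Longrightarrow> x < r \<Longrightarrow> summable (\<lambda>k. a k * x ^ k)" and w: "w \<in> S" "w \<in> ball (of_real y) r"
    for r w
  proof -
    define G where "G = (\<lambda>w. \<Sum>k. complex_of_real (a k) * (w - of_real y) ^ k)"
    have Gh: "G holomorphic_on ball (of_real y) r"
      unfolding G_def by (rule power_series_holomorphic_real[OF sm])
    have r: "0 < r" using w(2) using zero_le_dist[of "of_real y" w] by (auto simp del: zero_le_dist)
    define T where "T = S \<inter> ball (of_real y) r"
    have yT: "complex_of_real y \<in> T" using r seg[of y] yR by (auto simp: T_def)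
    have "G w = g w"
    proof (rule analytic_continuation_open[of "T \<inter> ball (of_real y) d" T G g])
      show "connected T"
        unfolding T_def by (intro convex_connected convex_Int S convex_ball)
      show "T \<inter> ball (of_real y) d \<noteq> {}" using yT d by auto
      show "G z = g z" if "z \<in> T \<inter> ball (of_real y) d" for z
        using near[of z] that by (auto simp: G_def sums_iff)
      show "G holomorphic_on T" "g holomorphic_on T"
        using Gh g by (auto simp: T_def intro: holomorphic_on_subset)
    qed (use w S in \<open>auto simp: T_def\<close>)
    moreover have "summable (\<lambda>k. of_real (a k) * (w - of_real y) ^ k)"
      using w(2) by (intro summable_of_real_power_series[OF sm]) (auto simp: dist_norm norm_minus_commute)
    ultimately show ?thesis by (simp add: G_def sums_iff)
  qed
  have sm: "summable (\<lambda>k. a k * x ^ k)" if x: "0 \<le> x" "x < R - y" for x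
  proof (rule ccontr)
    assume ns: "\<not> summable (\<lambda>k. a k * x ^ k)"
    have le: "conv_radius a \<le> x"
      using ns x summable_in_conv_radius[of x a] by (simp add: not_less[symmetric]) blast
    define r where "r = real_of_ereal (conv_radius a)"
    have r: "conv_radius a = ereal r"
      using le conv_radius_nonneg[of a] by (cases "conv_radius a") (auto simp: r_def)
    have "d / 2 \<le> conv_radius a"
    proof (rule conv_radius_geI_ex'[THEN order_trans[rotated]])
      show "summable (\<lambda>n. a n * of_real r ^ n)" if "0 < r" "ereal r < ereal (d / 2)" for r
      proof -
        have "complex_of_real (y + r) \<in> ball (of_real y) d"
          using that by (simp add: dist_norm)
        from sums_summable[OF near[OF this]] have "summable (\<lambda>k. complex_of_real (a k * r ^ k))"
          by simp
        then show ?thesis by (simp only: summable_of_real_iff) simp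
      qed
    qed simp
    with r d have r0: "0 < r" by simp
    have rR: "r < R - y" using le r x by simp
    have smr: "summable (\<lambda>k. a k * x ^ k)" if "0 \<le> x" "x < r" for x
      using summable_in_conv_radius[of x a] that r by simp
    have "complex_of_real (y + r) \<in> S" using seg[of "y + r"] r0 rR by simp
    then obtain e where e: "e > 0" "ball (of_real (y + r)) e \<subseteq> S" using S(1) openE by blast
    have "\<exists>x>r. summable (\<lambda>k. a k * x ^ k)"
    proof (rule pringsheim_boundary_point[OF a0 r0 smr e(1), of "\<lambda>w. g (of_real y + w)"])
      show "(\<lambda>w. g (of_real y + w)) holomorphic_on ball (of_real r) e"
        by (rule holomorphic_on_compose_gen[OF _ g, unfolded o_def])
           (use e in \<open>auto intro!: holomorphic_intros simp: subset_iff dist_norm algebra_simps\<close>)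
      fix x assume x: "0 < x" "r - e < x" "x < r"
      have "(\<lambda>k. of_real (a k) * (complex_of_real (y + x) - of_real y) ^ k) sums g (of_real (y + x))"
        by (rule disc[OF smr]) (use x seg[of "y + x"] rR in \<open>auto simp: dist_norm\<close>)
      then have "(\<lambda>k. complex_of_real (a k * x ^ k)) sums g (of_real (y + x))" by simp
      moreover have "(\<lambda>k. complex_of_real (a k * x ^ k)) sums of_real (\<Sum>k. a k * x ^ k)"
        using smr[of x] x by (intro sums_of_real summable_sums) auto
      ultimately show "g (of_real y + of_real x) = of_real (\<Sum>k. a k * x ^ k)"
        using sums_unique2 by fastforce
    qed auto
    then obtain x' where "x' > r" "summable (\<lambda>k. a k * x' ^ k)" by auto
    then have "ereal (norm x') \<le> conv_radius a" by (intro conv_radius_geI)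
    with r \<open>x' > r\<close> r0 show False by simp
  qed
  show thesis by (rule that[OF a0 da sm disc[OF sm]])
qed

subsection \<open>Positive semidefinite Hankel matrices of derivatives\<close>

lemma binomial_fact_sum:
  fixes x y :: "'a::{real_normed_field}"
  shows "(\<Sum>i\<le>p. x ^ i * y ^ (p - i) / (fact i * fact (p - i))) = (x + y) ^ p / fact p"
proof -
  have "(x + y) ^ p / fact p = (\<Sum>i\<le>p. of_nat (p choose i) * x ^ i * y ^ (p - i) / fact p)"
    by (simp add: binomial_ring sum_divide_distrib)
  also have "\<dots> = (\<Sum>i\<le>p. x ^ i * y ^ (p - i) / (fact i * fact (p - i)))"
    by (intro sum.cong refl) (simp add: binomial_fact)
  finally show ?thesis by simp
qed

lemma bij_betw_antidiagonals:
  "bij_betw (\<lambda>(p, i). (i, p - i)) (SIGMA p:UNIV. {..p}) (UNIV :: (nat \<times> nat) set)"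
  by (rule bij_betw_byWitness[where f' = "\<lambda>(i, j). (i + j, i)"]) auto

lemma has_sum_antidiagonals:
  fixes f :: "nat \<times> nat \<Rightarrow> 'a::{topological_comm_monoid_add, t3_space}"
  assumes "(f has_sum S) UNIV"
  shows "((\<lambda>p. \<Sum>i\<le>p. f (i, p - i)) has_sum S) UNIV"
proof -
  have "((\<lambda>(p, i). f (i, p - i)) has_sum S) (SIGMA p:UNIV. {..p})"
    using has_sum_reindex_bij_betw[OF bij_betw_antidiagonals, of f S] assms
    by (simp add: case_prod_unfold)
  then show ?thesis
    by (rule has_sum_SigmaD) (auto intro: has_sum_finiteI)
qed

text \<open>Absolute convergence justifies sorting the pairs by \<open>i + j\<close>. With
  \<open>y = cnj x\<close> this splits a Taylor series in \<open>2 * Re x\<close> into powers of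
  \<open>x\<close> and \<open>cnj x\<close>. With \<open>x = y\<close> it writes the exponential of
  a shift as the square of the exponential of half the shift.\<close>

lemma has_sum_binomial_pairs:
  fixes A :: "nat \<Rightarrow> complex" and x y :: complex
  assumes "summable (\<lambda>p. norm (A p) * (norm x + norm y) ^ p / fact p)"
  shows "((\<lambda>(i, j). A (i + j) * x ^ i * y ^ j / (fact i * fact j)) has_sum
    (\<Sum>p. A p * (x + y) ^ p / fact p)) UNIV"
proof -
  define F where "F = (\<lambda>(i, j). A (i + j) * x ^ i * y ^ j / (fact i * fact j))"
  define T where "T = (SIGMA p:UNIV. {..p::nat})"
  define F' where "F' = (\<lambda>(p, i). F (i, p - i))"
  have inner: "(\<Sum>i\<le>p. F' (p, i)) = A p * (x + y) ^ p / fact p" for p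
    using binomial_fact_sum[of x y p]
    by (simp add: F'_def F_def mult.assoc sum_distrib_left[symmetric] times_divide_eq_right[symmetric] del: times_divide_eq_right)
  have innern: "(\<Sum>i\<le>p. norm (F' (p, i))) = norm (A p) * (norm x + norm y) ^ p / fact p" for p
    using binomial_fact_sum[of "norm x" "norm y" p]
    by (simp add: F'_def F_def norm_mult norm_divide norm_power mult.assoc sum_distrib_left[symmetric]
        times_divide_eq_right[symmetric] del: times_divide_eq_right)
  have "(\<lambda>p. norm (A p) * (norm x + norm y) ^ p / fact p) summable_on UNIV"
    using assms by (intro summable_nonneg_imp_summable_on) auto
  then have "(\<lambda>x. norm (F' x)) summable_on T"
    unfolding T_def by (subst Infinite_Sum.abs_summable_on_Sigma_iff) (simp add: innern)
  then have sF: "F' summable_on T" by (rule abs_summable_summable)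
  then have hF: "(F' has_sum (infsum F' T)) T" by simp
  have "((\<lambda>p. A p * (x + y) ^ p / fact p) has_sum (infsum F' T)) UNIV"
  proof (rule has_sum_SigmaD)
    show "(F' has_sum infsum F' T) (SIGMA p:UNIV. {..p})" using hF by (simp add: T_def)
    show "((\<lambda>i. F' (p, i)) has_sum A p * (x + y) ^ p / fact p) {..p}" for p
      by (rule has_sum_finiteI) (auto simp: inner)
  qed
  from has_sum_imp_sums[OF this] have "infsum F' T = (\<Sum>p. A p * (x + y) ^ p / fact p)"
    by (simp add: sums_iff)
  moreover have "(F has_sum (infsum F' T)) UNIV"
    using has_sum_reindex_bij_betw[OF bij_betw_antidiagonals, of F "infsum F' T"] hF
    by (simp add: case_prod_unfold F'_def T_def)
  ultimately show ?thesis by (simp add: F_def)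
qed

text \<open>Positive semidefiniteness of the infinite Hankel matrix of derivatives at \<open>t\<close>; this says
  that \<open>H (t + a + b)\<close> is a positive definite kernel in the real variables \<open>a\<close>, \<open>b\<close> near 0.\<close>

definition hankel_psd :: "(complex \<Rightarrow> complex) \<Rightarrow> complex \<Rightarrow> bool" where
  "hankel_psd H t \<longleftrightarrow> (\<forall>N (c :: nat \<Rightarrow> real).
     (\<Sum>i<N. \<Sum>j<N. of_real (c i * c j) * (deriv ^^ (i + j)) H t) \<in> \<real>\<^sub>\<ge>\<^sub>0)"

lemma hankel_psd_nonneg: "hankel_psd H t \<Longrightarrow> H t \<in> \<real>\<^sub>\<ge>\<^sub>0"
  unfolding hankel_psd_def by (drule spec[of _ 1], drule spec[of _ "\<lambda>_. 1"]) simp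

lemma filterlim_square_finite_subsets:
  "filterlim (\<lambda>N. {..<N} \<times> {..<N}) (finite_subsets_at_top (UNIV :: (nat \<times> nat) set)) sequentially"
  unfolding filterlim_finite_subsets_at_top
proof (intro allI impI)
  fix X :: "(nat \<times> nat) set" assume X: "finite X \<and> X \<subseteq> UNIV"
  then have "finite (fst ` X \<union> snd ` X)" by blast
  then obtain m where m: "\<And>k. k \<in> fst ` X \<union> snd ` X \<Longrightarrow> k < m"
    using finite_nat_set_iff_bounded by metis
  have "X \<subseteq> {..<N} \<times> {..<N}" if "N \<ge> m" for N
  proof
    fix z assume "z \<in> X"
    then have "fst z < m" "snd z < m" using m by auto
    then show "z \<in> {..<N} \<times> {..<N}" using that by (cases z) auto
  qed
  then have "\<forall>\<^sub>F N in sequentially. X \<subseteq> {..<N} \<times> {..<N}"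
    by (rule eventually_sequentiallyI)
  then show "\<forall>\<^sub>F N in sequentially. finite ({..<N} \<times> {..<N}) \<and> X \<subseteq> {..<N} \<times> {..<N} \<and> {..<N} \<times> {..<N} \<subseteq> UNIV"
    by (rule eventually_mono) simp
qed

text \<open>Square truncations matter because the Hankel quadratic form sums over a square of
  indices.\<close>

lemma has_sum_imp_tendsto_squares:
  assumes "((\<lambda>(i, j). f i j) has_sum S) (UNIV :: (nat \<times> nat) set)"
  shows "(\<lambda>N. \<Sum>i<N. \<Sum>j<N. f i j) \<longlonglongrightarrow> S"
  using filterlim_compose[OF assms[unfolded has_sum_def] filterlim_square_finite_subsets]
  by (simp add: sum.cartesian_product)

text \<open>Shifting the base point by \<open>d\<close> multiplies the moment functional by \<open>exp (d D)\<close>, where \<open>D\<close>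
  denotes differentiation; this is the limit of the squares of the Taylor polynomials
  of \<open>exp (d D / 2)\<close>.\<close>

lemma hankel_psd_shift:
  assumes H: "H holomorphic_on ball t s" and psd: "hankel_psd H t" and d: "\<bar>d\<bar> < s"
  shows "hankel_psd H (t + of_real d)"
  unfolding hankel_psd_def
proof (intro allI)
  fix N :: nat and c :: "nat \<Rightarrow> real"
  define e where "e = complex_of_real (d / 2)"
  define A where "A n p = (deriv ^^ (n + p)) H t" for n p
  have lim: "(\<lambda>K. \<Sum>l<K. \<Sum>l'<K. A n (l + l') * e ^ l * e ^ l' / (fact l * fact l')) \<longlonglongrightarrow>
      (deriv ^^ n) H (t + of_real d)" for n
  proof -
    define s' where "s' = (\<bar>d\<bar> + s) / 2"
    have s': "\<bar>d\<bar> < s'" "s' < s" using d by (auto simp: s'_def)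
    have hol: "(deriv ^^ n) H holomorphic_on ball t s"
      by (intro holomorphic_higher_deriv H) auto
    have comp: "(deriv ^^ l) ((deriv ^^ n) H) t = A n l" for l
      by (simp add: A_def funpow_add add.commute[of n l])
    have ser: "(\<lambda>l. A n l / fact l * of_real x ^ l) sums (deriv ^^ n) H (t + of_real x)" if "\<bar>x\<bar> < s" for x
      using holomorphic_power_series[OF hol, of "t + of_real x"] that
      by (simp add: comp dist_norm)
    have "summable (\<lambda>l. norm (A n l / fact l * of_real d ^ l))"
      using sums_summable[OF ser[of s']] s' by (intro powser_insidea[where x = "of_real s'"]) auto
    then have "summable (\<lambda>l. norm (A n l) * (norm e + norm e) ^ l / fact l)"
      by (simp add: e_def norm_mult norm_divide norm_power power_abs mult_ac)
    from has_sum_imp_tendsto_squares[OF has_sum_binomial_pairs[OF this]]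
    have "(\<lambda>K. \<Sum>l<K. \<Sum>l'<K. A n (l + l') * e ^ l * e ^ l' / (fact l * fact l'))
       \<longlonglongrightarrow> (\<Sum>p. A n p * (e + e) ^ p / fact p)" .
    also have "(\<Sum>p. A n p * (e + e) ^ p / fact p) = (deriv ^^ n) H (t + of_real d)"
      using ser[OF d] by (simp add: e_def sums_iff)
    finally show ?thesis .
  qed
  have lim2: "(\<lambda>K. \<Sum>i<N. \<Sum>j<N. of_real (c i * c j) *
          (\<Sum>l<K. \<Sum>l'<K. A (i + j) (l + l') * e ^ l * e ^ l' / (fact l * fact l')))
      \<longlonglongrightarrow> (\<Sum>i<N. \<Sum>j<N. of_real (c i * c j) * (deriv ^^ (i + j)) H (t + of_real d))"
    by (intro tendsto_intros lim)
  have mem: "(\<Sum>i<N. \<Sum>j<N. of_real (c i * c j) *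
        (\<Sum>l<K. \<Sum>l'<K. A (i + j) (l + l') * e ^ l * e ^ l' / (fact l * fact l'))) \<in> \<real>\<^sub>\<ge>\<^sub>0" for K
  proof -
    \<comment> \<open>\<open>c'\<close> lists the coefficients of the product of the polynomial with
      coefficients \<open>c\<close> and the truncated exponential series of \<open>d / 2\<close>.
      The Hankel form at \<open>t\<close>, evaluated on \<open>c'\<close>, is therefore the
      truncated form at the shifted point.\<close>
    define w where "w i l = c i * (d / 2) ^ l / fact l" for i l
    define c' where "c' a = (\<Sum>(i, l)\<in>{..<N} \<times> {..<K}. if i + l = a then w i l else 0)" for a
    have red: "(\<Sum>a<N+K. of_real (c' a) * g a) = (\<Sum>(i, l)\<in>{..<N} \<times> {..<K}. of_real (w i l) * g (i + l))"
      for g :: "nat \<Rightarrow> complex"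
    proof -
      have "(\<Sum>a<N+K. of_real (c' a) * g a) =
          (\<Sum>a<N+K. \<Sum>q\<in>{..<N} \<times> {..<K}. if a = fst q + snd q then of_real (w (fst q) (snd q)) * g a else 0)"
        unfolding c'_def
        by (auto simp: case_prod_unfold sum_distrib_right intro!: sum.cong)
      also have "\<dots> = (\<Sum>q\<in>{..<N} \<times> {..<K}. \<Sum>a<N+K. if a = fst q + snd q then of_real (w (fst q) (snd q)) * g a else 0)"
        by (rule sum.swap)
      also have "\<dots> = (\<Sum>(i, l)\<in>{..<N} \<times> {..<K}. of_real (w i l) * g (i + l))"
        by (intro sum.cong refl) (auto simp: sum.delta)
      finally show ?thesis .
    qed
    have "(\<Sum>a<N+K. \<Sum>b<N+K. of_real (c' a * c' b) * (deriv ^^ (a + b)) H t) =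
        (\<Sum>a<N+K. of_real (c' a) * (\<Sum>b<N+K. of_real (c' b) * (deriv ^^ (a + b)) H t))"
      by (simp add: sum_distrib_left mult.assoc)
    also have "\<dots> = (\<Sum>(i, l)\<in>{..<N} \<times> {..<K}. \<Sum>(j, l')\<in>{..<N} \<times> {..<K}.
        of_real (w i l * w j l') * A (i + j) (l + l'))"
      unfolding red
      by (intro sum.cong refl) (auto simp: A_def sum_distrib_left ac_simps intro!: sum.cong)
    also have "\<dots> = (\<Sum>i<N. \<Sum>l<K. \<Sum>j<N. \<Sum>l'<K. of_real (w i l * w j l') * A (i + j) (l + l'))"
      by (simp only: sum.cartesian_product[symmetric])
    also have "\<dots> = (\<Sum>i<N. \<Sum>j<N. \<Sum>l<K. \<Sum>l'<K. of_real (w i l * w j l') * A (i + j) (l + l'))"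
      by (intro sum.cong refl sum.swap)
    also have "\<dots> = (\<Sum>i<N. \<Sum>j<N. of_real (c i * c j) *
        (\<Sum>l<K. \<Sum>l'<K. A (i + j) (l + l') * e ^ l * e ^ l' / (fact l * fact l')))"
      unfolding sum_distrib_left
      by (intro sum.cong refl) (simp add: w_def e_def)
    finally show ?thesis
      using psd[unfolded hankel_psd_def, rule_format, where N = "N + K" and c = c']
      by (rule subst[where P = "\<lambda>z. z \<in> \<real>\<^sub>\<ge>\<^sub>0"])
  qed
  show "(\<Sum>i<N. \<Sum>j<N. of_real (c i * c j) * (deriv ^^ (i + j)) H (t + of_real d)) \<in> \<real>\<^sub>\<ge>\<^sub>0"
    by (rule closed_sequentially[OF closed_nonneg_Reals_complex mem lim2])
qed

lemma norm_exp_minus_one_le: "norm (exp z - 1) \<le> exp (norm z) - 1" for z :: complex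
proof -
  have "(\<lambda>n. z ^ n /\<^sub>R fact n) sums exp z" by (rule exp_converges)
  then have 1: "(\<lambda>n. z ^ Suc n /\<^sub>R fact (Suc n)) sums (exp z - 1)"
    by (subst sums_Suc_iff) simp
  have "(\<lambda>n. norm z ^ n /\<^sub>R fact n) sums exp (norm z)" by (rule exp_converges)
  then have 2: "(\<lambda>n. norm z ^ Suc n /\<^sub>R fact (Suc n)) sums (exp (norm z) - 1)"
    by (subst sums_Suc_iff) simp
  have eq: "norm (z ^ Suc n /\<^sub>R fact (Suc n)) = norm z ^ Suc n /\<^sub>R fact (Suc n)" for n
    by (simp only: norm_scaleR norm_power real_scaleR_def) simp
  have "summable (\<lambda>n. norm (z ^ Suc n /\<^sub>R fact (Suc n)))"
    unfolding eq using 2 by (rule sums_summable)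
  from summable_norm[OF this] show ?thesis
    unfolding eq using 1 2 by (simp only: sums_iff)
qed

text \<open>The estimate of \<open>exp z - 1\<close> is sharp for positive \<open>z\<close>, so the
  two discs have matching right ends: \<open>ln R\<close> goes to \<open>R\<close>. This makes
  \<open>ln R - ln y\<close> the admissible length of a shift.\<close>

lemma exp_maps_ball:
  fixes y R :: real
  assumes "0 < y" "y < R" "\<tau> \<in> ball (of_real (ln y)) (ln R - ln y)"
  shows "exp \<tau> \<in> ball (complex_of_real y) (R - y)"
proof -
  define z where "z = \<tau> - of_real (ln y)"
  have z: "norm z < ln R - ln y" using assms(3) by (simp add: z_def dist_norm norm_minus_commute)
  have "exp \<tau> = exp (complex_of_real (ln y)) * exp z" by (simp add: z_def flip: exp_add)
  also have "exp (complex_of_real (ln y)) = of_real y"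
    using assms(1) by (metis exp_ln exp_of_real)
  finally have "exp \<tau> - of_real y = of_real y * (exp z - 1)" by (simp add: algebra_simps)
  then have "norm (exp \<tau> - of_real y) = y * norm (exp z - 1)"
    using assms(1) by (simp add: norm_mult)
  also have "\<dots> \<le> y * (exp (norm z) - 1)"
    using assms(1) by (intro mult_left_mono norm_exp_minus_one_le) auto
  also have "\<dots> < y * (exp (ln R - ln y) - 1)"
    using assms(1) z by simp
  also have "\<dots> = R - y" using assms(1,2) by (simp add: exp_diff field_simps)
  finally show ?thesis by (simp add: dist_norm norm_minus_commute)
qed

section \<open>Continuation towards the origin\<close>

lemma hankel_psd_cong:
  assumes "\<forall>\<^sub>F \<tau> in nhds t. H \<tau> = H' \<tau>" and "hankel_psd H t"
  shows "hankel_psd H' t"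
  using assms(2) unfolding hankel_psd_def higher_deriv_cong_ev[OF assms(1) refl] .

text \<open>The derivatives are taken in the original variable, where Pringsheim's theorem wants
  them nonnegative. Positivity is tested in the logarithm of that variable, in which the base point
  can be moved.\<close>

definition all_hankel_psd :: "(complex \<Rightarrow> complex) \<Rightarrow> real \<Rightarrow> bool" where
  "all_hankel_psd P x \<longleftrightarrow> (\<forall>k. hankel_psd (\<lambda>\<tau>. (deriv ^^ k) P (exp \<tau>)) (of_real (ln x)))"

lemma all_hankel_psd_nonneg:
  assumes "all_hankel_psd P x" "0 < x"
  shows "(deriv ^^ k) P (of_real x) \<in> \<real>\<^sub>\<ge>\<^sub>0"
proof -
  have "exp (complex_of_real (ln x)) = of_real x" using assms(2) by (metis exp_ln exp_of_real)
  then show ?thesis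
    using hankel_psd_nonneg[of "\<lambda>\<tau>. (deriv ^^ k) P (exp \<tau>)" "of_real (ln x)"] assms(1)
    by (simp add: all_hankel_psd_def)
qed

text \<open>The condition \<open>y\<^sup>2 / R < y'\<close> means
  \<open>ln y - ln y' < ln R - ln y\<close>. The real points from \<open>y'\<close> up to
  \<open>R\<close> already lie in the old disc, so Pringsheim's theorem applies to \<open>P\<close>
  itself; its series at \<open>y'\<close> defines \<open>P'\<close> on the larger disc.\<close>

lemma hankel_extension_step:
  fixes y y' R :: real
  assumes P: "P holomorphic_on ball (of_real y) (R - y)" and y: "0 < y" "y < R"
    and psd: "all_hankel_psd P y" and y': "y\<^sup>2 / R < y'" "y' \<le> y"
  obtains P' where "P' holomorphic_on ball (of_real y') (R - y')"
    "\<And>w. w \<in> ball (of_real y) (R - y) \<Longrightarrow> P' w = P w" "all_hankel_psd P' y'"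
proof -
  have R: "0 < R" using y by simp
  have "0 < y\<^sup>2 / R" using y R by simp
  with y' have y'0: "0 < y'" by linarith
  define S where "S = ball (complex_of_real y) (R - y)"
  define d where "d = ln y' - ln y"
  have "y * y < y' * R" using y'(1) R by (simp add: field_simps power2_eq_square)
  then have "ln (y * y) < ln (y' * R)" using y y'0 R by (subst ln_less_cancel_iff) auto
  moreover have "ln y' \<le> ln y" using y' y'0 by simp
  ultimately have d: "\<bar>d\<bar> < ln R - ln y" using y y'0 R by (simp add: d_def ln_mult)
  have inb: "of_real (ln y') \<in> ball (complex_of_real (ln y)) (ln R - ln y)"
    using d unfolding mem_ball dist_of_real dist_real_def d_def by linarith
  have ey': "exp (complex_of_real (ln y')) = of_real y'" using y'0 by (metis exp_ln exp_of_real)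
  have y'S: "complex_of_real y' \<in> S"
    using exp_maps_ball[OF y inb] by (simp add: ey' S_def)
  have psd': "all_hankel_psd P y'"
    unfolding all_hankel_psd_def
  proof
    fix k
    have "(\<lambda>\<tau>. (deriv ^^ k) P (exp \<tau>)) holomorphic_on ball (of_real (ln y)) (ln R - ln y)"
      by (rule holomorphic_on_compose_gen[of exp _ "(deriv ^^ k) P", unfolded o_def])
         (use exp_maps_ball[OF y] P in \<open>auto intro!: holomorphic_intros\<close>)
    from hankel_psd_shift[OF this _ d] show "hankel_psd (\<lambda>\<tau>. (deriv ^^ k) P (exp \<tau>)) (of_real (ln y'))"
      using psd by (simp add: all_hankel_psd_def d_def)
  qed
  have seg: "complex_of_real x \<in> S" if "y' \<le> x" "x < R" for x
  proof -
    have "y - y' < R - y"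
      using y'S y' unfolding S_def mem_ball dist_of_real dist_real_def by linarith
    then show ?thesis using that y' unfolding S_def mem_ball dist_of_real dist_real_def by linarith
  qed
  obtain a where a: "\<And>k. 0 \<le> a k"
    "\<And>x. 0 \<le> x \<Longrightarrow> x < R - y' \<Longrightarrow> summable (\<lambda>k. a k * x ^ k)"
    "\<And>w. w \<in> S \<Longrightarrow> w \<in> ball (of_real y') (R - y') \<Longrightarrow>
       (\<lambda>k. of_real (a k) * (w - of_real y') ^ k) sums P w"
    by (rule pringsheim[of P S y' R])
       (use P y y' seg all_hankel_psd_nonneg[OF psd' y'0] in \<open>auto simp: S_def\<close>)
  define P' where "P' = (\<lambda>w. \<Sum>k. complex_of_real (a k) * (w - of_real y') ^ k)"
  have eq: "P' w = P w" if w: "w \<in> S" for w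
  proof -
    have "dist (of_real y') w \<le> dist (complex_of_real y') (of_real y) + dist (of_real y) w"
      by (rule dist_triangle)
    also have "\<dots> < (y - y') + (R - y)"
      using w y' unfolding S_def mem_ball dist_of_real dist_real_def by linarith
    finally have "w \<in> ball (of_real y') (R - y')" by simp
    from a(3)[OF w this] show ?thesis by (simp add: P'_def sums_iff)
  qed
  show thesis
  proof (rule that)
    show "P' holomorphic_on ball (of_real y') (R - y')"
      unfolding P'_def by (rule power_series_holomorphic_real[OF a(2)])
    show "P' w = P w" if "w \<in> ball (of_real y) (R - y)" for w using eq that by (simp add: S_def)
    show "all_hankel_psd P' y'"
      unfolding all_hankel_psd_def
    proof
      fix k
      have dk: "(deriv ^^ k) P w = (deriv ^^ k) P' w" if "w \<in> S" for w
        by (rule higher_deriv_cong_ev[OF eventually_mono[OF eventually_nhds_in_open[of S]] refl])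
           (use that eq in \<open>auto simp: S_def\<close>)
      have "open (exp -` S :: complex set)"
        by (intro open_vimage continuous_intros) (auto simp: S_def)
      then have "\<forall>\<^sub>F \<tau> in nhds (of_real (ln y')). (deriv ^^ k) P (exp \<tau>) = (deriv ^^ k) P' (exp \<tau>)"
        by (intro eventually_mono[OF eventually_nhds_in_open[of "exp -` S"]])
           (use y'S ey' dk in auto)
      then show "hankel_psd (\<lambda>\<tau>. (deriv ^^ k) P' (exp \<tau>)) (of_real (ln y'))"
        by (rule hankel_psd_cong) (use psd' in \<open>simp add: all_hankel_psd_def\<close>)
    qed
  qed
qed

text \<open>The balls \<open>ball y (R - y)\<close> increase as \<open>y\<close> decreases to 0. A continuation to one of them,
  together with the Hankel condition at \<open>y\<close>, yields one for every \<open>y' > y\<^sup>2 / R\<close>: shift the Hankel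
  condition inside the disc of radius \<open>ln R - ln y\<close> around \<open>ln y\<close>, then apply Pringsheim's theorem
  at \<open>y'\<close>.\<close>

theorem hankel_psd_power_series:
  fixes x \<rho> :: real
  assumes x: "0 < x" and \<rho>: "0 < \<rho>" and P: "P holomorphic_on ball (of_real x) \<rho>"
    and psd: "all_hankel_psd P x"
  obtains a where "\<And>k. 0 \<le> a k"
    "\<And>z. 0 \<le> z \<Longrightarrow> z < x + \<rho> \<Longrightarrow> summable (\<lambda>k. a k * z ^ k)"
    "\<And>w. w \<in> ball (of_real x) \<rho> \<Longrightarrow> (\<lambda>k. of_real (a k) * w ^ k) sums P w"
proof -
  define R where "R = x + \<rho>"
  define good where "good y Q \<longleftrightarrow> 0 < y \<and> y \<le> x \<and> Q holomorphic_on ball (of_real y) (R - y) \<and>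
    (\<forall>w\<in>ball (of_real x) \<rho>. Q w = P w) \<and> all_hankel_psd Q y" for y Q
  have sub: "ball (complex_of_real y) (R - y) \<subseteq> ball (of_real z) (R - z)" if "z \<le> y" for y z
    using that by (subst ball_subset_ball_iff) (auto simp: dist_norm simp flip: of_real_diff)
  have subx: "ball (complex_of_real x) \<rho> \<subseteq> ball (of_real z) (R - z)" if "z \<le> x" for z
    using sub[OF that] by (simp add: R_def)
  have goodx: "good x P" using x P psd by (simp add: good_def R_def)
  define Y where "Y = {y. \<exists>Q. good y Q}"
  have xY: "x \<in> Y" using goodx by (auto simp: Y_def)
  have bdd: "bdd_below Y" by (rule bdd_belowI[of _ 0]) (auto simp: Y_def good_def)
  \<comment> \<open>If the infimum \<open>I\<close> were positive, some radius \<open>y\<close> in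
    \<open>Y\<close> would satisfy \<open>y < sqrt (I * R)\<close>, that is
    \<open>y\<^sup>2 / R < I\<close>, and one more extension would reach a radius below
    \<open>I\<close>.\<close>
  have Inf0: "Inf Y = 0"
  proof (rule ccontr)
    assume "Inf Y \<noteq> 0"
    moreover have "0 \<le> Inf Y" using xY by (intro cInf_greatest) (auto simp: Y_def good_def)
    ultimately have I: "0 < Inf Y" by simp
    have "Inf Y \<le> x" using xY bdd by (rule cInf_lower)
    then have IR: "Inf Y < R" using \<rho> by (simp add: R_def)
    have "Inf Y * Inf Y < Inf Y * R" using I IR by simp
    then have "Inf Y < sqrt (Inf Y * R)" by (intro real_less_rsqrt) (simp add: power2_eq_square)
    then obtain y where y: "y \<in> Y" "y < sqrt (Inf Y * R)"
      using cInf_lessD[of Y] xY by blast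
    then obtain Q where Q: "good y Q" by (auto simp: Y_def)
    have y0: "0 < y" "y \<le> x" "y < R" using Q \<rho> by (auto simp: good_def R_def)
    have R0: "0 < R" using y0 by simp
    have "y\<^sup>2 < Inf Y * R"
      using y(2) y0 by (metis less_eq_real_def real_sqrt_less_iff real_sqrt_unique)
    then have "y\<^sup>2 / R < Inf Y" using R0 by (simp add: field_simps)
    then obtain y' where y': "y\<^sup>2 / R < y'" "y' < Inf Y" using dense by blast
    have "y' \<le> y" using y' cInf_lower[OF y(1) bdd] by simp
    have "0 < y\<^sup>2 / R" using y0 R0 by simp
    then have "0 < y'" using y' by linarith
    obtain Q' where Q': "Q' holomorphic_on ball (of_real y') (R - y')"
      "\<And>w. w \<in> ball (of_real y) (R - y) \<Longrightarrow> Q' w = Q w" "all_hankel_psd Q' y'"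
      by (rule hankel_extension_step[of Q y R y']) (use Q y0 y' \<open>y' \<le> y\<close> in \<open>auto simp: good_def\<close>)
    have "good y' Q'"
      using Q' Q subx[of y] y0 \<open>0 < y'\<close> \<open>y' \<le> y\<close> unfolding good_def by auto
    then have "y' \<in> Y" by (auto simp: Y_def)
    from cInf_lower[OF this bdd] y' show False by simp
  qed
  have small: "\<exists>y Q. y < e \<and> good y Q" if "0 < e" for e
    using cInf_lessD[of Y e] xY Inf0 that by (auto simp: Y_def)
  have R0: "0 < R" using x \<rho> by (simp add: R_def)
  \<comment> \<open>\<open>y0 < R / 2\<close> puts the origin inside the disc
    \<open>S\<close>.\<close>
  obtain y0 Q0 where y0: "y0 < R / 2" and Q0: "good y0 Q0" using small[of "R / 2"] R0 by auto
  define S where "S = ball (complex_of_real y0) (R - y0)"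
  have Q0h: "Q0 holomorphic_on S" using Q0 by (simp add: good_def S_def)
  \<comment> \<open>The logarithmic condition makes no sense at 0. Nonnegativity of the derivatives
    there is obtained as a limit along good radii tending to 0, and Pringsheim's theorem asks for no
    more.\<close>
  have nn: "(deriv ^^ k) Q0 (of_real 0) \<in> \<real>\<^sub>\<ge>\<^sub>0" for k
  proof -
    have "\<exists>y Q. y < min y0 (1 / real (Suc n)) \<and> good y Q" for n
      using small[of "min y0 (1 / real (Suc n))"] Q0 by (auto simp: good_def)
    then obtain Y Q where Y: "\<And>n. Y n < min y0 (1 / real (Suc n))" "\<And>n. good (Y n) (Q n)" by metis
    have Y0: "Y n \<ge> 0" for n using Y(2)[of n] by (simp add: good_def)
    have "Y \<longlonglongrightarrow> 0"
    proof (rule tendsto_sandwich[of "\<lambda>_. 0" _ _ "\<lambda>n. 1 / real (Suc n)"])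
      show "(\<lambda>n. 1 / real (Suc n)) \<longlonglongrightarrow> 0" using LIMSEQ_inverse_real_of_nat by (simp add: inverse_eq_divide)
    qed (use Y Y0 in \<open>auto intro!: always_eventually less_imp_le simp: less_imp_le\<close>)
    then have Yc: "(\<lambda>n. complex_of_real (Y n)) \<longlonglongrightarrow> of_real 0" by (rule tendsto_of_real)
    have 0: "complex_of_real 0 \<in> S" using y0 Q0 by (simp add: S_def good_def)
    have "isCont ((deriv ^^ k) Q0) (of_real 0)"
      using holomorphic_on_imp_continuous_on[OF holomorphic_higher_deriv[OF Q0h]] 0
      by (simp add: S_def continuous_on_eq_continuous_at)
    then have "(\<lambda>n. (deriv ^^ k) Q0 (of_real (Y n))) \<longlonglongrightarrow> (deriv ^^ k) Q0 (of_real 0)"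
      using Yc by (rule isCont_tendsto_compose)
    moreover have "(deriv ^^ k) Q0 (of_real (Y n)) \<in> \<real>\<^sub>\<ge>\<^sub>0" for n
    proof -
      have Yn: "Y n < y0" "0 < Y n" using Y[of n] by (auto simp: good_def)
      have eq: "Q0 w = Q n w" if "w \<in> S" for w
      proof (rule analytic_continuation_open[of "ball (of_real x) \<rho>" S Q0 "Q n"])
        show "ball (complex_of_real x) \<rho> \<subseteq> S" using subx[of y0] Q0 by (simp add: S_def good_def)
        show "Q n holomorphic_on S"
          using Y(2)[of n] sub[of "Y n" y0] Yn by (auto simp: S_def good_def intro: holomorphic_on_subset)
        show "Q0 z = Q n z" if "z \<in> ball (of_real x) \<rho>" for z
          using that Q0 Y(2)[of n] by (simp add: good_def)
      qed (use that Q0h \<rho> in \<open>auto simp: S_def\<close>)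
      have "complex_of_real (Y n) \<in> S"
        using Yn y0 unfolding S_def mem_ball dist_of_real dist_real_def by linarith
      then have "(deriv ^^ k) Q0 (of_real (Y n)) = (deriv ^^ k) (Q n) (of_real (Y n))"
        by (intro higher_deriv_cong_ev[OF eventually_mono[OF eventually_nhds_in_open[of S]] refl])
           (use eq in \<open>auto simp: S_def\<close>)
      then show ?thesis using all_hankel_psd_nonneg[of "Q n" "Y n" k] Y(2)[of n] by (simp add: good_def)
    qed
    ultimately show ?thesis by (rule closed_sequentially[OF closed_nonneg_Reals_complex, rotated])
  qed
  obtain a where a: "\<And>k. 0 \<le> a k"
    "\<And>x. 0 \<le> x \<Longrightarrow> x < R - 0 \<Longrightarrow> summable (\<lambda>k. a k * x ^ k)"
    "\<And>w. w \<in> S \<Longrightarrow> w \<in> ball (of_real 0) (R - 0) \<Longrightarrow>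
       (\<lambda>k. of_real (a k) * (w - of_real 0) ^ k) sums Q0 w"
  proof (rule pringsheim[of Q0 S 0 R])
    show "complex_of_real x \<in> S" if "0 \<le> x" "x < R" for x
      using that y0 Q0 unfolding S_def mem_ball dist_of_real dist_real_def good_def by linarith
  qed (use Q0h R0 nn in \<open>auto simp: S_def\<close>)
  show thesis
  proof (rule that)
    show "summable (\<lambda>k. a k * z ^ k)" if "0 \<le> z" "z < x + \<rho>" for z
      using a(2)[of z] that by (simp add: R_def)
    fix w assume w: "w \<in> ball (complex_of_real x) \<rho>"
    then have "w \<in> S" "w \<in> ball 0 R" using subx[of y0] subx[of 0] x Q0 by (auto simp: S_def good_def)
    then show "(\<lambda>k. of_real (a k) * w ^ k) sums P w" using a(3)[of w] w Q0 by (simp add: good_def)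
  qed (rule a(1))
qed

subsection \<open>Sums of squares of holomorphic functions\<close>

definition taylor_coeff :: "(complex \<Rightarrow> complex) \<Rightarrow> nat \<Rightarrow> complex" where
  "taylor_coeff g a = (deriv ^^ a) g 0 / fact a"

lemma taylor_coeff_sums:
  assumes "g holomorphic_on ball 0 e" "norm z < e"
  shows "(\<lambda>a. taylor_coeff g a * z ^ a) sums g z"
  using holomorphic_power_series[OF assms(1), of z] assms(2) by (simp add: taylor_coeff_def)

lemma taylor_coeff_abs_summable:
  assumes "g holomorphic_on ball 0 e" "norm z < e"
  shows "summable (\<lambda>a. norm (taylor_coeff g a * z ^ a))"
proof -
  define r where "r = (norm z + e) / 2"
  have r: "norm z < r" "r < e" using assms(2) by (auto simp: r_def)
  have "0 \<le> r" using norm_ge_zero[of z] r(1) by linarith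
  with r show ?thesis
    using sums_summable[OF taylor_coeff_sums[OF assms(1), of "of_real r"]]
    by (intro powser_insidea[where x = "of_real r"]) auto
qed

lemma taylor_coeff_has_sum:
  assumes "g holomorphic_on ball 0 e" "norm z < e"
  shows "((\<lambda>a. taylor_coeff g a * z ^ a) has_sum g z) UNIV"
  using norm_summable_imp_has_sum[OF taylor_coeff_abs_summable[OF assms] taylor_coeff_sums[OF assms]] .

lemma taylor_coeff_sum:
  fixes g :: "'i \<Rightarrow> complex \<Rightarrow> complex"
  assumes "finite W" "\<And>w. w \<in> W \<Longrightarrow> g w holomorphic_on ball 0 e" "0 < e"
  shows "taylor_coeff (\<lambda>z. \<Sum>w\<in>W. d w * g w z) a = (\<Sum>w\<in>W. d w * taylor_coeff (g w) a)"
  using assms(1,2)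
proof (induction W)
  case empty
  show ?case by (simp add: taylor_coeff_def)
next
  case (insert v W)
  have h: "(\<lambda>z. d v * g v z) holomorphic_on ball 0 e" "(\<lambda>z. \<Sum>w\<in>W. d w * g w z) holomorphic_on ball 0 e"
    using insert by (auto intro!: holomorphic_intros)
  have "(deriv ^^ a) (\<lambda>z. d v * g v z + (\<Sum>w\<in>W. d w * g w z)) 0 =
      (deriv ^^ a) (\<lambda>z. d v * g v z) 0 + (deriv ^^ a) (\<lambda>z. \<Sum>w\<in>W. d w * g w z) 0"
    by (rule higher_deriv_add[OF h]) (use assms(3) in auto)
  moreover have "(deriv ^^ a) (\<lambda>z. d v * g v z) 0 = d v * (deriv ^^ a) (g v) 0"
    by (rule higher_deriv_cmult[where A = "ball 0 e"]) (use insert assms(3) in auto)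
  ultimately show ?case
    using insert by (simp add: taylor_coeff_def add_divide_distrib)
qed

text \<open>Cauchy's inequality for a holomorphic map into \<open>\<ell>\<^sup>2\<close>, by pairing the map with the vector
  of its coefficients.\<close>

lemma sum_squares_taylor_coeff_le:
  fixes g :: "'i \<Rightarrow> complex \<Rightarrow> complex"
  assumes W: "finite W" and hol: "\<And>w. w \<in> W \<Longrightarrow> g w holomorphic_on ball 0 e"
    and B: "\<And>z. z \<in> ball 0 e \<Longrightarrow> (\<Sum>w\<in>W. (cmod (g w z))\<^sup>2) \<le> B" and r: "0 < r" "r < e"
  shows "(\<Sum>w\<in>W. (cmod (taylor_coeff (g w) a))\<^sup>2) \<le> B / r ^ (2 * a)"
proof -
  define S where "S = (\<Sum>w\<in>W. (cmod (taylor_coeff (g w) a))\<^sup>2)"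
  have S0: "0 \<le> S" by (auto simp: S_def intro: sum_nonneg)
  have B0: "0 \<le> B" by (rule order_trans[OF _ B[of 0]]) (use r in \<open>auto intro: sum_nonneg\<close>)
  define G where "G = (\<lambda>z. \<Sum>w\<in>W. cnj (taylor_coeff (g w) a) * g w z)"
  have Gh: "G holomorphic_on ball 0 e" unfolding G_def using hol by (intro holomorphic_intros) auto
  have "norm ((deriv ^^ a) G 0) \<le> fact a * (sqrt S * sqrt B) / r ^ a"
  proof (rule Cauchy_inequality)
    show "G holomorphic_on ball 0 r" using Gh r by (auto intro: holomorphic_on_subset)
    show "continuous_on (cball 0 r) G"
      using holomorphic_on_imp_continuous_on[OF Gh] r by (auto intro: continuous_on_subset)
    fix z :: complex assume "norm (0 - z) = r"
    then have z: "z \<in> ball 0 e" using r by simp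
    have "norm (G z) \<le> (\<Sum>w\<in>W. cmod (taylor_coeff (g w) a) * cmod (g w z))"
      unfolding G_def by (rule sum_norm_le) (simp add: norm_mult)
    also have "\<dots> \<le> sqrt (\<Sum>w\<in>W. (cmod (taylor_coeff (g w) a))\<^sup>2) * sqrt (\<Sum>w\<in>W. (cmod (g w z))\<^sup>2)"
      using L2_set_mult_ineq[of "\<lambda>w. cmod (taylor_coeff (g w) a)" "\<lambda>w. cmod (g w z)" W]
      by (simp add: L2_set_def)
    also have "\<dots> \<le> sqrt S * sqrt B"
      unfolding S_def[symmetric] using B[OF z] S0 by (intro mult_left_mono) auto
    finally show "norm (G z) \<le> sqrt S * sqrt B" .
  qed (use r in auto)
  moreover have "(deriv ^^ a) G 0 = fact a * of_real S"
  proof -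
    have "taylor_coeff G a = of_real S"
      using taylor_coeff_sum[OF W hol, where d = "\<lambda>w. cnj (taylor_coeff (g w) a)" and a = a] r
      by (simp add: G_def S_def complex_norm_square mult.commute del: of_real_power)
    then show ?thesis by (simp add: taylor_coeff_def field_simps)
  qed
  ultimately have "fact a * S \<le> fact a * (sqrt S * sqrt B / r ^ a)"
    using S0 by (simp add: norm_mult)
  then have "S \<le> sqrt S * sqrt B / r ^ a"
    by (simp only: mult_le_cancel_left_pos fact_gt_zero)
  then have "sqrt S * sqrt S * r ^ a \<le> sqrt S * sqrt B"
    using S0 r by (simp add: field_simps)
  then have "sqrt S * r ^ a \<le> sqrt B \<or> sqrt S = 0"
    using S0 by (metis mult.assoc mult_le_cancel_left_pos order_le_less real_sqrt_ge_zero)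
  then have "sqrt S * r ^ a \<le> sqrt B" using B0 by auto
  then have "(sqrt S * r ^ a)\<^sup>2 \<le> (sqrt B)\<^sup>2"
    using S0 r by (intro power_mono) auto
  then have "S * r ^ (2 * a) \<le> B"
    using S0 B0 by (simp add: power_mult_distrib power_mult[symmetric] mult.commute)
  then show ?thesis using r by (simp add: S_def field_simps)
qed

text \<open>For fixed \<open>a\<close> and \<open>b\<close> this is the inner product of two vectors
  of Taylor coefficients indexed by \<open>w\<close>; as a matrix in \<open>a\<close> and
  \<open>b\<close> it is a Gram matrix.\<close>

definition gram_coeff :: "('i \<Rightarrow> complex \<Rightarrow> complex) \<Rightarrow> nat \<Rightarrow> nat \<Rightarrow> complex" where
  "gram_coeff g a b = (\<Sum>\<^sub>\<infinity>w. taylor_coeff (g w) a * cnj (taylor_coeff (g w) b))"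

context
  fixes g :: "'i \<Rightarrow> complex \<Rightarrow> complex" and e B :: real and K :: "complex \<Rightarrow> real"
  assumes e: "0 < e"
    and hol: "\<And>w. g w holomorphic_on ball 0 e"
    and sos: "\<And>z. z \<in> ball 0 e \<Longrightarrow> ((\<lambda>w. (cmod (g w z))\<^sup>2) has_sum K z) UNIV"
    and K_le: "\<And>z. z \<in> ball 0 e \<Longrightarrow> K z \<le> B"
begin

lemma sum_squares_coeff_le:
  assumes "finite W" "0 < r" "r < e"
  shows "(\<Sum>w\<in>W. (cmod (taylor_coeff (g w) a))\<^sup>2) \<le> B / r ^ (2 * a)"
proof (rule sum_squares_taylor_coeff_le[OF assms(1) hol _ assms(2,3)])
  fix z assume z: "z \<in> ball (0::complex) e"
  have "(\<Sum>w\<in>W. (cmod (g w z))\<^sup>2) \<le> K z"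
    by (rule finite_sum_le_has_sum[OF sos[OF z] assms(1)]) auto
  then show "(\<Sum>w\<in>W. (cmod (g w z))\<^sup>2) \<le> B" using K_le[OF z] by simp
qed

text \<open>The coefficients are weighted by \<open>r ^ a\<close> and \<open>r ^ b\<close> before a
  product is bounded by half the sum of two squares. Without these weights the bounds from
  \<open>sum_squares_coeff_le\<close> would not combine to the exponent
  \<open>a + b\<close>.\<close>

lemma gram_abs_bound:
  assumes "finite W" "0 < r" "r < e"
  shows "(\<Sum>w\<in>W. cmod (taylor_coeff (g w) a * cnj (taylor_coeff (g w) b))) \<le> B / r ^ (a + b)"
proof -
  let ?c = "\<lambda>w a. cmod (taylor_coeff (g w) a)"
  have "(\<Sum>w\<in>W. ?c w a * ?c w b) * r ^ (a + b) = (\<Sum>w\<in>W. (?c w a * r ^ a) * (?c w b * r ^ b))"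
    unfolding sum_distrib_right by (intro sum.cong refl) (simp add: power_add)
  also have "\<dots> \<le> (\<Sum>w\<in>W. ((?c w a * r ^ a)\<^sup>2 + (?c w b * r ^ b)\<^sup>2) / 2)"
  proof (rule sum_mono)
    fix w
    have "0 \<le> (?c w a * r ^ a - ?c w b * r ^ b)\<^sup>2" by simp
    then show "(?c w a * r ^ a) * (?c w b * r ^ b) \<le> ((?c w a * r ^ a)\<^sup>2 + (?c w b * r ^ b)\<^sup>2) / 2"
      by (simp add: power2_diff)
  qed
  also have "\<dots> = ((\<Sum>w\<in>W. (?c w a)\<^sup>2) * r ^ (2 * a) + (\<Sum>w\<in>W. (?c w b)\<^sup>2) * r ^ (2 * b)) / 2"
    by (simp add: sum_distrib_right sum.distrib sum_divide_distrib[symmetric] power_mult_distrib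
        flip: power_mult) (simp add: mult.commute)
  also have "\<dots> \<le> (B + B) / 2"
    using sum_squares_coeff_le[OF assms, of a] sum_squares_coeff_le[OF assms, of b] assms(2)
    by (intro divide_right_mono add_mono) (auto simp: field_simps)
  finally show ?thesis using assms(2) by (simp add: norm_mult field_simps)
qed

lemma gram_coeff_abs_summable:
  "(\<lambda>w. cmod (taylor_coeff (g w) a * cnj (taylor_coeff (g w) b))) summable_on UNIV"
proof (rule nonneg_bdd_above_summable_on)
  show "bdd_above (sum (\<lambda>w. cmod (taylor_coeff (g w) a * cnj (taylor_coeff (g w) b))) ` {F. F \<subseteq> UNIV \<and> finite F})"
    by (rule bdd_aboveI2[of _ _ "B / (e / 2) ^ (a + b)"], rule gram_abs_bound) (use e in auto)
qed auto

lemma gram_coeff_has_sum: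
  "((\<lambda>w. taylor_coeff (g w) a * cnj (taylor_coeff (g w) b)) has_sum gram_coeff g a b) UNIV"
  using abs_summable_summable[OF gram_coeff_abs_summable] by (simp add: gram_coeff_def)

text \<open>Expanding the squares gives a triple family over \<open>a\<close>, \<open>b\<close> and
  \<open>w\<close>, which is summed in two orders. A radius \<open>r\<close> between
  \<open>norm z\<close> and \<open>e\<close> provides the geometric majorant
  \<open>B * (q ^ a * q ^ b)\<close> and with it absolute summability.\<close>

lemma gram_coeff_expansion:
  assumes z: "norm z < e"
  shows "((\<lambda>(a, b). gram_coeff g a b * z ^ a * cnj z ^ b) has_sum of_real (K z)) UNIV"
proof -
  define r where "r = (norm z + e) / 2"
  have r: "norm z < r" "r < e" using z by (auto simp: r_def)
  have r0: "0 < r" using norm_ge_zero[of z] r(1) by linarith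
  define q where "q = norm z / r"
  have q: "0 \<le> q" "q < 1" using r r0 by (auto simp: q_def)
  define F where "F = (\<lambda>((a, b), w). taylor_coeff (g w) a * cnj (taylor_coeff (g w) b) * z ^ a * cnj z ^ b)"
  have inner: "(\<lambda>w. norm (F (p, w))) summable_on UNIV" for p
    using summable_on_cmult_left[OF gram_coeff_abs_summable, of "fst p" "snd p" "norm z ^ fst p * norm z ^ snd p"]
    by (cases p) (simp add: F_def norm_mult norm_power mult_ac)
  have innerle: "(\<Sum>\<^sub>\<infinity>w. norm (F (p, w))) \<le> B * (q ^ fst p * q ^ snd p)" for p
  proof (rule infsum_le_finite_sums[OF inner])
    fix W :: "'i set" assume W: "finite W"
    have "(\<Sum>w\<in>W. norm (F (p, w))) =
      (\<Sum>w\<in>W. cmod (taylor_coeff (g w) (fst p) * cnj (taylor_coeff (g w) (snd p)))) * norm z ^ (fst p + snd p)"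
      unfolding sum_distrib_right
      by (cases p, intro sum.cong refl) (simp add: F_def norm_mult norm_power power_add)
    also have "\<dots> \<le> B / r ^ (fst p + snd p) * norm z ^ (fst p + snd p)"
      by (intro mult_right_mono gram_abs_bound W r0 r) auto
    also have "\<dots> = B * (q ^ fst p * q ^ snd p)"
      by (simp add: q_def power_divide power_add)
    finally show "(\<Sum>w\<in>W. norm (F (p, w))) \<le> B * (q ^ fst p * q ^ snd p)" .
  qed
  have geo: "(\<lambda>a. q ^ a) summable_on UNIV"
    using q by (intro summable_nonneg_imp_summable_on) (auto simp: summable_geometric)
  have "(\<lambda>p. norm (q ^ fst p * q ^ snd p)) summable_on UNIV \<times> UNIV"
    by (subst Infinite_Sum.abs_summable_on_Sigma_iff)
       (use q geo in \<open>auto intro!: summable_on_cmult_right summable_on_cmult_left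
          simp: infsum_cmult_right' norm_mult norm_power infsum_nonneg abs_mult\<close>)
  then have geo2: "(\<lambda>p. B * (q ^ fst p * q ^ snd p)) summable_on UNIV"
    using q by (intro summable_on_cmult_right) (simp add: abs_mult)
  have "(\<lambda>x. norm (F x)) summable_on UNIV \<times> UNIV"
  proof (subst Infinite_Sum.abs_summable_on_Sigma_iff, intro conjI ballI inner)
    show "(\<lambda>p. norm (\<Sum>\<^sub>\<infinity>w. norm (F (p, w)))) summable_on UNIV"
      by (rule Infinite_Sum.abs_summable_on_comparison_test'[OF geo2]) (use innerle in \<open>simp add: infsum_nonneg\<close>)
  qed
  then have Fs: "F summable_on UNIV \<times> UNIV" by (rule abs_summable_summable)
  define S where "S = infsum F (UNIV \<times> UNIV)"
  have FS: "(F has_sum S) (UNIV \<times> UNIV)" using Fs by (simp add: S_def)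
  have 1: "((\<lambda>p. gram_coeff g (fst p) (snd p) * z ^ fst p * cnj z ^ snd p) has_sum S) UNIV"
    by (rule has_sum_SigmaD[OF FS])
       (auto simp: F_def intro!: has_sum_cmult_left gram_coeff_has_sum)
  have sw: "((\<lambda>(w, p). F (p, w)) has_sum S) (UNIV \<times> UNIV)"
    using FS by (subst (asm) has_sum_swap)
  have 2: "((\<lambda>w. complex_of_real ((cmod (g w z))\<^sup>2)) has_sum S) UNIV"
  proof (rule has_sum_SigmaD[OF sw])
    fix w
    have h: "((\<lambda>a. taylor_coeff (g w) a * z ^ a) has_sum g w z) UNIV"
      by (rule taylor_coeff_has_sum[OF hol z])
    have "((\<lambda>(a, b). (taylor_coeff (g w) a * z ^ a) * cnj (taylor_coeff (g w) b * z ^ b)) has_sum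
       g w z * cnj (g w z)) (UNIV \<times> UNIV)"
    proof (rule has_sum_SigmaI)
      show "((\<lambda>b. case (a, b) of (a, b) \<Rightarrow> (taylor_coeff (g w) a * z ^ a) * cnj (taylor_coeff (g w) b * z ^ b)) has_sum
        (taylor_coeff (g w) a * z ^ a) * cnj (g w z)) UNIV" for a
        unfolding prod.case by (intro has_sum_cmult_right) (use h in \<open>simp only: has_sum_cnj_iff\<close>)
      show "((\<lambda>a. (taylor_coeff (g w) a * z ^ a) * cnj (g w z)) has_sum g w z * cnj (g w z)) UNIV"
        by (intro has_sum_cmult_left h)
      have "(\<lambda>(w, p). F (p, w)) summable_on UNIV \<times> UNIV" using sw by (rule has_sum_imp_summable)
      from summable_on_SigmaD1[OF this, of w]
      show "(\<lambda>(a, b). (taylor_coeff (g w) a * z ^ a) * cnj (taylor_coeff (g w) b * z ^ b)) summable_on UNIV \<times> UNIV"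
        by (simp add: F_def case_prod_unfold mult_ac)
    qed
    then show "((\<lambda>p. case (w, p) of (w, p) \<Rightarrow> F (p, w)) has_sum complex_of_real ((cmod (g w z))\<^sup>2)) UNIV"
      unfolding complex_norm_square by (simp add: F_def case_prod_unfold mult_ac)
  qed
  have "((\<lambda>w. complex_of_real ((cmod (g w z))\<^sup>2)) has_sum of_real (K z)) UNIV"
    using sos[of z] z by (intro has_sum_of_real) simp
  with 2 have "S = of_real (K z)" by (rule has_sum_unique)
  with 1 show ?thesis by (simp add: case_prod_unfold)
qed

end

text \<open>A one-sided real interval suffices by the identity theorem. This matters because series
  in \<open>s = (cmod \<eta>)\<^sup>2\<close> are known only for \<open>s \<ge> 0\<close>.\<close>

lemma power_series_zero_on_reals:
  fixes c :: "nat \<Rightarrow> complex"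
  assumes e: "0 < e" and z: "\<And>x. 0 \<le> x \<Longrightarrow> x < e \<Longrightarrow> (\<lambda>n. c n * of_real x ^ n) sums 0"
  shows "c n = 0"
proof -
  have sm: "summable (\<lambda>n. c n * w ^ n)" if "norm w < e" for w
  proof -
    define x where "x = (norm w + e) / 2"
    have x: "norm w < x" "x < e" using that by (auto simp: x_def)
    then have "0 \<le> x" using norm_ge_zero[of w] by linarith
    with x have "summable (\<lambda>n. c n * of_real x ^ n)" by (intro sums_summable[OF z])
    then show ?thesis by (rule powser_inside) (use x \<open>0 \<le> x\<close> in simp)
  qed
  define G where "G = (\<lambda>w. \<Sum>n. c n * w ^ n)"
  have Gs: "(\<lambda>n. c n * w ^ n) sums G w" if "norm w < e" for w
    unfolding G_def using sm[OF that] by (rule summable_sums)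
  have G: "G holomorphic_on ball 0 e"
    by (rule power_series_holomorphic[where a = c]) (use Gs in auto)
  have "G w = 0" if "w \<in> ball 0 e" for w
    by (rule holomorphic_eq_if_eq_on_reals[of G "ball 0 e" "\<lambda>_. 0" 0 e])
       (use G e z that in \<open>auto simp: G_def sums_iff\<close>)
  then have "\<forall>\<^sub>F w in nhds 0. G w = 0"
    using e by (intro eventually_mono[OF eventually_nhds_in_open[of "ball 0 e"]]) auto
  from higher_deriv_cong_ev[OF this refl, of n] have "(deriv ^^ n) G 0 = 0" by simp
  moreover have "(deriv ^^ n) G 0 = (diffs ^^ n) c 0"
    unfolding G_def using higher_deriv_power_series[of e c 0 n] sm e by simp
  moreover have "(diffs ^^ n) c k = fact (n + k) / fact k * c (n + k)" for k
  proof (induction n arbitrary: k)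
    case (Suc n)
    have "(diffs ^^ Suc n) c k = of_nat (Suc k) * (fact (n + Suc k) / fact (Suc k) * c (n + Suc k))"
      by (simp add: diffs_def Suc del: of_nat_Suc fact_Suc)
    also have "\<dots> = fact (Suc n + k) / fact k * c (Suc n + k)"
      by (simp add: fact_Suc[of k] del: of_nat_Suc fact_Suc)
    finally show ?case .
  qed simp
  ultimately show ?thesis by simp
qed

text \<open>Along a ray \<open>z = x * u\<close> the terms of total degree \<open>p\<close> collect
  to the coefficient of \<open>x ^ p\<close>, so each homogeneous part vanishes on the unit circle.
  There \<open>cnj u\<close> is the inverse of \<open>u\<close>; multiplying by \<open>u ^ p\<close>
  leaves a polynomial in \<open>u\<^sup>2\<close> with infinitely many zeros.\<close>

lemma hermitian_series_unique:
  fixes E :: "nat \<Rightarrow> nat \<Rightarrow> complex"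
  assumes e: "0 < e"
    and z: "\<And>z. norm z < e \<Longrightarrow> ((\<lambda>(a, b). E a b * z ^ a * cnj z ^ b) has_sum 0) UNIV"
  shows "E a b = 0"
proof -
  define p where "p = a + b"
  have key: "(\<Sum>i\<le>p. E i (p - i) * u ^ i * cnj u ^ (p - i)) = 0" if u: "norm u = 1" for u
  proof (rule power_series_zero_on_reals[OF e, where c = "\<lambda>p. \<Sum>i\<le>p. E i (p - i) * u ^ i * cnj u ^ (p - i)"])
    fix x :: real assume x: "0 \<le> x" "x < e"
    have "((\<lambda>(a, b). E a b * (of_real x * u) ^ a * cnj (of_real x * u) ^ b) has_sum 0) UNIV"
      by (rule z) (use x u in \<open>simp add: norm_mult\<close>)
    from has_sum_imp_sums[OF has_sum_antidiagonals[OF this]]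
    have "(\<lambda>p. \<Sum>i\<le>p. E i (p - i) * (of_real x * u) ^ i * cnj (of_real x * u) ^ (p - i)) sums 0" by simp
    also have "(\<lambda>p. \<Sum>i\<le>p. E i (p - i) * (of_real x * u) ^ i * cnj (of_real x * u) ^ (p - i)) =
      (\<lambda>p. (\<Sum>i\<le>p. E i (p - i) * u ^ i * cnj u ^ (p - i)) * of_real x ^ p)"
    proof (intro ext)
      fix p
      have "E i (p - i) * (of_real x * u) ^ i * cnj (of_real x * u) ^ (p - i) =
        E i (p - i) * u ^ i * cnj u ^ (p - i) * of_real x ^ p" if "i \<le> p" for i
      proof -
        have "of_real x ^ p = (of_real x :: complex) ^ i * of_real x ^ (p - i)"
          using that by (simp flip: power_add)
        then show ?thesis by (simp add: power_mult_distrib)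
      qed
      then show "(\<Sum>i\<le>p. E i (p - i) * (of_real x * u) ^ i * cnj (of_real x * u) ^ (p - i)) =
        (\<Sum>i\<le>p. E i (p - i) * u ^ i * cnj u ^ (p - i)) * of_real x ^ p"
        unfolding sum_distrib_right by (intro sum.cong) auto
    qed
    finally show "(\<lambda>n. (\<Sum>i\<le>n. E i (n - i) * u ^ i * cnj u ^ (n - i)) * complex_of_real x ^ n) sums 0" .
  qed
  have "(\<Sum>i\<le>p. E i (p - i) * v ^ i) = 0" if v: "norm v = 1" for v
  proof -
    obtain u where u: "u ^ 2 = v" by (metis power2_csqrt)
    then have nu: "norm u = 1" using v by (metis norm_power norm_ge_zero power2_eq_1_iff neg_0_le_iff_le not_one_le_zero)
    have uu: "u * cnj u = 1" using nu by (simp add: complex_norm_square[symmetric])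
    have "E i (p - i) * v ^ i = (E i (p - i) * u ^ i * cnj u ^ (p - i)) * u ^ p" if "i \<le> p" for i
    proof -
      have "u ^ p = u ^ i * u ^ (p - i)" using that by (simp flip: power_add)
      then have "(E i (p - i) * u ^ i * cnj u ^ (p - i)) * u ^ p = E i (p - i) * (u ^ i * u ^ i) * (u * cnj u) ^ (p - i)"
        by (simp add: power_mult_distrib)
      also have "u ^ i * u ^ i = v ^ i" by (simp add: u[symmetric] power2_eq_square power_mult_distrib)
      finally show ?thesis unfolding uu by (simp only: power_one mult_1_right)
    qed
    then have "(\<Sum>i\<le>p. E i (p - i) * v ^ i) = (\<Sum>i\<le>p. E i (p - i) * u ^ i * cnj u ^ (p - i)) * u ^ p"
      unfolding sum_distrib_right by (intro sum.cong) auto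
    then show ?thesis using key[OF nu] by simp
  qed
  then have "sphere 0 1 \<subseteq> {v. (\<Sum>i\<le>p. E i (p - i) * v ^ i) = 0}" by auto
  moreover have "infinite (sphere (0::complex) 1)"
  proof -
    have "inj_on cis {0..pi}"
    proof (rule inj_onI)
      fix x y assume "x \<in> {0..pi}" "y \<in> {0..pi}" "cis x = cis y"
      then show "x = y" using cos_inj_pi[of x y] by (auto simp: complex_eq_iff)
    qed
    moreover have "infinite {0..pi}" by (simp add: infinite_Icc)
    ultimately have "infinite (cis ` {0..pi})" by (simp add: finite_image_iff)
    moreover have "cis ` {0..pi} \<subseteq> sphere 0 1" by auto
    ultimately show ?thesis using finite_subset by blast
  qed
  ultimately have "infinite {v. (\<Sum>i\<le>p. E i (p - i) * v ^ i) = 0}" using finite_subset by blast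
  then have "\<forall>i\<le>p. E i (p - i) = 0" using polyfun_finite_roots[of "\<lambda>i. E i (p - i)" p] by blast
  then show ?thesis by (auto simp: p_def dest: spec[of _ a])
qed

text \<open>Only separate holomorphy and a common bound are at hand. By induction, the
  \<open>k\<close>-th coefficient is the limit of \<open>g \<zeta> \<eta>\<close> minus its lower
  terms, divided by \<open>\<eta> ^ k\<close>, along real \<open>\<eta>\<close> tending to 0. Each
  quotient is holomorphic in \<open>\<zeta>\<close>, and Cauchy's estimates make the convergence
  uniform.\<close>

lemma taylor_coeff_holomorphic_parameter:
  fixes g :: "complex \<Rightarrow> complex \<Rightarrow> complex"
  assumes U: "open U" and e: "0 < e"
    and h1: "\<And>\<eta>. \<eta> \<in> ball 0 e \<Longrightarrow> (\<lambda>\<zeta>. g \<zeta> \<eta>) holomorphic_on U"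
    and h2: "\<And>\<zeta>. \<zeta> \<in> U \<Longrightarrow> g \<zeta> holomorphic_on ball 0 e"
    and B: "\<And>\<zeta> \<eta>. \<zeta> \<in> U \<Longrightarrow> \<eta> \<in> ball 0 e \<Longrightarrow> norm (g \<zeta> \<eta>) \<le> B"
  shows "(\<lambda>\<zeta>. taylor_coeff (g \<zeta>) k) holomorphic_on U"
proof (induction k rule: less_induct)
  case (less k)
  define r where "r = e / 2"
  have r: "0 < r" "r < e" using e by (auto simp: r_def)
  have cb: "norm (taylor_coeff (g \<zeta>) j) \<le> B / r ^ j" if \<zeta>: "\<zeta> \<in> U" for \<zeta> j
  proof -
    have B0: "0 \<le> B" using order_trans[OF norm_ge_zero B[OF \<zeta>, of 0]] e by simp
    \<comment> \<open>Cauchy's estimate, as the case of a single function in the inequality for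
      families.\<close>
    have "(\<Sum>w\<in>{()}. (cmod (taylor_coeff (g \<zeta>) j))\<^sup>2) \<le> B\<^sup>2 / r ^ (2 * j)"
      by (rule sum_squares_taylor_coeff_le[where g = "\<lambda>_. g \<zeta>" and e = e])
         (use h2[OF \<zeta>] B[OF \<zeta>] r in \<open>auto intro: power_mono\<close>)
    then have "(cmod (taylor_coeff (g \<zeta>) j))\<^sup>2 \<le> (B / r ^ j)\<^sup>2"
      by (simp add: power_divide power_mult[symmetric] mult.commute)
    then show ?thesis by (rule power2_le_imp_le) (use B0 r in auto)
  qed
  \<comment> \<open>With this choice \<open>q = \<eta> n / r\<close> is \<open>1 / (n + 2)\<close>,
    so the tail factor \<open>q / (1 - q)\<close> is exactly \<open>1 / (n + 1)\<close>.\<close>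
  define \<eta> where "\<eta> n = r / real (n + 2)" for n
  have \<eta>: "0 < \<eta> n" "\<eta> n < e" for n
    using r by (auto simp: \<eta>_def field_simps) (smt (verit) mult_nonneg_nonneg of_nat_0_le_iff)
  define f where "f n \<zeta> = (g \<zeta> (of_real (\<eta> n)) - (\<Sum>j<k. taylor_coeff (g \<zeta>) j * of_real (\<eta> n) ^ j)) / of_real (\<eta> n) ^ k"
    for n \<zeta>
  have bound: "norm (f n \<zeta> - taylor_coeff (g \<zeta>) k) \<le> B / r ^ k / real (n + 1)" if \<zeta>: "\<zeta> \<in> U" for n \<zeta>
  proof -
    let ?c = "taylor_coeff (g \<zeta>)" and ?h = "complex_of_real (\<eta> n)"
    define q where "q = \<eta> n / r"
    have q: "0 < q" "q = 1 / real (n + 2)" "q < 1" using r by (auto simp: q_def \<eta>_def)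
    have "(\<lambda>j. ?c j * ?h ^ j) sums g \<zeta> ?h"
      by (rule taylor_coeff_sums[OF h2[OF \<zeta>]]) (use \<eta>[of n] in simp)
    then have S: "(\<lambda>j. ?c (j + Suc k) * ?h ^ (j + Suc k)) sums (g \<zeta> ?h - (\<Sum>j<Suc k. ?c j * ?h ^ j))"
      by (rule sums_split_initial_segment)
    have le: "norm (?c (j + Suc k) * ?h ^ (j + Suc k)) \<le> B * q ^ Suc k * q ^ j" for j
    proof -
      have "norm (?c (j + Suc k) * ?h ^ (j + Suc k)) \<le> B / r ^ (j + Suc k) * \<eta> n ^ (j + Suc k)"
        unfolding norm_mult norm_power using \<eta>[of n]
        by (intro mult_mono cb[OF \<zeta>] order_trans[OF norm_ge_zero cb[OF \<zeta>]]) auto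
      then show ?thesis by (simp add: q_def power_add power_divide mult_ac)
    qed
    have G: "(\<lambda>j. B * q ^ Suc k * q ^ j) sums (B * q ^ Suc k * (1 / (1 - q)))"
      by (intro sums_mult geometric_sums) (use q in auto)
    have "norm (\<Sum>j. ?c (j + Suc k) * ?h ^ (j + Suc k)) \<le> (\<Sum>j. B * q ^ Suc k * q ^ j)"
      by (rule norm_suminf_le[OF le sums_summable[OF G]])
    then have 1: "norm (g \<zeta> ?h - (\<Sum>j<Suc k. ?c j * ?h ^ j)) \<le> B * q ^ Suc k * (1 / (1 - q))"
      using S G by (simp only: sums_iff)
    have "f n \<zeta> - ?c k = (g \<zeta> ?h - (\<Sum>j<Suc k. ?c j * ?h ^ j)) / ?h ^ k"
      using \<eta>(1)[of n] by (simp add: f_def diff_divide_distrib add_divide_distrib)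
    then have "norm (f n \<zeta> - ?c k) \<le> B * q ^ Suc k * (1 / (1 - q)) / \<eta> n ^ k"
      using 1 \<eta>(1)[of n] by (simp only: norm_divide norm_power norm_of_real abs_of_pos) (intro divide_right_mono, auto)
    also have "B * q ^ Suc k * (1 / (1 - q)) / \<eta> n ^ k = B / r ^ k * (q / (1 - q))"
      using \<eta>(1)[of n] r by (simp add: q_def power_divide)
    also have "q / (1 - q) = 1 / real (n + 1)"
      unfolding q(2) by (simp add: field_simps)
    finally show ?thesis by simp
  qed
  show ?case
  proof (rule holomorphic_uniform_sequence[OF U, of f])
    show "f n holomorphic_on U" for n
      unfolding f_def using less.IH h1[of "of_real (\<eta> n)"] \<eta>[of n] by (intro holomorphic_intros) auto
    have lim: "(\<lambda>n. B / r ^ k / real (n + 1)) \<longlonglongrightarrow> 0"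
      using tendsto_mult_right_zero[OF LIMSEQ_inverse_real_of_nat, of "B / r ^ k"] by (simp add: field_simps)
    have ul: "uniform_limit U f (\<lambda>\<zeta>. taylor_coeff (g \<zeta>) k) sequentially"
    proof (rule uniform_limitI)
      fix \<epsilon> :: real assume "0 < \<epsilon>"
      from order_tendstoD(2)[OF lim this]
      show "\<forall>\<^sub>F n in sequentially. \<forall>x\<in>U. dist (f n x) (taylor_coeff (g x) k) < \<epsilon>"
        by eventually_elim (use bound in \<open>auto simp: dist_norm intro: le_less_trans\<close>)
    qed
    show "\<exists>d>0. cball x d \<subseteq> U \<and> uniform_limit (cball x d) f (\<lambda>\<zeta>. taylor_coeff (g \<zeta>) k) sequentially"
      if "x \<in> U" for x
      using open_contains_cball[THEN iffD1, OF U, rule_format, OF that] uniform_limit_on_subset[OF ul] by blast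
  qed
qed

section \<open>Positivity from sums of squares\<close>

lemma has_sum_finite_sum:
  fixes f :: "'i \<Rightarrow> 'b \<Rightarrow> 'c::topological_comm_monoid_add"
  assumes "finite I" "\<And>i. i \<in> I \<Longrightarrow> (f i has_sum s i) A"
  shows "((\<lambda>x. \<Sum>i\<in>I. f i x) has_sum (\<Sum>i\<in>I. s i)) A"
  using assms by (induction I) (auto intro: has_sum_add)

text \<open>As a function of \<open>z\<close>, \<open>H (t + of_real (2 * Re z))\<close> has the
  Hermitian coefficients \<open>(deriv ^^ (a + b)) H t / (fact a * fact b)\<close>. Uniqueness
  identifies them with those of the sum of squares, which form a Gram matrix and are therefore
  positive semidefinite.\<close>

lemma hankel_psd_sum_squares:
  fixes g :: "'i \<Rightarrow> complex \<Rightarrow> complex"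
  assumes e: "0 < e" and s: "0 < s" and H: "H holomorphic_on ball t s"
    and hol: "\<And>w. g w holomorphic_on ball 0 e"
    and sos: "\<And>z. z \<in> ball 0 e \<Longrightarrow> ((\<lambda>w. (cmod (g w z))\<^sup>2) has_sum K z) UNIV"
    and HK: "\<And>z. z \<in> ball 0 e \<Longrightarrow> H (t + of_real (2 * Re z)) = of_real (K z)"
  shows "hankel_psd H t"
proof -
  \<comment> \<open>\<open>2 * d < s\<close> keeps \<open>t + of_real (2 * Re z)\<close> in a
    compact disc on which \<open>H\<close> is bounded. This provides the bound on \<open>K\<close>
    that the Gram expansion requires.\<close>
  define d where "d = min e (s / 4)"
  have d: "0 < d" "d \<le> e" "2 * d < s" using e s by (auto simp: d_def)
  have sub: "ball 0 d \<subseteq> ball (0::complex) e" using d by auto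
  have "compact (H ` cball t (2 * d))"
    by (intro compact_continuous_image continuous_on_subset[OF holomorphic_on_imp_continuous_on[OF H]]) (use d in auto)
  then obtain B where B: "\<And>x. x \<in> cball t (2 * d) \<Longrightarrow> norm (H x) \<le> B"
    by (meson compact_imp_bounded bounded_iff imageI)
  have KB: "K z \<le> B" if z: "z \<in> ball 0 d" for z
  proof -
    have "t + of_real (2 * Re z) \<in> cball t (2 * d)"
      using z abs_Re_le_cmod[of z] by (simp add: dist_norm norm_mult)
    from B[OF this] show ?thesis using HK[of z] z sub by auto
  qed
  define A where "A p = (deriv ^^ p) H t" for p
  have AC: "gram_coeff g a b - A (a + b) / (fact a * fact b) = 0" for a b
  proof (rule hermitian_series_unique[OF d(1), where E = "\<lambda>a b. gram_coeff g a b - A (a + b) / (fact a * fact b)"])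
    fix z :: complex assume z: "norm z < d"
    have h: "g w holomorphic_on ball 0 d" for w using hol sub by (rule holomorphic_on_subset)
    have 1: "((\<lambda>(a, b). gram_coeff g a b * z ^ a * cnj z ^ b) has_sum of_real (K z)) UNIV"
      by (rule gram_coeff_expansion[OF d(1) h _ KB z]) (use sos sub in auto)
    have "(\<lambda>p. A p / fact p * of_real x ^ p) sums H (t + of_real x)" if "\<bar>x\<bar> < s" for x
      using holomorphic_power_series[OF H, of "t + of_real x"] that by (simp add: A_def dist_norm)
    note ser = this
    have "summable (\<lambda>p. norm (A p / fact p * of_real (2 * norm z) ^ p))"
      using sums_summable[OF ser[of "2 * d"]] d z by (intro powser_insidea[where x = "of_real (2 * d)"]) (auto simp: norm_mult)
    then have "summable (\<lambda>p. norm (A p) * (norm z + norm (cnj z)) ^ p / fact p)"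
      by (simp add: norm_mult norm_divide norm_power)
    from has_sum_binomial_pairs[OF this]
    have "((\<lambda>(a, b). A (a + b) * z ^ a * cnj z ^ b / (fact a * fact b)) has_sum (\<Sum>p. A p * (z + cnj z) ^ p / fact p)) UNIV" .
    also have "(\<Sum>p. A p * (z + cnj z) ^ p / fact p) = of_real (K z)"
    proof -
      have "\<bar>2 * Re z\<bar> < s" using z d abs_Re_le_cmod[of z] by linarith
      from ser[OF this] show ?thesis
        using HK[of z] z d by (simp add: complex_add_cnj sums_iff)
    qed
    finally have 2: "((\<lambda>(a, b). A (a + b) * z ^ a * cnj z ^ b / (fact a * fact b)) has_sum of_real (K z)) UNIV" .
    have "((\<lambda>p. (case p of (a, b) \<Rightarrow> gram_coeff g a b * z ^ a * cnj z ^ b) +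
        - (case p of (a, b) \<Rightarrow> A (a + b) * z ^ a * cnj z ^ b / (fact a * fact b))) has_sum of_real (K z) + - of_real (K z)) UNIV"
      by (intro has_sum_add 1 has_sum_uminusI 2)
    then show "((\<lambda>(a, b). (gram_coeff g a b - A (a + b) / (fact a * fact b)) * z ^ a * cnj z ^ b) has_sum 0) UNIV"
      by (simp add: case_prod_unfold algebra_simps)
  qed
  show ?thesis
    unfolding hankel_psd_def
  proof (intro allI)
    fix N :: nat and c :: "nat \<Rightarrow> real"
    let ?x = "\<lambda>w i. complex_of_real (c i * fact i) * taylor_coeff (g w) i"
    have h: "g w holomorphic_on ball 0 d" for w using hol sub by (rule holomorphic_on_subset)
    have gs: "((\<lambda>w. taylor_coeff (g w) a * cnj (taylor_coeff (g w) b)) has_sum gram_coeff g a b) UNIV" for a b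
      by (rule gram_coeff_has_sum[OF d(1) h _ KB]) (use sos sub in auto)
    have "((\<lambda>w. \<Sum>i<N. \<Sum>j<N. complex_of_real (c i * fact i * (c j * fact j)) * (taylor_coeff (g w) i * cnj (taylor_coeff (g w) j)))
       has_sum (\<Sum>i<N. \<Sum>j<N. complex_of_real (c i * fact i * (c j * fact j)) * gram_coeff g i j)) UNIV"
      by (intro has_sum_finite_sum has_sum_cmult_right gs) auto
    also have "(\<lambda>w. \<Sum>i<N. \<Sum>j<N. complex_of_real (c i * fact i * (c j * fact j)) * (taylor_coeff (g w) i * cnj (taylor_coeff (g w) j))) =
      (\<lambda>w. of_real ((cmod (\<Sum>i<N. ?x w i))\<^sup>2))"
      unfolding complex_norm_square by (simp add: sum_product mult_ac)
    also have "(\<Sum>i<N. \<Sum>j<N. complex_of_real (c i * fact i * (c j * fact j)) * gram_coeff g i j) =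
      (\<Sum>i<N. \<Sum>j<N. of_real (c i * c j) * A (i + j))"
      using AC by (intro sum.cong refl) (simp add: field_simps)
    finally have hs: "((\<lambda>w. complex_of_real ((cmod (\<Sum>i<N. ?x w i))\<^sup>2)) has_sum (\<Sum>i<N. \<Sum>j<N. of_real (c i * c j) * A (i + j))) UNIV" .
    have "0 \<le> Re (\<Sum>i<N. \<Sum>j<N. of_real (c i * c j) * A (i + j))"
      by (rule has_sum_nonneg[OF has_sum_Re[OF hs]]) simp
    moreover have "Im (\<Sum>i<N. \<Sum>j<N. of_real (c i * c j) * A (i + j)) = 0"
      using has_sum_Im[OF hs] has_sum_0[of UNIV "\<lambda>_. 0"] by (simp add: has_sum_unique del: of_real_power)
    ultimately show "(\<Sum>i<N. \<Sum>j<N. of_real (c i * c j) * (deriv ^^ (i + j)) H t) \<in> \<real>\<^sub>\<ge>\<^sub>0"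
      by (simp add: complex_nonneg_Reals_iff A_def)
  qed
qed

text \<open>Invariance under rotations kills the off-diagonal Gram coefficients. The diagonal ones
  are sums of squares and become the coefficients of a power series in the squared modulus.\<close>

lemma sos_radial_coefficients:
  fixes G :: "'i \<Rightarrow> complex \<Rightarrow> complex" and \<kappa> :: "real \<Rightarrow> real"
  assumes e: "0 < e" and hol: "\<And>w. G w holomorphic_on ball 0 e"
    and sos: "\<And>z. z \<in> ball 0 e \<Longrightarrow> ((\<lambda>w. (cmod (G w z))\<^sup>2) has_sum \<kappa> ((cmod z)\<^sup>2)) UNIV"
    and B: "\<And>z. z \<in> ball 0 e \<Longrightarrow> \<kappa> ((cmod z)\<^sup>2) \<le> B"
  obtains D where "\<And>a. ((\<lambda>w. (cmod (taylor_coeff (G w) a))\<^sup>2) has_sum D a) UNIV"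
    "\<And>s. 0 \<le> s \<Longrightarrow> s < e\<^sup>2 \<Longrightarrow> (\<lambda>a. D a * s ^ a) sums \<kappa> s"
proof -
  let ?C = "gram_coeff G"
  have exp: "((\<lambda>(a, b). ?C a b * z ^ a * cnj z ^ b) has_sum of_real (\<kappa> ((cmod z)\<^sup>2))) UNIV"
    if "norm z < e" for z
    by (rule gram_coeff_expansion[OF e hol sos B that])
  have off: "?C a b = 0" if ab: "a \<noteq> b" for a b
  proof -
    \<comment> \<open>This angle gives \<open>u ^ a * cnj u ^ b = -1\<close>, so invariance under
      the rotation by \<open>u\<close> forces the coefficient to be 0.\<close>
    define \<theta> where "\<theta> = pi / (real a - real b)"
    define u where "u = cis \<theta>"
    have "?C a b * (u ^ a * cnj u ^ b - 1) = 0"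
    proof (rule hermitian_series_unique[OF e, where E = "\<lambda>a b. ?C a b * (u ^ a * cnj u ^ b - 1)"])
      fix z :: complex assume z: "norm z < e"
      have uz: "norm (u * z) < e" "cmod (u * z) = cmod z" using z by (auto simp: u_def norm_mult)
      have "((\<lambda>p. (case p of (a, b) \<Rightarrow> ?C a b * (u * z) ^ a * cnj (u * z) ^ b) +
         - (case p of (a, b) \<Rightarrow> ?C a b * z ^ a * cnj z ^ b)) has_sum
         of_real (\<kappa> ((cmod (u * z))\<^sup>2)) + - of_real (\<kappa> ((cmod z)\<^sup>2))) UNIV"
        by (intro has_sum_add exp has_sum_uminusI uz z)
      then show "((\<lambda>(a, b). ?C a b * (u ^ a * cnj u ^ b - 1) * z ^ a * cnj z ^ b) has_sum 0) UNIV"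
        unfolding uz(2) by (simp add: case_prod_unfold algebra_simps power_mult_distrib)
    qed
    moreover have "u ^ a * cnj u ^ b = -1"
    proof -
      have "u ^ a * cnj u ^ b = cis (real a * \<theta>) * cis (- (real b * \<theta>))"
        by (simp only: u_def cis_cnj Complex.DeMoivre mult_minus_right)
      also have "\<dots> = cis ((real a - real b) * \<theta>)" by (simp add: cis_mult algebra_simps)
      also have "(real a - real b) * \<theta> = pi" using ab by (simp add: \<theta>_def)
      finally show ?thesis by simp
    qed
    ultimately show ?thesis by simp
  qed
  define D where "D a = Re (?C a a)" for a
  have Dw: "((\<lambda>w. (cmod (taylor_coeff (G w) a))\<^sup>2) has_sum D a) UNIV" for a
  proof -
    have "((\<lambda>w. taylor_coeff (G w) a * cnj (taylor_coeff (G w) a)) has_sum ?C a a) UNIV"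
      by (rule gram_coeff_has_sum[OF e hol sos B])
    from has_sum_Re[OF this] show ?thesis
      by (simp add: D_def complex_mult_cnj cmod_power2)
  qed
  have "(\<lambda>a. D a * s ^ a) sums \<kappa> s" if s: "0 \<le> s" "s < e\<^sup>2" for s
  proof -
    define x where "x = sqrt s"
    have x: "0 \<le> x" "x < e" "x\<^sup>2 = s"
      using s e by (auto simp: x_def intro: real_less_lsqrt)
    have "((\<lambda>(a, b). ?C a b * of_real x ^ a * cnj (of_real x) ^ b) has_sum of_real (\<kappa> s)) (UNIV \<times> UNIV)"
      using exp[of "of_real x"] x by simp
    then have "((\<lambda>a. ?C a a * of_real x ^ a * cnj (of_real x) ^ a) has_sum of_real (\<kappa> s)) UNIV"
    proof (rule has_sum_SigmaD)
      fix a
      show "((\<lambda>b. case (a, b) of (a, b) \<Rightarrow> ?C a b * of_real x ^ a * cnj (of_real x) ^ b) has_sum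
        ?C a a * of_real x ^ a * cnj (of_real x) ^ a) UNIV"
        by (rule has_sum_finite_neutralI[of "{a}"]) (use off in auto)
    qed
    from sums_Re[OF has_sum_imp_sums[OF this]]
    have "(\<lambda>a. Re (?C a a * of_real x ^ a * cnj (of_real x) ^ a)) sums \<kappa> s" by simp
    also have "(\<lambda>a. Re (?C a a * of_real x ^ a * cnj (of_real x) ^ a)) = (\<lambda>a. D a * s ^ a)"
    proof
      fix a
      have "?C a a * of_real x ^ a * cnj (of_real x) ^ a = ?C a a * of_real (x ^ a * x ^ a)" by simp
      also have "x ^ a * x ^ a = s ^ a" by (simp add: x(3)[symmetric] power2_eq_square power_mult_distrib)
      finally show "Re (?C a a * of_real x ^ a * cnj (of_real x) ^ a) = D a * s ^ a"
        by (simp only: D_def times_complex.simps Re_complex_of_real Im_complex_of_real mult_zero_right diff_zero)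
    qed
    finally show ?thesis .
  qed
  with Dw show thesis by (rule that)
qed

text \<open>The given series represents the derivative of \<open>s * F1 (r + s)\<close>; it is
  integrated term by term and divided by \<open>s\<close>, which leaves \<open>s = 0\<close> as a
  separate case.\<close>

lemma sums_antiderivative_shift:
  fixes F1 F2 :: "real \<Rightarrow> real"
  assumes D: "\<And>s. 0 \<le> s \<Longrightarrow> s < E \<Longrightarrow> (\<lambda>k. D k * s ^ k) sums (F1 (r + s) + s * F2 (r + s))"
    and F: "\<And>s. 0 \<le> s \<Longrightarrow> s < E \<Longrightarrow> (F1 has_real_derivative F2 (r + s)) (at (r + s))"
    and s: "0 \<le> s" "s < E"
  shows "(\<lambda>k. D k / real (Suc k) * s ^ k) sums F1 (r + s)"
proof (cases "s = 0")
  case True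
  have "(\<lambda>k. D k * 0 ^ k) sums F1 r" using D[of 0] s by simp
  then have "D 0 = F1 r" using powser_sums_zero_iff by blast
  then show ?thesis using True powser_sums_zero_iff[of "\<lambda>k. D k / real (Suc k)" "F1 r"] by simp
next
  case False
  \<comment> \<open>Coefficients of \<open>s * F1 (r + s)\<close>, hence the shift by one and the
    vanishing constant term.\<close>
  define c where "c k = (case k of 0 \<Rightarrow> 0 | Suc j \<Rightarrow> D j / real (Suc j))" for k
  have dc: "diffs c = D" by (auto simp: diffs_def c_def fun_eq_iff)
  have absD: "summable (\<lambda>k. norm (D k * x ^ k))" if "norm x < E" for x :: real
  proof -
    define y where "y = (norm x + E) / 2"
    have y: "norm x < y" "y < E" "0 \<le> y" using that by (auto simp: y_def)
    have "summable (\<lambda>k. D k * y ^ k)" by (rule sums_summable[OF D]) (use y in auto)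
    then show ?thesis by (rule powser_insidea) (use y in auto)
  qed
  have b: "summable (\<lambda>k. D k / real (Suc k) * x ^ k)" if "norm x < E" for x :: real
  proof (rule summable_comparison_test'[OF absD[OF that], of 0])
    fix k :: nat
    have "\<bar>D k / real (Suc k)\<bar> \<le> \<bar>D k\<bar> / 1" unfolding abs_divide by (rule divide_left_mono) auto
    then show "norm (D k / real (Suc k) * x ^ k) \<le> norm (D k * x ^ k)"
      unfolding real_norm_def abs_mult by (intro mult_right_mono) auto
  qed
  have csum: "(\<lambda>k. c k * x ^ k) sums (x * (\<Sum>k. D k / real (Suc k) * x ^ k))" if "norm x < E" for x
  proof -
    have "(\<lambda>k. c (Suc k) * x ^ Suc k) sums (x * (\<Sum>k. D k / real (Suc k) * x ^ k))"
      using sums_mult[OF summable_sums[OF b[OF that]], of x] by (simp add: c_def mult_ac)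
    then show ?thesis using sums_Suc_iff[of "\<lambda>k. c k * x ^ k"] by (simp add: c_def)
  qed
  define \<Phi> where "\<Phi> x = x * F1 (r + x) - (\<Sum>k. c k * x ^ k)" for x
  have dPhi: "(\<Phi> has_real_derivative 0) (at x within {0..<E})" if x: "x \<in> {0..<E}" for x
  proof -
    have "((\<lambda>x. \<Sum>k. c k * x ^ k) has_real_derivative (\<Sum>k. diffs c k * x ^ k)) (at x)"
      by (rule termdiffs_strong'[of E]) (use csum x in \<open>auto intro: sums_summable\<close>)
    moreover have "(\<Sum>k. diffs c k * x ^ k) = F1 (r + x) + x * F2 (r + x)"
      using D[of x] x by (simp add: dc sums_iff)
    ultimately have 1: "((\<lambda>x. \<Sum>k. c k * x ^ k) has_real_derivative F1 (r + x) + x * F2 (r + x)) (at x)" by simp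
    have "((\<lambda>x. F1 (r + x)) has_real_derivative F2 (r + x) * 1) (at x)"
      by (rule DERIV_chain'[where g = F1 and f = "\<lambda>x. r + x"]) (use F[of x] x in \<open>auto intro!: derivative_eq_intros\<close>)
    then have "(\<Phi> has_real_derivative (1 * F1 (r + x) + F2 (r + x) * 1 * x) - (F1 (r + x) + x * F2 (r + x))) (at x)"
      unfolding \<Phi>_def by (intro DERIV_diff 1 DERIV_mult DERIV_ident)
    then show ?thesis by (simp add: mult.commute has_field_derivative_at_within)
  qed
  have "\<exists>c. \<forall>x\<in>{0..<E}. \<Phi> x = c"
    by (rule has_field_derivative_zero_constant) (use dPhi in auto)
  then have "\<Phi> s = \<Phi> 0" using s by auto
  also have "\<Phi> 0 = 0" by (simp add: \<Phi>_def c_def)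
  finally have "s * F1 (r + s) = s * (\<Sum>k. D k / real (Suc k) * s ^ k)"
    using csum[of s] s by (simp add: \<Phi>_def sums_iff)
  then have "F1 (r + s) = (\<Sum>k. D k / real (Suc k) * s ^ k)" using False by simp
  then show ?thesis using b[of s] s by (simp add: sums_iff)
qed

text \<open>Expanding in \<open>\<eta>\<close> shows that \<open>F1\<close> is analytic and that its \<open>k\<close>-th derivative is a sum of squares
  of functions holomorphic in \<open>\<zeta>\<close>. The series produced at a radius represents \<open>F1\<close> only to its
  right, so \<open>P\<close> is taken from a radius slightly below \<open>r1\<close>.\<close>

lemma radial_sos_local:
  fixes F1 F2 :: "real \<Rightarrow> real" and g :: "'i \<Rightarrow> complex \<Rightarrow> complex \<Rightarrow> complex"
  defines "rad \<equiv> \<lambda>r1 \<zeta> \<eta>. r1 * exp (2 * Re \<zeta>) + (cmod \<eta>)\<^sup>2"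
  assumes r1: "0 < r1" and e: "0 < e"
    and F: "\<And>r. r \<in> J \<Longrightarrow> (F1 has_real_derivative F2 r) (at r)"
    and J: "\<And>\<zeta> \<eta>. \<zeta> \<in> ball 0 e \<Longrightarrow> \<eta> \<in> ball 0 e \<Longrightarrow> rad r1 \<zeta> \<eta> \<in> J"
    and B: "\<And>\<zeta> \<eta>. \<zeta> \<in> ball 0 e \<Longrightarrow> \<eta> \<in> ball 0 e \<Longrightarrow>
       F1 (rad r1 \<zeta> \<eta>) + (cmod \<eta>)\<^sup>2 * F2 (rad r1 \<zeta> \<eta>) \<le> B"
    and h1: "\<And>w \<eta>. \<eta> \<in> ball 0 e \<Longrightarrow> (\<lambda>\<zeta>. g w \<zeta> \<eta>) holomorphic_on ball 0 e"
    and h2: "\<And>w \<zeta>. \<zeta> \<in> ball 0 e \<Longrightarrow> g w \<zeta> holomorphic_on ball 0 e"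
    and gB: "\<And>w. \<exists>C. \<forall>\<zeta>\<in>ball 0 e. \<forall>\<eta>\<in>ball 0 e. norm (g w \<zeta> \<eta>) \<le> C"
    and sos: "\<And>\<zeta> \<eta>. \<zeta> \<in> ball 0 e \<Longrightarrow> \<eta> \<in> ball 0 e \<Longrightarrow>
       ((\<lambda>w. (cmod (deriv (g w \<zeta>) \<eta>))\<^sup>2) has_sum
         (F1 (rad r1 \<zeta> \<eta>) + (cmod \<eta>)\<^sup>2 * F2 (rad r1 \<zeta> \<eta>))) UNIV"
  obtains P \<rho> where "0 < \<rho>" "P holomorphic_on ball (of_real r1) \<rho>" "all_hankel_psd P r1"
    "\<And>x. \<bar>x - r1\<bar> < \<rho> \<Longrightarrow> P (of_real x) = of_real (F1 x)"
proof -
  have coeffs: "\<exists>D. (\<forall>a. ((\<lambda>w. (cmod (taylor_coeff (deriv (g w \<zeta>)) a))\<^sup>2) has_sum D a) UNIV) \<and>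
      (\<forall>s. 0 \<le> s \<and> s < e\<^sup>2 \<longrightarrow> (\<lambda>k. D k / real (Suc k) * s ^ k) sums F1 (r1 * exp (2 * Re \<zeta>) + s))"
    if \<zeta>: "\<zeta> \<in> ball 0 e" for \<zeta>
  proof -
    define r where "r = r1 * exp (2 * Re \<zeta>)"
    obtain D where D: "\<And>a. ((\<lambda>w. (cmod (taylor_coeff (deriv (g w \<zeta>)) a))\<^sup>2) has_sum D a) UNIV"
      "\<And>s. 0 \<le> s \<Longrightarrow> s < e\<^sup>2 \<Longrightarrow> (\<lambda>a. D a * s ^ a) sums (F1 (r + s) + s * F2 (r + s))"
    proof (rule sos_radial_coefficients[OF e, of "\<lambda>w. deriv (g w \<zeta>)" "\<lambda>s. F1 (r + s) + s * F2 (r + s)" B])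
      show "deriv (g w \<zeta>) holomorphic_on ball 0 e" for w
        by (rule holomorphic_deriv[OF h2[OF \<zeta>]]) auto
    qed (use sos[OF \<zeta>] B[OF \<zeta>] in \<open>auto simp: rad_def r_def\<close>)
    have "(\<lambda>k. D k / real (Suc k) * s ^ k) sums F1 (r + s)" if "0 \<le> s" "s < e\<^sup>2" for s
    proof (rule sums_antiderivative_shift[OF D(2) _ that])
      fix s :: real assume s: "0 \<le> s" "s < e\<^sup>2"
      have "sqrt s < e" using s e by (auto intro: real_less_lsqrt)
      then have "rad r1 \<zeta> (of_real (sqrt s)) \<in> J" using s by (intro J \<zeta>) auto
      then show "(F1 has_real_derivative F2 (r + s)) (at (r + s))" using F s by (simp add: rad_def r_def)
    qed auto
    with D(1) show ?thesis unfolding r_def by blast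
  qed
  \<comment> \<open>The auxiliary base radius \<open>r'\<close> belongs to
    \<open>\<zeta> = - x\<close>. The second bound on \<open>x\<close> gives
    \<open>r1 - r' \<le> e\<^sup>2 / 2\<close>, so the series started at \<open>r'\<close> reaches
    beyond \<open>r1\<close>.\<close>
  define x where "x = min (e / 2) (e\<^sup>2 / (4 * r1))"
  define r' where "r' = r1 * exp (- 2 * x)"
  have x: "0 < x" "x < e" using e r1 by (auto simp: x_def)
  have r'1: "r' < r1" using r1 x by (simp add: r'_def)
  have r'2: "r1 < r' + e\<^sup>2"
  proof -
    have "1 - 2 * x \<le> exp (- 2 * x)" using exp_ge_add_one_self[of "- 2 * x"] by simp
    then have "r1 * (1 - 2 * x) \<le> r'" unfolding r'_def using r1 by (intro mult_left_mono) auto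
    moreover have "r1 * x \<le> r1 * (e\<^sup>2 / (4 * r1))" using r1 by (intro mult_left_mono) (auto simp: x_def)
    then have "r1 * x \<le> e\<^sup>2 / 4" using r1 by simp
    moreover have "0 < e\<^sup>2" using e by simp
    ultimately show ?thesis unfolding right_diff_distrib by linarith
  qed
  have "of_real (- x) \<in> ball (0::complex) e" using x by simp
  from coeffs[OF this] obtain D' where D': "\<And>s. 0 \<le> s \<Longrightarrow> s < e\<^sup>2 \<Longrightarrow> (\<lambda>k. D' k / real (Suc k) * s ^ k) sums F1 (r' + s)"
    by (auto simp: r'_def)
  define P where "P w = (\<Sum>k. of_real (D' k / real (Suc k)) * (w - of_real r') ^ k)" for w :: complex
  define \<rho> where "\<rho> = min (r1 - r') (r' + e\<^sup>2 - r1)"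
  have \<rho>: "0 < \<rho>" using r'1 r'2 by (simp add: \<rho>_def)
  have "P holomorphic_on ball (of_real r') (e\<^sup>2)"
    unfolding P_def by (rule power_series_holomorphic_real) (use D' in \<open>auto intro: sums_summable\<close>)
  then have Ph: "P holomorphic_on ball (of_real r1) \<rho>"
  proof (rule holomorphic_on_subset)
    show "ball (of_real r1) \<rho> \<subseteq> ball (complex_of_real r') (e\<^sup>2)"
      unfolding ball_subset_ball_iff dist_of_real dist_real_def using r'1 by (auto simp: \<rho>_def)
  qed
  have PF: "P (of_real y) = of_real (F1 y)" if "\<bar>y - r1\<bar> < \<rho>" for y
  proof -
    have "0 \<le> y - r'" "y - r' < e\<^sup>2" using that by (auto simp: \<rho>_def)
    from D'[OF this] have "(\<lambda>k. complex_of_real (D' k / real (Suc k) * (y - r') ^ k)) sums of_real (F1 y)"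
      by (subst sums_of_real_iff) simp
    then show ?thesis by (simp add: P_def sums_iff)
  qed
  have "isCont (\<lambda>\<zeta>. r1 * exp (2 * Re \<zeta>)) 0"
    by (intro continuous_intros linear_continuous_at bounded_linear_Re)
  then have "((\<lambda>\<zeta>. r1 * exp (2 * Re \<zeta>)) \<longlongrightarrow> r1) (at 0)" by (simp add: isCont_def)
  from tendstoD[OF this \<rho>] obtain d where d: "d > 0" "\<And>\<zeta>. \<zeta> \<noteq> 0 \<Longrightarrow> dist \<zeta> 0 < d \<Longrightarrow> dist (r1 * exp (2 * Re \<zeta>)) r1 < \<rho>"
    unfolding eventually_at by auto
  define e' where "e' = min e d"
  have e': "0 < e'" "e' \<le> e" "e' \<le> d" using e d by (auto simp: e'_def)
  have near: "\<bar>r1 * exp (2 * Re \<zeta>) - r1\<bar> < \<rho>" if "\<zeta> \<in> ball 0 e'" for \<zeta>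
    using d(2)[of \<zeta>] that e' \<rho> by (cases "\<zeta> = 0") (auto simp: dist_real_def)
  have "all_hankel_psd P r1"
    unfolding all_hankel_psd_def
  proof
    fix k
    define H where "H = (\<lambda>\<tau>. (deriv ^^ k) P (exp \<tau>))"
    have er1: "exp (complex_of_real (ln r1)) = of_real r1" using r1 by (metis exp_ln exp_of_real)
    have "open (exp -` ball (of_real r1) \<rho> :: complex set)"
      by (intro open_vimage continuous_intros) auto
    moreover have "of_real (ln r1) \<in> (exp -` ball (of_real r1) \<rho> :: complex set)" using er1 \<rho> by simp
    ultimately obtain s where s: "s > 0" "ball (of_real (ln r1)) s \<subseteq> (exp -` ball (of_real r1) \<rho> :: complex set)"
      using openE by blast
    have Hh: "H holomorphic_on ball (of_real (ln r1)) s"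
      unfolding H_def
      by (rule holomorphic_on_compose_gen[of exp _ "(deriv ^^ k) P", unfolded o_def])
         (use s Ph in \<open>auto intro!: holomorphic_intros\<close>)
    \<comment> \<open>The \<open>k\<close>-th derivative at the moving radius is
      \<open>q * D k\<close>: the factorial comes from Taylor's formula, the denominator
      \<open>Suc k\<close> from integrating the series.\<close>
    define q where "q = fact k / real (Suc k)"
    have q: "0 \<le> q" by (simp add: q_def)
    define h where "h w \<zeta> = of_real (sqrt q) * taylor_coeff (deriv (g w \<zeta>)) k" for w \<zeta>
    \<comment> \<open>The bound \<open>gB\<close> concerns \<open>g\<close> and not its derivative
      in \<open>\<eta>\<close>, so holomorphy in \<open>\<zeta>\<close> is derived for the
      coefficient of order \<open>Suc k\<close> of \<open>g\<close> itself.\<close>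
    have tc: "taylor_coeff (deriv f) k = of_nat (Suc k) * taylor_coeff f (Suc k)" for f
      by (simp add: taylor_coeff_def funpow_Suc_right del: funpow.simps of_nat_Suc)
    show "hankel_psd (\<lambda>\<tau>. (deriv ^^ k) P (exp \<tau>)) (of_real (ln r1))"
      unfolding H_def[symmetric]
    proof (rule hankel_psd_sum_squares[OF e'(1) s(1) Hh, of h "\<lambda>\<zeta>. Re (H (of_real (ln r1) + of_real (2 * Re \<zeta>)))"])
      fix w
      obtain C where "\<forall>\<zeta>\<in>ball 0 e. \<forall>\<eta>\<in>ball 0 e. norm (g w \<zeta> \<eta>) \<le> C" using gB by blast
      then have "(\<lambda>\<zeta>. taylor_coeff (g w \<zeta>) (Suc k)) holomorphic_on ball 0 e"
        by (intro taylor_coeff_holomorphic_parameter[OF _ e h1 h2, where B = C]) auto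
      then show "h w holomorphic_on ball 0 e'"
        unfolding h_def tc using e' by (intro holomorphic_intros) (auto intro: holomorphic_on_subset)
    next
      fix \<zeta> :: complex assume \<zeta>: "\<zeta> \<in> ball 0 e'"
      define r where "r = r1 * exp (2 * Re \<zeta>)"
      have r: "\<bar>r - r1\<bar> < \<rho>" using near[OF \<zeta>] by (simp add: r_def)
      have ex: "exp (complex_of_real (ln r1) + of_real (2 * Re \<zeta>)) = of_real r"
        unfolding exp_add er1 r_def of_real_mult[of r1] by (simp only: exp_of_real)
      obtain D where D: "((\<lambda>w. (cmod (taylor_coeff (deriv (g w \<zeta>)) k))\<^sup>2) has_sum D k) UNIV"
        "\<And>s. 0 \<le> s \<Longrightarrow> s < e\<^sup>2 \<Longrightarrow> (\<lambda>k. D k / real (Suc k) * s ^ k) sums F1 (r + s)"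
        using coeffs[of \<zeta>] \<zeta> e' unfolding r_def by auto
      define \<delta> where "\<delta> = min (e\<^sup>2) (\<rho> - \<bar>r - r1\<bar>)"
      have \<delta>: "0 < \<delta>" using e r by (simp add: \<delta>_def)
      have sub: "ball (of_real r) \<delta> \<subseteq> ball (complex_of_real r1) \<rho>"
        unfolding ball_subset_ball_iff dist_of_real dist_real_def by (auto simp: \<delta>_def)
      \<comment> \<open>Two series represent \<open>F1\<close> to the right of \<open>r\<close>,
        which is enough for uniqueness. One is the Taylor series of the fixed function
        \<open>P\<close>, the other comes from the sum of squares at this
        \<open>\<zeta>\<close>.\<close>
      have "(deriv ^^ k) P (of_real r) / fact k - of_real (D k / real (Suc k)) = 0"
      proof (rule power_series_zero_on_reals[OF \<delta>, where c = "\<lambda>k. (deriv ^^ k) P (of_real r) / fact k - of_real (D k / real (Suc k))"])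
        fix s :: real assume s: "0 \<le> s" "s < \<delta>"
        have "(\<lambda>n. (deriv ^^ n) P (of_real r) / fact n * (of_real (r + s) - of_real r) ^ n) sums P (of_real (r + s))"
          by (rule holomorphic_power_series[OF holomorphic_on_subset[OF Ph sub]]) (use s in \<open>simp add: dist_norm\<close>)
        moreover have "P (of_real (r + s)) = of_real (F1 (r + s))"
          by (rule PF) (use s in \<open>auto simp: \<delta>_def\<close>)
        ultimately have "(\<lambda>n. (deriv ^^ n) P (of_real r) / fact n * of_real s ^ n) sums of_real (F1 (r + s))" by simp
        moreover have "(\<lambda>n. complex_of_real (D n / real (Suc n) * s ^ n)) sums of_real (F1 (r + s))"
          using D(2)[of s] s by (subst sums_of_real_iff) (auto simp: \<delta>_def)
        ultimately have "(\<lambda>n. (deriv ^^ n) P (of_real r) / fact n * of_real s ^ n - complex_of_real (D n / real (Suc n) * s ^ n)) sums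
           (of_real (F1 (r + s)) - of_real (F1 (r + s)))"
          by (rule sums_diff)
        then show "(\<lambda>n. ((deriv ^^ n) P (of_real r) / fact n - of_real (D n / real (Suc n))) * of_real s ^ n) sums 0"
          by (simp add: left_diff_distrib)
      qed
      then have "(deriv ^^ k) P (of_real r) = fact k * of_real (D k / real (Suc k))"
        by (simp add: field_simps)
      then have val: "H (of_real (ln r1) + of_real (2 * Re \<zeta>)) = of_real (q * D k)"
        unfolding H_def ex by (simp add: q_def)
      then show "H (of_real (ln r1) + of_real (2 * Re \<zeta>)) = of_real (Re (H (of_real (ln r1) + of_real (2 * Re \<zeta>))))"
        by simp
      have "((\<lambda>w. q * (cmod (taylor_coeff (deriv (g w \<zeta>)) k))\<^sup>2) has_sum q * D k) UNIV"
        by (intro has_sum_cmult_right D)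
      then show "((\<lambda>w. (cmod (h w \<zeta>))\<^sup>2) has_sum Re (H (of_real (ln r1) + of_real (2 * Re \<zeta>)))) UNIV"
        unfolding val using q by (simp add: h_def norm_mult power_mult_distrib)
    qed
  qed
  with \<rho> Ph PF show thesis by (intro that) auto
qed

text \<open>Each point of \<open>J\<close> has its own expansion about 0, valid near that point. On
  overlaps the expansions coincide, so the coefficient sequence is locally constant on the connected
  set \<open>J\<close>.\<close>

theorem power_series_if_locally_hankel_psd:
  fixes F1 :: "real \<Rightarrow> real" and J :: "real set"
  assumes J: "connected J" "J \<noteq> {}" "\<And>r. r \<in> J \<Longrightarrow> 0 < r"
    and loc: "\<And>r. r \<in> J \<Longrightarrow> \<exists>P \<rho>. 0 < \<rho> \<and> P holomorphic_on ball (of_real r) \<rho> \<and> all_hankel_psd P r \<and>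
      (\<forall>x. \<bar>x - r\<bar> < \<rho> \<longrightarrow> P (of_real x) = of_real (F1 x))"
  obtains a where "\<And>k. 0 \<le> a k" "\<And>r. r \<in> J \<Longrightarrow> (\<lambda>k. a k * r ^ k) sums F1 r"
proof -
  have "\<exists>a \<rho>. 0 < \<rho> \<and> (\<forall>k. 0 \<le> a k) \<and> (\<forall>x. 0 < x \<longrightarrow> \<bar>x - r\<bar> < \<rho> \<longrightarrow> (\<lambda>k. a k * x ^ k) sums F1 x)"
    if r: "r \<in> J" for r
  proof -
    obtain P \<rho> where P: "0 < \<rho>" "P holomorphic_on ball (of_real r) \<rho>" "all_hankel_psd P r"
      "\<And>x. \<bar>x - r\<bar> < \<rho> \<Longrightarrow> P (of_real x) = of_real (F1 x)"
      using loc[OF r] by blast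
    obtain a where a: "\<And>k. 0 \<le> a k" "\<And>z. 0 \<le> z \<Longrightarrow> z < r + \<rho> \<Longrightarrow> summable (\<lambda>k. a k * z ^ k)"
      "\<And>w. w \<in> ball (of_real r) \<rho> \<Longrightarrow> (\<lambda>k. of_real (a k) * w ^ k) sums P w"
      by (rule hankel_psd_power_series[OF J(3)[OF r] P(1-3)]) (rule that, assumption+)
    have "(\<lambda>k. a k * x ^ k) sums F1 x" if x: "\<bar>x - r\<bar> < \<rho>" for x
    proof -
      have "complex_of_real x \<in> ball (of_real r) \<rho>"
        unfolding mem_ball dist_of_real dist_real_def using x by linarith
      from a(3)[OF this] have "(\<lambda>k. complex_of_real (a k * x ^ k)) sums of_real (F1 x)"
        using P(4)[OF x] by simp
      then show ?thesis by (simp only: sums_of_real_iff)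
    qed
    then show ?thesis using a(1) P(1) by blast
  qed
  then obtain A R where AR: "\<And>r. r \<in> J \<Longrightarrow> 0 < R r" "\<And>r k. r \<in> J \<Longrightarrow> 0 \<le> A r k"
    "\<And>r x. r \<in> J \<Longrightarrow> 0 < x \<Longrightarrow> \<bar>x - r\<bar> < R r \<Longrightarrow> (\<lambda>k. A r k * x ^ k) sums F1 x"
    by metis
  have locconst: "A r = A r'" if r: "r \<in> J" and r': "r' \<in> J" "\<bar>r' - r\<bar> < R r" for r r'
  proof -
    have r'0: "0 < r'" using J(3) r' by simp
    define \<delta> where "\<delta> = min (min r' (R r')) (R r - \<bar>r' - r\<bar>)"
    have \<delta>: "0 < \<delta>" "\<delta> \<le> r'" "\<delta> \<le> R r'" "\<delta> \<le> R r - \<bar>r' - r\<bar>"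
      using r'0 AR(1)[OF r'(1)] r'(2) by (auto simp: \<delta>_def)
    have inA: "(\<lambda>k. A r k * x ^ k) sums F1 x" "(\<lambda>k. A r' k * x ^ k) sums F1 x" if "\<bar>x - r'\<bar> < \<delta>" for x
      using AR(3)[OF r, of x] AR(3)[OF r'(1), of x] that \<delta> by (auto simp: abs_if split: if_splits)
    define c where "c k = complex_of_real (A r k - A r' k)" for k
    have cs: "(\<lambda>k. c k * complex_of_real x ^ k) sums 0" if "\<bar>x - r'\<bar> < \<delta>" for x
    proof -
      have "(\<lambda>k. A r k * x ^ k - A r' k * x ^ k) sums (F1 x - F1 x)" by (intro sums_diff inA that)
      then have "(\<lambda>k. (A r k - A r' k) * x ^ k) sums 0" by (simp add: left_diff_distrib)
      then have "(\<lambda>k. complex_of_real ((A r k - A r' k) * x ^ k)) sums of_real 0"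
        by (subst sums_of_real_iff)
      then show ?thesis by (simp add: c_def)
    qed
    \<comment> \<open>The difference of the two series converges on a disc about 0 that reaches past
      \<open>r'\<close>, and it vanishes between \<open>r'\<close> and \<open>r''\<close>.\<close>
    define r'' where "r'' = r' + \<delta> / 2"
    have sm: "summable (\<lambda>k. c k * w ^ k)" if "norm w < r''" for w
    proof (rule powser_inside[OF sums_summable[OF cs[of r'']]])
      have "0 < r''" using \<delta> r'0 by (simp add: r''_def)
      then show "norm w < norm (complex_of_real r'')" using that by simp
    qed (use \<delta> in \<open>simp add: r''_def\<close>)
    have Gs: "(\<lambda>k. c k * w ^ k) sums (\<Sum>k. c k * w ^ k)" if "norm w < r''" for w
      using sm[OF that] by (rule summable_sums)
    have G: "(\<lambda>w. \<Sum>k. c k * w ^ k) holomorphic_on ball 0 r''"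
      by (rule power_series_holomorphic[where a = c]) (use Gs in auto)
    have "(\<Sum>k. c k * w ^ k) = 0" if "w \<in> ball 0 r''" for w
    proof (rule holomorphic_eq_if_eq_on_reals[of "\<lambda>w. \<Sum>k. c k * w ^ k" "ball 0 r''" "\<lambda>_. 0" r' r''])
      show "(\<Sum>k. c k * of_real x ^ k) = 0" if "r' < x" "x < r''" for x
        using cs[of x] that \<delta> by (simp add: r''_def sums_iff)
    qed (use G \<delta> r'0 that in \<open>auto simp: r''_def\<close>)
    then have "(\<lambda>k. c k * of_real x ^ k) sums 0" if "0 \<le> x" "x < r''" for x
      using Gs[of "of_real x"] that by simp
    then have "c k = 0" for k
      by (rule power_series_zero_on_reals[rotated]) (use \<delta> r'0 in \<open>auto simp: r''_def\<close>)
    then show ?thesis by (auto simp: c_def)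
  qed
  obtain r0 where r0: "r0 \<in> J" using J by blast
  have const: "A r0 = A r" if "r \<in> J" for r
  proof (rule connected_local_const[OF J(1) r0 that])
    show "\<forall>a\<in>J. \<forall>\<^sub>F b in at a within J. A a = A b"
      unfolding eventually_at using locconst AR(1) unfolding dist_real_def by blast
  qed
  show thesis
  proof (rule that)
    show "0 \<le> A r0 k" for k using AR(2)[OF r0] .
    show "(\<lambda>k. A r0 k * r ^ k) sums F1 r" if "r \<in> J" for r
      using AR(3)[OF that, of r] AR(1)[OF that] J(3)[OF that] const[OF that] by simp
  qed
qed

subsection \<open>Radial Hermitian matrices\<close>

lemma wirtinger_eqI:
  assumes "(F has_derivative (\<lambda>h. p * h + q * cnj h)) (at 0)"
  shows "wirtinger F = p" and "wirtinger_bar F = q"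
proof -
  have lin: "vector_derivative (\<lambda>x. F (c * of_real x)) (at 0) = p * c + q * cnj c" for c
  proof (rule vector_derivative_at)
    have "(F has_derivative (\<lambda>h. p * h + q * cnj h)) (at (c * of_real 0))" using assms by simp
    then have "((\<lambda>x. F (c * of_real x)) has_derivative (\<lambda>x. p * (c * of_real x) + q * cnj (c * of_real x))) (at 0)"
      by (rule has_derivative_compose[rotated]) (auto intro!: derivative_eq_intros)
    then show "((\<lambda>x. F (c * of_real x)) has_vector_derivative p * c + q * cnj c) (at 0)"
      unfolding has_vector_derivative_def
      by (rule has_derivative_eq_rhs) (auto simp: fun_eq_iff scaleR_conv_of_real algebra_simps)
  qed
  show "wirtinger F = p" "wirtinger_bar F = q"
    using lin[of 1] unfolding wirtinger_def wirtinger_bar_def lin[of \<i>]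
    by (simp_all add: algebra_simps)
qed

text \<open>The argument of \<open>\<phi>\<close> is the squared norm of a point \<open>z\<close>
  displaced by \<alpha> times \<open>u\<close> and \<beta> times \<open>v\<close> in a Hermitian
  inner product; \<open>b\<close>, \<open>c\<close>, \<open>d\<close> are the products of
  \<open>u\<close> with \<open>z\<close>, of \<open>v\<close> with \<open>z\<close> and of
  \<open>u\<close> with \<open>v\<close>. One computation thus serves the radial potentials and both
  space forms.\<close>

lemma mixed_wirtinger_quadratic:
  fixes \<phi> \<phi>1 :: "real \<Rightarrow> real"
  assumes S: "open S" "W \<in> S" and d1: "\<And>x. x \<in> S \<Longrightarrow> (\<phi> has_real_derivative \<phi>1 x) (at x)"
    and d2: "(\<phi>1 has_real_derivative \<phi>2) (at W)"
  shows "mixed_wirtinger (\<lambda>\<alpha> \<beta>. \<phi> (W + (cmod \<alpha>)\<^sup>2 * U + (cmod \<beta>)\<^sup>2 * V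
     + 2 * Re (\<alpha> * b + \<beta> * c + \<alpha> * cnj \<beta> * d))) = of_real (\<phi>1 W) * d + of_real \<phi>2 * b * cnj c"
proof -
  define N where "N \<alpha> \<beta> = W + (cmod \<alpha>)\<^sup>2 * U + (cmod \<beta>)\<^sup>2 * V + 2 * Re (\<alpha> * b + \<beta> * c + \<alpha> * cnj \<beta> * d)"
    for \<alpha> \<beta>
  define n where "n \<alpha> = W + (cmod \<alpha>)\<^sup>2 * U + 2 * Re (\<alpha> * b)" for \<alpha>
  define \<Psi> where "\<Psi> \<alpha> = of_real (\<phi>1 (n \<alpha>)) * (cnj c + \<alpha> * d)" for \<alpha>
  have inner: "wirtinger_bar (\<lambda>\<beta>. of_real (\<phi> (N \<alpha> \<beta>))) = \<Psi> \<alpha>" if "n \<alpha> \<in> S" for \<alpha>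
  proof (rule wirtinger_eqI(2))
    have N0: "N \<alpha> 0 = n \<alpha>" by (simp add: N_def n_def)
    have dN: "(N \<alpha> has_derivative (\<lambda>h. 2 * Re (h * c + \<alpha> * cnj h * d))) (at 0)"
      unfolding N_def cmod_power2
      by (auto intro!: derivative_eq_intros simp: fun_eq_iff algebra_simps)
    have "(\<phi> has_derivative (\<lambda>h. \<phi>1 (n \<alpha>) * h)) (at (N \<alpha> 0))"
      using d1[OF that] unfolding N0 by (simp add: has_field_derivative_def mult.commute[of _ "\<phi>1 _"])
    from has_derivative_compose[OF dN this]
    have "((\<lambda>\<beta>. of_real (\<phi> (N \<alpha> \<beta>))) has_derivative
        (\<lambda>h. complex_of_real (\<phi>1 (n \<alpha>) * (2 * Re (h * c + \<alpha> * cnj h * d))))) (at 0)"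
      by (rule has_derivative_of_real)
    then show "((\<lambda>\<beta>. of_real (\<phi> (N \<alpha> \<beta>))) has_derivative
        (\<lambda>h. (of_real (\<phi>1 (n \<alpha>)) * (c + cnj \<alpha> * cnj d)) * h + \<Psi> \<alpha> * cnj h)) (at 0)"
    proof (rule has_derivative_eq_rhs)
      have "complex_of_real (2 * Re z) = z + cnj z" for z by (simp add: complex_add_cnj)
      then show "(\<lambda>h. complex_of_real (\<phi>1 (n \<alpha>) * (2 * Re (h * c + \<alpha> * cnj h * d)))) =
        (\<lambda>h. (of_real (\<phi>1 (n \<alpha>)) * (c + cnj \<alpha> * cnj d)) * h + \<Psi> \<alpha> * cnj h)"
        by (simp only: of_real_mult[of "\<phi>1 _"] \<Psi>_def) (simp add: fun_eq_iff algebra_simps)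
    qed
  qed
  have n0: "n 0 = W" by (simp add: n_def)
  have "open (n -` S)"
    unfolding n_def by (intro open_vimage S(1) continuous_intros)
  then have "\<forall>\<^sub>F \<alpha> in nhds 0. \<alpha> \<in> n -` S"
    using S(2) n0 by (intro eventually_nhds_in_open) auto
  then have ev: "\<forall>\<^sub>F \<alpha> in nhds 0. wirtinger_bar (\<lambda>\<beta>. of_real (\<phi> (N \<alpha> \<beta>))) = \<Psi> \<alpha>"
    by eventually_elim (use inner in auto)
  have dn: "(n has_derivative (\<lambda>h. 2 * Re (h * b))) (at 0)"
    unfolding n_def cmod_power2
    by (auto intro!: derivative_eq_intros simp: fun_eq_iff algebra_simps)
  have "(\<phi>1 has_derivative (\<lambda>h. \<phi>2 * h)) (at (n 0))"
    using d2 unfolding n0 by (simp add: has_field_derivative_def mult.commute[of _ \<phi>2])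
  from has_derivative_compose[OF dn this]
  have "((\<lambda>\<alpha>. complex_of_real (\<phi>1 (n \<alpha>))) has_derivative (\<lambda>h. complex_of_real (\<phi>2 * (2 * Re (h * b))))) (at 0)"
    by (rule has_derivative_of_real)
  then have "(\<Psi> has_derivative (\<lambda>h. of_real (\<phi>1 (n 0)) * (h * d) + complex_of_real (\<phi>2 * (2 * Re (h * b))) * (cnj c + 0 * d))) (at 0)"
    unfolding \<Psi>_def by (rule has_derivative_mult) (auto intro!: derivative_eq_intros)
  then have "(\<Psi> has_derivative (\<lambda>h. (of_real (\<phi>1 W) * d + of_real \<phi>2 * b * cnj c) * h + of_real \<phi>2 * cnj b * cnj c * cnj h)) (at 0)"
  proof (rule has_derivative_eq_rhs)
    have "complex_of_real (2 * Re z) = z + cnj z" for z by (simp add: complex_add_cnj)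
    then show "(\<lambda>h. of_real (\<phi>1 (n 0)) * (h * d) + complex_of_real (\<phi>2 * (2 * Re (h * b))) * (cnj c + 0 * d)) =
      (\<lambda>h. (of_real (\<phi>1 W) * d + of_real \<phi>2 * b * cnj c) * h + of_real \<phi>2 * cnj b * cnj c * cnj h)"
      by (simp only: of_real_mult[of \<phi>2] n0) (simp add: fun_eq_iff algebra_simps)
  qed
  then have "((\<lambda>\<alpha>. wirtinger_bar (\<lambda>\<beta>. of_real (\<phi> (N \<alpha> \<beta>)))) has_derivative
     (\<lambda>h. (of_real (\<phi>1 W) * d + of_real \<phi>2 * b * cnj c) * h + of_real \<phi>2 * cnj b * cnj c * cnj h)) (at 0)"
    by (rule has_derivative_transform_eventually)
       (use ev eventually_nhds_x_imp_x[OF ev] in \<open>auto simp: eventually_at_filter elim: eventually_mono\<close>)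
  from wirtinger_eqI(1)[OF this] show ?thesis by (simp add: mixed_wirtinger_def N_def)
qed

section \<open>Hermitian products and the matrix of a radial potential\<close>

lemma scaleR_vec_conv_of_real: "r *\<^sub>R u = complex_of_real r *s u" for u :: "complex^'n"
  by (simp add: vec_eq_iff scaleR_conv_of_real[where 'a = complex])

definition hinner :: "complex^'n \<Rightarrow> complex^'n \<Rightarrow> complex" where
  "hinner u v = (\<Sum>i\<in>UNIV. u $ i * cnj (v $ i))"

lemma hinner_simps:
  "hinner (u + v) w = hinner u w + hinner v w" "hinner w (u + v) = hinner w u + hinner w v"
  "hinner (a *s u) w = a * hinner u w" "hinner w (a *s u) = cnj a * hinner w u"
  by (simp_all add: hinner_def sum.distrib sum_distrib_left algebra_simps)

lemma hinner_commute: "hinner v u = cnj (hinner u v)"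
  by (simp add: hinner_def mult.commute)

lemma hinner_self: "hinner z z = of_real ((norm z)\<^sup>2)"
  by (simp add: hinner_def norm_vec_def L2_set_def sum_nonneg complex_norm_square del: of_real_power)

lemma hinner_axis: "hinner (axis i 1) z = cnj (z $ i)" "hinner z (axis i 1) = z $ i"
proof -
  have "hinner (axis i 1) z = (\<Sum>j\<in>UNIV. if j = i then cnj (z $ j) else 0)"
    unfolding hinner_def by (intro sum.cong refl) (auto simp: axis_def)
  then show *: "hinner (axis i 1) z = cnj (z $ i)" by simp
  show "hinner z (axis i 1) = z $ i" using hinner_commute[of z "axis i 1"] * by simp
qed

lemma norm_plus_two_terms:
  "(norm (z + \<alpha> *s u + \<beta> *s v))\<^sup>2 = (norm z)\<^sup>2 + (cmod \<alpha>)\<^sup>2 * (norm u)\<^sup>2 + (cmod \<beta>)\<^sup>2 * (norm v)\<^sup>2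
     + 2 * Re (\<alpha> * hinner u z + \<beta> * hinner v z + \<alpha> * cnj \<beta> * hinner u v)"
proof -
  have "complex_of_real ((norm (z + \<alpha> *s u + \<beta> *s v))\<^sup>2) = of_real ((norm z)\<^sup>2 + (cmod \<alpha>)\<^sup>2 * (norm u)\<^sup>2 + (cmod \<beta>)\<^sup>2 * (norm v)\<^sup>2)
     + (\<alpha> * hinner u z + \<beta> * hinner v z + \<alpha> * cnj \<beta> * hinner u v) + cnj (\<alpha> * hinner u z + \<beta> * hinner v z + \<alpha> * cnj \<beta> * hinner u v)"
    unfolding hinner_self[symmetric] of_real_add of_real_mult complex_norm_square complex_cnj_add complex_cnj_mult hinner_commute[symmetric] complex_cnj_cnj
    by (simp add: hinner_simps algebra_simps)
  also have "\<dots> = of_real ((norm z)\<^sup>2 + (cmod \<alpha>)\<^sup>2 * (norm u)\<^sup>2 + (cmod \<beta>)\<^sup>2 * (norm v)\<^sup>2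
     + 2 * Re (\<alpha> * hinner u z + \<beta> * hinner v z + \<alpha> * cnj \<beta> * hinner u v))"
    unfolding add.assoc[of _ _ "cnj _"] complex_add_cnj by simp
  finally show ?thesis by (simp only: of_real_eq_iff)
qed

text \<open>The complex Hessian of a radial potential at \<open>z\<close>, when \<open>a\<close> and
  \<open>b\<close> are its first and second derivatives at the squared norm of
  \<open>z\<close>.\<close>

definition radial_matrix :: "real \<Rightarrow> real \<Rightarrow> complex^'n \<Rightarrow> complex^'n^'n" where
  "radial_matrix a b z = (\<chi> i j. (if i = j then of_real a else 0) + of_real b * (cnj (z $ i) * z $ j))"

lemma ddbar_radial:
  fixes z :: "complex^'n"
  assumes "open S" "(norm z)\<^sup>2 \<in> S" "\<And>x. x \<in> S \<Longrightarrow> (\<phi> has_real_derivative \<phi>1 x) (at x)"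
    and "(\<phi>1 has_real_derivative \<phi>2) (at ((norm z)\<^sup>2))"
  shows "ddbar (\<lambda>w. \<phi> ((norm w)\<^sup>2)) z = radial_matrix (\<phi>1 ((norm z)\<^sup>2)) \<phi>2 z"
proof -
  have "mixed_wirtinger (\<lambda>\<alpha> \<beta>. \<phi> ((norm (z + \<alpha> *s axis i 1 + \<beta> *s axis j 1))\<^sup>2)) =
      of_real (\<phi>1 ((norm z)\<^sup>2)) * hinner (axis i 1) (axis j 1) + of_real \<phi>2 * hinner (axis i 1) z * cnj (hinner (axis j 1) z)"
    for i j
    unfolding norm_plus_two_terms by (rule mixed_wirtinger_quadratic[OF assms])
  moreover have "axis j (1::complex) $ i = (if i = j then 1 else 0)" for i j :: 'n
    by (simp add: axis_def)
  ultimately show ?thesis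
    by (simp add: ddbar_def radial_matrix_def vec_eq_iff hinner_axis)
qed

definition herm :: "complex^'n^'n \<Rightarrow> complex^'n \<Rightarrow> complex^'n \<Rightarrow> complex" where
  "herm A u v = (\<Sum>i\<in>UNIV. \<Sum>j\<in>UNIV. A $ i $ j * (u $ i * cnj (v $ j)))"

lemma herm_radial_matrix:
  "herm (radial_matrix a b z) u v = of_real a * hinner u v + of_real b * (hinner u z * hinner z v)"
proof -
  have "herm (radial_matrix a b z) u v =
      (\<Sum>i\<in>UNIV. \<Sum>j\<in>UNIV. (if j = i then of_real a * (u $ i * cnj (v $ j)) else 0) +
         of_real b * ((u $ i * cnj (z $ i)) * (z $ j * cnj (v $ j))))"
    unfolding herm_def radial_matrix_def by (intro sum.cong refl) (simp add: algebra_simps)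
  then show ?thesis
    unfolding hinner_def sum_product sum.distrib by (simp add: sum_distrib_left)
qed

lemma herm_simps:
  "herm A (u + v) w = herm A u w + herm A v w" "herm A w (u + v) = herm A w u + herm A w v"
  "herm A (a *s u) w = a * herm A u w" "herm A w (a *s u) = cnj a * herm A w u"
  by (simp_all add: herm_def sum.distrib sum_distrib_left algebra_simps)

lemma form11_herm: "form11 A u v = \<i> / 2 * (herm A u v - herm A v u)"
  by (simp add: form11_def herm_def right_diff_distrib sum_subtractf)

text \<open>Since row \<open>k\<close> equals \<open>y\<close>, the multiple of \<open>y\<close> in
  any other row drops out by multilinearity and the equality of two rows. Cramer's rule evaluates
  the remaining determinant.\<close>

lemma det_rank_one_aux:
  fixes x y :: "complex^'n"
  assumes a: "a \<noteq> 0" and k: "k \<notin> S" and S: "finite S"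
  shows "det (\<chi> i. if i = k then y else if i \<in> S then a *s axis i 1 + x $ i *s y else a *s axis i 1)
    = a ^ CARD('n) * (y $ k / a)"
  using S k
proof (induction S)
  case empty
  define A :: "complex^'n^'n" where "A = (\<chi> i. a *s axis i 1)"
  have dA: "det A = a ^ CARD('n)"
    by (subst det_diagonal) (auto simp: A_def axis_def)
  have rA: "row i A = a *s axis i 1" for i by (simp add: A_def row_def vec_eq_iff)
  have "(\<Sum>i\<in>UNIV. (y $ i / a) *s row i A) = (\<Sum>i\<in>UNIV. y $ i *s axis i 1)"
    using a by (intro sum.cong refl) (simp add: rA vec_eq_iff)
  also have "\<dots> = y" by (rule basis_expansion)
  finally have sumeq: "(\<Sum>i\<in>UNIV. ((\<chi> i. y $ i / a) $ i) *s row i A) = y" by simp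
  have "det (\<chi> i. if i = k then y else row i A) = (\<chi> i. y $ i / a) $ k * det A"
    using cramer_lemma_transpose[where x = "\<chi> i. y $ i / a" and A = A and k = k]
    unfolding sumeq .
  then have "det (\<chi> i. if i = k then y else row i A) = y $ k / a * a ^ CARD('n)"
    using dA by simp
  moreover have "(\<chi> i. if i = k then y else row i A) =
     (\<chi> i. if i = k then y else if i \<in> {} then a *s axis i 1 + x $ i *s y else a *s axis i 1)"
    by (simp add: rA vec_eq_iff)
  ultimately show ?case by (simp add: mult.commute)
next
  case (insert l S)
  then have lk: "l \<noteq> k" "l \<notin> S" "k \<notin> S" by auto
  define c where "c i = (if i = k then y else if i \<in> S then a *s axis i 1 + x $ i *s y else a *s axis i 1)" for i
  have "det (\<chi> i. if i = k then y else if i \<in> insert l S then a *s axis i 1 + x $ i *s y else a *s axis i 1) =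
    det (\<chi> i. if i = l then a *s axis i 1 + x $ i *s y else c i)"
    by (rule arg_cong[where f = det]) (use lk in \<open>auto simp: vec_eq_iff c_def\<close>)
  also have "\<dots> = det (\<chi> i. if i = l then a *s axis i 1 else c i) + det (\<chi> i. if i = l then x $ i *s y else c i)"
    by (rule det_row_add)
  also have "(\<chi> i. if i = l then x $ i *s y else c i) = (\<chi> i. if i = l then x $ l *s y else c i)"
    by (simp add: vec_eq_iff)
  also have "det (\<chi> i. if i = l then x $ l *s y else c i) = x $ l * det (\<chi> i. if i = l then y else c i)"
    by (rule det_row_mul)
  also have "det (\<chi> i. if i = l then y else c i) = 0"
    by (rule det_identical_rows[OF lk(1)]) (use lk in \<open>auto simp: row_def vec_eq_iff c_def\<close>)
  also have "(\<chi> i. if i = l then a *s axis i 1 else c i) =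
     (\<chi> i. if i = k then y else if i \<in> S then a *s axis i 1 + x $ i *s y else a *s axis i 1)"
    using lk by (auto simp: vec_eq_iff c_def)
  finally show ?case using insert by simp
qed

text \<open>The matrix determinant lemma. The rank one part is switched on row by row, and each row
  contributes one summand through \<open>det_rank_one_aux\<close>.\<close>

lemma det_scalar_plus_rank_one:
  fixes x y :: "complex^'n"
  assumes a: "a \<noteq> 0"
  shows "det (\<chi> i j. (if i = j then a else 0) + x $ i * y $ j) = a ^ CARD('n) * (1 + (\<Sum>i\<in>UNIV. x $ i * y $ i) / a)"
proof -
  have "det (\<chi> i. if i \<in> S then a *s axis i 1 + x $ i *s y else a *s axis i 1) =
     a ^ CARD('n) * (1 + (\<Sum>i\<in>S. x $ i * y $ i) / a)" if "finite S" for S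
    using that
  proof (induction S)
    case empty
    show ?case by (subst det_diagonal) (auto simp: axis_def)
  next
    case (insert l S)
    define c where "c i = (if i \<in> S then a *s axis i 1 + x $ i *s y else a *s axis i 1)" for i
    have "det (\<chi> i. if i \<in> insert l S then a *s axis i 1 + x $ i *s y else a *s axis i 1) =
      det (\<chi> i. if i = l then a *s axis i 1 + x $ i *s y else c i)"
      by (rule arg_cong[where f = det]) (use insert in \<open>auto simp: vec_eq_iff c_def\<close>)
    also have "\<dots> = det (\<chi> i. if i = l then a *s axis i 1 else c i) + det (\<chi> i. if i = l then x $ i *s y else c i)"
      by (rule det_row_add)
    also have "(\<chi> i. if i = l then x $ i *s y else c i) = (\<chi> i. if i = l then x $ l *s y else c i)"
      by (simp add: vec_eq_iff)
    also have "det (\<chi> i. if i = l then x $ l *s y else c i) = x $ l * det (\<chi> i. if i = l then y else c i)"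
      by (rule det_row_mul)
    also have "det (\<chi> i. if i = l then y else c i) = a ^ CARD('n) * (y $ l / a)"
      unfolding c_def by (rule det_rank_one_aux[OF a]) (use insert in auto)
    also have "(\<chi> i. if i = l then a *s axis i 1 else c i) =
       (\<chi> i. if i \<in> S then a *s axis i 1 + x $ i *s y else a *s axis i 1)"
      using insert by (auto simp: vec_eq_iff c_def)
    finally show ?case using insert a by (simp add: field_simps)
  qed
  from this[of UNIV] have "det (\<chi> i. a *s axis i 1 + x $ i *s y) = a ^ CARD('n) * (1 + (\<Sum>i\<in>UNIV. x $ i * y $ i) / a)"
    by simp
  also have "(\<chi> i. a *s axis i 1 + x $ i *s y) = (\<chi> i j. (if i = j then a else 0) + x $ i * y $ j)"
    by (auto simp: vec_eq_iff axis_def)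
  finally show ?thesis .
qed

lemma det_radial_matrix:
  fixes z :: "complex^'n"
  assumes "a \<noteq> 0"
  shows "det (radial_matrix a b z) = of_real (a ^ (CARD('n) - 1) * (a + b * (norm z)\<^sup>2))"
proof -
  have "radial_matrix a b z = (\<chi> i j. (if i = j then of_real a else 0) + (\<chi> i. of_real b * cnj (z $ i)) $ i * z $ j)"
    by (simp add: radial_matrix_def vec_eq_iff)
  then have "det (radial_matrix a b z) = of_real a ^ CARD('n) * (1 + (\<Sum>i\<in>UNIV. of_real b * cnj (z $ i) * z $ i) / of_real a)"
    using det_scalar_plus_rank_one[of "of_real a" "\<chi> i. of_real b * cnj (z $ i)" z] assms by simp
  also have "(\<Sum>i\<in>UNIV. of_real b * cnj (z $ i) * z $ i) = of_real b * hinner z z"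
    by (simp add: hinner_def sum_distrib_left mult_ac)
  also have "of_real a ^ CARD('n) = of_real a ^ (CARD('n) - 1) * (of_real a :: complex)"
    by (metis One_nat_def Suc_pred mult.commute power_Suc zero_less_card_finite)
  finally show ?thesis using assms by (simp add: hinner_self distrib_left mult.assoc)
qed

lemma smooth_on_imp_derivatives:
  fixes f :: "real \<Rightarrow> real"
  assumes "smooth_on S f"
  obtains f' where "smooth_on S f'" "\<And>x. x \<in> S \<Longrightarrow> (f has_real_derivative f' x) (at x)"
proof
  show "smooth_on S (\<lambda>x. frechet_derivative f (at x) 1)"
    unfolding smooth_on_def
  proof
    fix k
    have "C_k_on (Suc k) S f" using assms by (simp add: smooth_on_def)
    then show "C_k_on k S (\<lambda>x. frechet_derivative f (at x) 1)" by simp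
  qed
  fix x assume "x \<in> S"
  moreover have "C_k_on (Suc 0) S f" using assms unfolding smooth_on_def by blast
  ultimately have "f differentiable (at x)" by simp
  then have d: "(f has_derivative frechet_derivative f (at x)) (at x)" by (simp add: frechet_derivative_works)
  then have "linear (frechet_derivative f (at x))" by (rule has_derivative_linear)
  then have "frechet_derivative f (at x) h = frechet_derivative f (at x) 1 * h" for h
    using linear_scale[of "frechet_derivative f (at x)" h 1] by (simp add: mult.commute)
  then have "frechet_derivative f (at x) = (\<lambda>h. frechet_derivative f (at x) 1 * h)" by (rule ext)
  with d show "(f has_real_derivative frechet_derivative f (at x) 1) (at x)"
    unfolding has_field_derivative_def by simp
qed

lemma has_sum_product_complex:
  fixes f :: "'a \<Rightarrow> complex" and g :: "'b \<Rightarrow> complex"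
  assumes f: "(f has_sum a) A" and g: "(g has_sum b) B"
  shows "((\<lambda>(x, y). f x * g y) has_sum a * b) (A \<times> B)"
proof (rule has_sum_SigmaI)
  show "((\<lambda>y. case (x, y) of (x, y) \<Rightarrow> f x * g y) has_sum f x * b) B" for x
    unfolding prod.case by (intro has_sum_cmult_right g)
  show "((\<lambda>x. f x * b) has_sum a * b) A" by (intro has_sum_cmult_left f)
  have "(\<lambda>x. norm (f x)) summable_on A" "(\<lambda>x. norm (g x)) summable_on B"
    using has_sum_imp_summable[OF f] has_sum_imp_summable[OF g]
    by (simp_all add: summable_on_iff_abs_summable_on_complex)
  then have "(\<lambda>p. norm (case p of (x, y) \<Rightarrow> f x * g y)) summable_on A \<times> B"
    by (subst Infinite_Sum.abs_summable_on_Sigma_iff)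
       (auto simp: norm_mult infsum_cmult_right' abs_mult infsum_nonneg
         intro!: summable_on_cmult_right summable_on_cmult_left)
  then show "(\<lambda>(x, y). f x * g y) summable_on A \<times> B" by (rule abs_summable_summable)
qed

subsection \<open>The Hilbert space of square summable sequences\<close>

definition ell2_inner :: "(nat \<Rightarrow> complex) \<Rightarrow> (nat \<Rightarrow> complex) \<Rightarrow> complex" where
  "ell2_inner x y = (\<Sum>\<^sub>\<infinity>k. x k * cnj (y k))"

lemma ell2_norm_has_sum:
  assumes "x \<in> ell2"
  shows "((\<lambda>k. (cmod (x k))\<^sup>2) has_sum (ell2_norm x)\<^sup>2) UNIV"
proof -
  have "summable (\<lambda>k. (cmod (x k))\<^sup>2)" using assms by (simp add: ell2_def)
  moreover from this have "(ell2_norm x)\<^sup>2 = (\<Sum>k. (cmod (x k))\<^sup>2)"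
    by (simp add: ell2_norm_def suminf_nonneg)
  ultimately show ?thesis
    by (intro sums_nonneg_imp_has_sum) (auto simp: sums_iff)
qed

lemma ell2_inner_has_sum:
  assumes "x \<in> ell2" "y \<in> ell2"
  shows "((\<lambda>k. x k * cnj (y k)) has_sum ell2_inner x y) UNIV"
proof -
  have "(\<lambda>k. (cmod (x k))\<^sup>2 + (cmod (y k))\<^sup>2) summable_on UNIV"
    by (intro summable_on_add has_sum_imp_summable[OF ell2_norm_has_sum[OF assms(1)]]
        has_sum_imp_summable[OF ell2_norm_has_sum[OF assms(2)]])
  moreover have "norm (x k * cnj (y k)) \<le> (cmod (x k))\<^sup>2 + (cmod (y k))\<^sup>2" for k
  proof -
    have "0 \<le> (cmod (x k) - cmod (y k))\<^sup>2" by simp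
    then have "2 * (cmod (x k) * cmod (y k)) \<le> (cmod (x k))\<^sup>2 + (cmod (y k))\<^sup>2"
      by (simp add: power2_diff)
    moreover have "0 \<le> cmod (x k) * cmod (y k)" by simp
    ultimately show ?thesis unfolding norm_mult complex_mod_cnj by linarith
  qed
  ultimately have "(\<lambda>k. norm (x k * cnj (y k))) summable_on UNIV"
    by (rule Infinite_Sum.abs_summable_on_comparison_test')
  then show ?thesis
    unfolding ell2_inner_def by (rule has_sum_infsum[OF abs_summable_summable])
qed

lemma ell2_add:
  assumes "x \<in> ell2" "y \<in> ell2"
  shows "(\<lambda>k. x k + y k) \<in> ell2"
proof -
  have "summable (\<lambda>k. 2 * (cmod (x k))\<^sup>2 + 2 * (cmod (y k))\<^sup>2)"
    using assms unfolding ell2_def by (intro summable_add summable_mult) auto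
  moreover have "norm ((cmod (x k + y k))\<^sup>2) \<le> 2 * (cmod (x k))\<^sup>2 + 2 * (cmod (y k))\<^sup>2" for k
  proof -
    have "(cmod (x k + y k))\<^sup>2 \<le> (cmod (x k) + cmod (y k))\<^sup>2" by (intro power_mono norm_triangle_ineq) auto
    also have "\<dots> \<le> 2 * (cmod (x k))\<^sup>2 + 2 * (cmod (y k))\<^sup>2"
      using sum_squares_bound[of "cmod (x k)" "cmod (y k)"] by (simp add: power2_sum)
    finally show ?thesis by simp
  qed
  ultimately show ?thesis
    unfolding ell2_def mem_Collect_eq by (rule summable_comparison_test'[of _ 0]) 
qed

lemma ell2_mult: "x \<in> ell2 \<Longrightarrow> (\<lambda>k. c * x k) \<in> ell2"
  by (auto simp: ell2_def norm_mult power_mult_distrib intro: summable_mult)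

lemma ell2_diff: "x \<in> ell2 \<Longrightarrow> y \<in> ell2 \<Longrightarrow> (\<lambda>k. x k - y k) \<in> ell2"
  using ell2_add[of x "\<lambda>k. - 1 * y k"] ell2_mult[of y "- 1"] by simp

lemma ell2_norm_plus_two_terms:
  assumes w: "w \<in> ell2" and u: "u \<in> ell2" and v: "v \<in> ell2"
  shows "(ell2_norm (\<lambda>k. w k + \<alpha> * u k + \<beta> * v k))\<^sup>2 = (ell2_norm w)\<^sup>2
    + (cmod \<alpha>)\<^sup>2 * (ell2_norm u)\<^sup>2 + (cmod \<beta>)\<^sup>2 * (ell2_norm v)\<^sup>2
    + 2 * Re (\<alpha> * ell2_inner u w + \<beta> * ell2_inner v w + \<alpha> * cnj \<beta> * ell2_inner u v)"
proof (rule has_sum_unique)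
  have "(\<lambda>k. w k + \<alpha> * u k + \<beta> * v k) \<in> ell2" by (intro ell2_add ell2_mult w u v)
  then show "((\<lambda>k. (cmod (w k + \<alpha> * u k + \<beta> * v k))\<^sup>2) has_sum (ell2_norm (\<lambda>k. w k + \<alpha> * u k + \<beta> * v k))\<^sup>2) UNIV"
    by (rule ell2_norm_has_sum)
  have "((\<lambda>k. (cmod (w k))\<^sup>2 + (cmod \<alpha>)\<^sup>2 * (cmod (u k))\<^sup>2 + (cmod \<beta>)\<^sup>2 * (cmod (v k))\<^sup>2
    + 2 * Re (\<alpha> * (u k * cnj (w k)) + \<beta> * (v k * cnj (w k)) + \<alpha> * cnj \<beta> * (u k * cnj (v k)))) has_sum
    ((ell2_norm w)\<^sup>2 + (cmod \<alpha>)\<^sup>2 * (ell2_norm u)\<^sup>2 + (cmod \<beta>)\<^sup>2 * (ell2_norm v)\<^sup>2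
    + 2 * Re (\<alpha> * ell2_inner u w + \<beta> * ell2_inner v w + \<alpha> * cnj \<beta> * ell2_inner u v))) UNIV"
    by (intro has_sum_add has_sum_cmult_right has_sum_Re ell2_norm_has_sum ell2_inner_has_sum w u v)
  moreover have "(cmod (w k + \<alpha> * u k + \<beta> * v k))\<^sup>2 = (cmod (w k))\<^sup>2 + (cmod \<alpha>)\<^sup>2 * (cmod (u k))\<^sup>2 + (cmod \<beta>)\<^sup>2 * (cmod (v k))\<^sup>2
    + 2 * Re (\<alpha> * (u k * cnj (w k)) + \<beta> * (v k * cnj (w k)) + \<alpha> * cnj \<beta> * (u k * cnj (v k)))" for k
    unfolding cmod_power2 by (simp add: power2_eq_square algebra_simps)
  ultimately show "((\<lambda>k. (cmod (w k + \<alpha> * u k + \<beta> * v k))\<^sup>2) has_sum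
    ((ell2_norm w)\<^sup>2 + (cmod \<alpha>)\<^sup>2 * (ell2_norm u)\<^sup>2 + (cmod \<beta>)\<^sup>2 * (ell2_norm v)\<^sup>2
    + 2 * Re (\<alpha> * ell2_inner u w + \<beta> * ell2_inner v w + \<alpha> * cnj \<beta> * ell2_inner u v))) UNIV"
    by simp
qed

lemma space_form_metric_flat:
  assumes "w \<in> ell2" "u \<in> ell2" "v \<in> ell2"
  shows "space_form_metric 0 w u v = ell2_inner u v"
proof -
  have "mixed_wirtinger (\<lambda>\<alpha> \<beta>. (\<lambda>x. x) ((ell2_norm w)\<^sup>2 + (cmod \<alpha>)\<^sup>2 * (ell2_norm u)\<^sup>2 + (cmod \<beta>)\<^sup>2 * (ell2_norm v)\<^sup>2
    + 2 * Re (\<alpha> * ell2_inner u w + \<beta> * ell2_inner v w + \<alpha> * cnj \<beta> * ell2_inner u v))) =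
    of_real ((\<lambda>_. 1) ((ell2_norm w)\<^sup>2)) * ell2_inner u v + of_real 0 * ell2_inner u w * cnj (ell2_inner v w)"
    by (rule mixed_wirtinger_quadratic[where S = UNIV]) (auto intro!: derivative_eq_intros)
  then show ?thesis
    by (simp add: space_form_metric_def space_form_potential_def ell2_norm_plus_two_terms assms)
qed

lemma ell2_norm_nonneg: "x \<in> ell2 \<Longrightarrow> 0 \<le> ell2_norm x"
  by (simp add: ell2_norm_def ell2_def suminf_nonneg)

lemma space_form_metric_hyperbolic:
  assumes c: "c < 0" and w: "w \<in> ell2" "ell2_norm w < 1" and uv: "u \<in> ell2" "v \<in> ell2"
  shows "space_form_metric c w u v = of_real (- 1 / c / (1 - (ell2_norm w)\<^sup>2)) * ell2_inner u v
    + of_real (- 1 / c / (1 - (ell2_norm w)\<^sup>2)\<^sup>2) * ell2_inner u w * cnj (ell2_inner v w)"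
proof -
  have "0 \<le> ell2_norm w" using w(1) by (rule ell2_norm_nonneg)
  then have lt: "(ell2_norm w)\<^sup>2 < 1" using w(2) by (simp add: power_less_one_iff abs_square_less_1)
  have "mixed_wirtinger (\<lambda>\<alpha> \<beta>. (\<lambda>x. 1 / c * ln (1 - x)) ((ell2_norm w)\<^sup>2 + (cmod \<alpha>)\<^sup>2 * (ell2_norm u)\<^sup>2 + (cmod \<beta>)\<^sup>2 * (ell2_norm v)\<^sup>2
    + 2 * Re (\<alpha> * ell2_inner u w + \<beta> * ell2_inner v w + \<alpha> * cnj \<beta> * ell2_inner u v))) =
    of_real ((\<lambda>x. - 1 / c / (1 - x)) ((ell2_norm w)\<^sup>2)) * ell2_inner u v
    + of_real (- 1 / c / (1 - (ell2_norm w)\<^sup>2)\<^sup>2) * ell2_inner u w * cnj (ell2_inner v w)"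
  proof (rule mixed_wirtinger_quadratic[where S = "{..<1}"])
    show "((\<lambda>x. 1 / c * ln (1 - x)) has_real_derivative - 1 / c / (1 - x)) (at x)" if "x \<in> {..<1}" for x
      using that c by (auto intro!: derivative_eq_intros simp: field_simps)
    show "((\<lambda>x. - 1 / c / (1 - x)) has_real_derivative - 1 / c / (1 - (ell2_norm w)\<^sup>2)\<^sup>2) (at ((ell2_norm w)\<^sup>2))"
    proof -
      have *: "((\<lambda>x. k / (1 - x)) has_real_derivative k / (1 - y)\<^sup>2) (at y)" if "y \<noteq> 1" for k y :: real
        using that by (auto intro!: derivative_eq_intros simp: power2_eq_square)
      show ?thesis by (rule *) (use lt in simp)
    qed
  qed (use lt in auto)
  moreover have "c \<noteq> 0" using c by simp
  ultimately show ?thesis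
    by (simp only: space_form_metric_def space_form_potential_def ell2_norm_plus_two_terms[OF w(1) uv] if_False)
qed

lemma cmod_le_ell2_norm:
  assumes "x \<in> ell2"
  shows "cmod (x k) \<le> ell2_norm x"
proof (rule power2_le_imp_le[OF _ ell2_norm_nonneg[OF assms]])
  have "(\<Sum>k\<in>{k}. (cmod (x k))\<^sup>2) \<le> (ell2_norm x)\<^sup>2"
    by (rule finite_sum_le_has_sum[OF ell2_norm_has_sum[OF assms]]) auto
  then show "(cmod (x k))\<^sup>2 \<le> (ell2_norm x)\<^sup>2" by simp
qed

lemma has_ell2_derivative_component:
  fixes \<phi> :: "complex^'n \<Rightarrow> nat \<Rightarrow> complex"
  assumes M: "open M" "z \<in> M" and \<phi>: "\<And>x. x \<in> M \<Longrightarrow> \<phi> x \<in> ell2" and L: "has_ell2_derivative \<phi> L z"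
  shows "((\<lambda>x. \<phi> x k) has_derivative (\<lambda>h. L h k)) (at z)"
  unfolding has_derivative_at
proof
  have ladd: "L (u + v) k = L u k + L v k" and lmul: "L (\<alpha> *s u) k = \<alpha> * L u k" and lell: "L u \<in> ell2" for u v \<alpha> k
    using L by (auto simp: has_ell2_derivative_def)
  have "linear (\<lambda>h. L h k)"
    by (intro linearI) (simp_all add: scaleR_vec_conv_of_real ladd lmul scaleR_conv_of_real[where 'a = complex])
  then show "bounded_linear (\<lambda>h. L h k)" by (simp add: linear_conv_bounded_linear)
  have lim: "((\<lambda>h. ell2_norm (\<lambda>k. \<phi> (z + h) k - \<phi> z k - L h k) / norm h) \<longlongrightarrow> 0) (at 0)"
    using L by (simp add: has_ell2_derivative_def)
  have "open ((\<lambda>h. z + h) -` M)" by (intro open_vimage M continuous_intros)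
  then have "\<forall>\<^sub>F h in at 0. h \<in> (\<lambda>h. z + h) -` M" using M by (intro eventually_at_in_open') auto
  then have "\<forall>\<^sub>F h in at 0. norm (norm (\<phi> (z + h) k - \<phi> z k - L h k) / norm h) \<le>
     ell2_norm (\<lambda>k. \<phi> (z + h) k - \<phi> z k - L h k) / norm h"
  proof eventually_elim
    case (elim h)
    then have "(\<lambda>k. \<phi> (z + h) k - \<phi> z k - L h k) \<in> ell2"
      using \<phi> M lell by (intro ell2_diff) auto
    from cmod_le_ell2_norm[OF this, of k] show ?case by (simp add: divide_right_mono)
  qed
  then show "(\<lambda>h. norm (\<phi> (z + h) k - \<phi> z k - L h k) / norm h) \<midarrow>0\<rightarrow> 0"
    using lim by (rule Lim_null_comparison)
qed

text \<open>The definition of an immersion compares the metrics only on basis vectors; linearity of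
  \<open>L\<close> carries the comparison to all \<open>u\<close>. In the hyperbolic case both
  squares come with nonnegative weights.\<close>

lemma immersion_herm:
  fixes H :: "complex^'n \<Rightarrow> complex^'n^'n"
  assumes c: "c \<le> 0" and \<phi>: "\<phi> z \<in> space_form c" and L: "has_ell2_derivative \<phi> L z"
    and H: "\<And>i j. H z $ i $ j = space_form_metric c (\<phi> z) (L (axis i 1)) (L (axis j 1))"
  shows "herm (H z) u u = (if c = 0 then of_real ((ell2_norm (L u))\<^sup>2)
    else of_real (- 1 / c / (1 - (ell2_norm (\<phi> z))\<^sup>2) * (ell2_norm (L u))\<^sup>2
      + - 1 / c / (1 - (ell2_norm (\<phi> z))\<^sup>2)\<^sup>2 * (cmod (ell2_inner (L u) (\<phi> z)))\<^sup>2))"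
proof -
  have ladd: "L (u + v) k = L u k + L v k" and lmul: "L (\<alpha> *s u) k = \<alpha> * L u k" and lell: "L u \<in> ell2" for u v \<alpha> k
    using L by (auto simp: has_ell2_derivative_def)
  have \<phi>ell: "\<phi> z \<in> ell2" using \<phi> by (auto simp: space_form_def split: if_splits)
  have l0: "L 0 k = 0" for k using lmul[of 0 0 k] by simp
  have lsum: "L (\<Sum>i\<in>I. g i) k = (\<Sum>i\<in>I. L (g i) k)" if "finite I" for I :: "'n set" and g k
    using that by (induction I) (auto simp: l0 ladd)
  have Lu: "L u k = (\<Sum>i\<in>UNIV. u $ i * L (axis i 1) k)" for k
  proof -
    have "L (\<Sum>i\<in>UNIV. u $ i *s axis i 1) k = (\<Sum>i\<in>UNIV. u $ i * L (axis i 1) k)"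
      by (simp add: lsum lmul)
    then show ?thesis unfolding basis_expansion .
  qed
  have ip1: "ell2_inner (L u) y = (\<Sum>i\<in>UNIV. u $ i * ell2_inner (L (axis i 1)) y)" if "y \<in> ell2" for y
  proof (rule has_sum_unique[OF ell2_inner_has_sum[OF lell that]])
    have "((\<lambda>k. \<Sum>i\<in>UNIV. u $ i * (L (axis i 1) k * cnj (y k))) has_sum (\<Sum>i\<in>UNIV. u $ i * ell2_inner (L (axis i 1)) y)) UNIV"
      by (intro has_sum_finite_sum has_sum_cmult_right ell2_inner_has_sum lell that) auto
    then show "((\<lambda>k. L u k * cnj (y k)) has_sum (\<Sum>i\<in>UNIV. u $ i * ell2_inner (L (axis i 1)) y)) UNIV"
      by (simp add: Lu sum_distrib_right mult.assoc)
  qed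
  have ipc: "ell2_inner y x = cnj (ell2_inner x y)" for x y
    by (simp add: ell2_inner_def mult.commute flip: infsum_cnj)
  have ip2: "ell2_inner y (L u) = (\<Sum>j\<in>UNIV. cnj (u $ j) * ell2_inner y (L (axis j 1)))" if "y \<in> ell2" for y
    using ip1[OF that] by (simp add: ipc[of y])
  have ipn: "ell2_inner x x = of_real ((ell2_norm x)\<^sup>2)" if "x \<in> ell2" for x
    using has_sum_unique[OF ell2_inner_has_sum[OF that that], of "of_real ((ell2_norm x)\<^sup>2)"]
      has_sum_of_real[OF ell2_norm_has_sum[OF that], where 'a = complex]
    by (simp add: complex_norm_square del: of_real_power)
  have q1: "(\<Sum>i\<in>UNIV. \<Sum>j\<in>UNIV. ell2_inner (L (axis i 1)) (L (axis j 1)) * (u $ i * cnj (u $ j))) = of_real ((ell2_norm (L u))\<^sup>2)"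
  proof -
    have "of_real ((ell2_norm (L u))\<^sup>2) = ell2_inner (L u) (L u)" using ipn lell by simp
    also have "\<dots> = (\<Sum>i\<in>UNIV. u $ i * (\<Sum>j\<in>UNIV. cnj (u $ j) * ell2_inner (L (axis i 1)) (L (axis j 1))))"
      by (subst ip1[OF lell], intro sum.cong refl) (simp only: ip2[OF lell])
    finally show ?thesis by (simp add: sum_distrib_left mult_ac)
  qed
  have q2: "(\<Sum>i\<in>UNIV. \<Sum>j\<in>UNIV. (ell2_inner (L (axis i 1)) (\<phi> z) * cnj (ell2_inner (L (axis j 1)) (\<phi> z))) * (u $ i * cnj (u $ j)))
     = of_real ((cmod (ell2_inner (L u) (\<phi> z)))\<^sup>2)"
    unfolding complex_norm_square ip1[OF \<phi>ell] by (simp add: sum_product mult_ac)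
  show ?thesis
  proof (cases "c = 0")
    case True
    then show ?thesis
      using q1 by (simp add: herm_def H space_form_metric_flat[OF \<phi>ell lell lell])
  next
    case False
    then have cn: "c < 0" and lt: "ell2_norm (\<phi> z) < 1" using c \<phi> by (auto simp: space_form_def)
    define A B where "A = complex_of_real (- 1 / c / (1 - (ell2_norm (\<phi> z))\<^sup>2))"
      and "B = complex_of_real (- 1 / c / (1 - (ell2_norm (\<phi> z))\<^sup>2)\<^sup>2)"
    have "herm (H z) u u = A * (\<Sum>i\<in>UNIV. \<Sum>j\<in>UNIV. ell2_inner (L (axis i 1)) (L (axis j 1)) * (u $ i * cnj (u $ j)))
       + B * (\<Sum>i\<in>UNIV. \<Sum>j\<in>UNIV. (ell2_inner (L (axis i 1)) (\<phi> z) * cnj (ell2_inner (L (axis j 1)) (\<phi> z))) * (u $ i * cnj (u $ j)))"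
      unfolding herm_def H space_form_metric_hyperbolic[OF cn \<phi>ell lt lell lell] A_def[symmetric] B_def[symmetric]
      by (simp add: sum_distrib_left sum.distrib[symmetric] algebra_simps)
    then show ?thesis unfolding q1 q2 using False by (simp add: A_def B_def)
  qed
qed

subsection \<open>Immersions into hyperbolic space and the logarithmic series\<close>

text \<open>The words over \<open>nat\<close> of length \<open>l\<close> index the orthonormal basis of the \<open>l\<close>-th tensor power
  of \<open>\<ell>\<^sup>2\<close>; \<open>word_prod x\<close> are the coordinates of a tensor power of \<open>x\<close>, and \<open>word_deriv x y\<close> those
  of its derivative in direction \<open>y\<close>.\<close>

primrec word_prod :: "(nat \<Rightarrow> complex) \<Rightarrow> nat list \<Rightarrow> complex" where
  "word_prod x [] = 1"
| "word_prod x (m # w) = x m * word_prod x w"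

primrec word_deriv :: "(nat \<Rightarrow> complex) \<Rightarrow> (nat \<Rightarrow> complex) \<Rightarrow> nat list \<Rightarrow> complex" where
  "word_deriv x y [] = 0"
| "word_deriv x y (m # w) = y m * word_prod x w + x m * word_deriv x y w"

definition words :: "nat \<Rightarrow> nat list set" where
  "words l = {w. length w = l}"

lemma has_sum_words_Suc:
  assumes "((\<lambda>(m, w). f (m # w)) has_sum S) (UNIV \<times> words l)"
  shows "(f has_sum S) (words (Suc l))"
proof -
  have "bij_betw (\<lambda>(m, w). m # w) (UNIV \<times> words l) (words (Suc l))"
    by (rule bij_betw_byWitness[where f' = "\<lambda>w. (hd w, tl w)"]) (auto simp: words_def length_Suc_conv)
  from has_sum_reindex_bij_betw[OF this, of f S] assms show ?thesis by (simp add: case_prod_unfold)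
qed

text \<open>Prepending a letter is a tensor product with \<open>x\<close>, and
  \<open>word_deriv\<close> obeys the Leibniz rule. The third sum at length \<open>Suc l\<close>
  therefore involves all three at length \<open>l\<close>, hence the joint induction.\<close>

lemma word_sums:
  assumes x: "x \<in> ell2" and y: "y \<in> ell2"
  defines "X \<equiv> complex_of_real ((ell2_norm x)\<^sup>2)" and "Y \<equiv> complex_of_real ((ell2_norm y)\<^sup>2)" and "q \<equiv> ell2_inner y x"
  shows "((\<lambda>w. word_prod x w * cnj (word_prod x w)) has_sum X ^ l) (words l)"
    and "((\<lambda>w. word_deriv x y w * cnj (word_prod x w)) has_sum of_nat l * X ^ (l - 1) * q) (words l)"
    and "((\<lambda>w. word_deriv x y w * cnj (word_deriv x y w)) has_sum
      of_nat l * X ^ (l - 1) * Y + of_nat (l * (l - 1)) * X ^ (l - 2) * (q * cnj q)) (words l)"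
proof -
  have sq: "((\<lambda>k. z k * cnj (z k)) has_sum of_real ((ell2_norm z)\<^sup>2)) UNIV" if "z \<in> ell2" for z
    using has_sum_of_real[OF ell2_norm_has_sum[OF that], where 'a = complex]
    by (simp only: complex_norm_square)
  have hX: "((\<lambda>k. x k * cnj (x k)) has_sum X) UNIV" and hY: "((\<lambda>k. y k * cnj (y k)) has_sum Y) UNIV"
    unfolding X_def Y_def using sq x y by auto
  have hq: "((\<lambda>k. y k * cnj (x k)) has_sum q) UNIV" unfolding q_def by (rule ell2_inner_has_sum[OF y x])
  then have "((\<lambda>k. cnj (y k * cnj (x k))) has_sum cnj q) UNIV" by (simp only: has_sum_cnj_iff)
  then have hq': "((\<lambda>k. x k * cnj (y k)) has_sum cnj q) UNIV" by (simp add: mult.commute)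
  have w0: "words 0 = {[]}" by (auto simp: words_def)
  have "((\<lambda>w. word_prod x w * cnj (word_prod x w)) has_sum X ^ l) (words l) \<and>
    ((\<lambda>w. word_deriv x y w * cnj (word_prod x w)) has_sum of_nat l * X ^ (l - 1) * q) (words l) \<and>
    ((\<lambda>w. word_deriv x y w * cnj (word_deriv x y w)) has_sum
      of_nat l * X ^ (l - 1) * Y + of_nat (l * (l - 1)) * X ^ (l - 2) * (q * cnj q)) (words l)"
  proof (induction l)
    case 0
    show ?case unfolding w0 by (auto intro!: has_sum_finiteI)
  next
    case (Suc l)
    define C where "C = of_nat l * X ^ (l - 1) * q"
    define E where "E = of_nat l * X ^ (l - 1) * Y + of_nat (l * (l - 1)) * X ^ (l - 2) * (q * cnj q)"
    have a: "((\<lambda>w. word_prod x w * cnj (word_prod x w)) has_sum X ^ l) (words l)"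
      and b: "((\<lambda>w. word_deriv x y w * cnj (word_prod x w)) has_sum C) (words l)"
      and d: "((\<lambda>w. word_deriv x y w * cnj (word_deriv x y w)) has_sum E) (words l)"
      using Suc by (simp_all add: C_def E_def)
    from b have "((\<lambda>w. cnj (word_deriv x y w * cnj (word_prod x w))) has_sum cnj C) (words l)"
      by (simp only: has_sum_cnj_iff)
    then have b': "((\<lambda>w. word_prod x w * cnj (word_deriv x y w)) has_sum cnj C) (words l)"
      by (simp add: mult.commute)
    have XC: "X * C = of_nat l * X ^ l * q" by (cases l) (simp_all add: C_def)
    have Xr: "cnj X = X" by (simp add: X_def)
    have A: "((\<lambda>w. word_prod x w * cnj (word_prod x w)) has_sum X * X ^ l) (words (Suc l))"
      by (rule has_sum_words_Suc)
         (use has_sum_product_complex[OF hX a] in \<open>simp add: case_prod_unfold mult_ac\<close>)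
    have B: "((\<lambda>w. word_deriv x y w * cnj (word_prod x w)) has_sum q * X ^ l + X * C) (words (Suc l))"
      by (rule has_sum_words_Suc)
         (use has_sum_add[OF has_sum_product_complex[OF hq a] has_sum_product_complex[OF hX b]] in
           \<open>simp add: case_prod_unfold algebra_simps\<close>)
    have D: "((\<lambda>w. word_deriv x y w * cnj (word_deriv x y w)) has_sum
        (Y * X ^ l + X * E) + (q * cnj C + cnj q * C)) (words (Suc l))"
      by (rule has_sum_words_Suc)
         (use has_sum_add[OF has_sum_add[OF has_sum_product_complex[OF hY a] has_sum_product_complex[OF hX d]]
             has_sum_add[OF has_sum_product_complex[OF hq b'] has_sum_product_complex[OF hq' b]]] in
           \<open>simp add: case_prod_unfold algebra_simps\<close>)
    have B2: "q * X ^ l + X * C = of_nat (Suc l) * X ^ l * q"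
      unfolding XC by (simp add: algebra_simps)
    have D2: "(Y * X ^ l + X * E) + (q * cnj C + cnj q * C) =
       of_nat (Suc l) * X ^ l * Y + of_nat (Suc l * l) * X ^ (l - 1) * (q * cnj q)"
    proof -
      \<comment> \<open>The exponents \<open>l - 1\<close> and \<open>l - 2\<close> are truncated
        differences; where truncation occurs, their numerical factors are 0, and the cases on
        \<open>l\<close> deal with this.\<close>
      have XE: "X * E = of_nat l * X ^ l * Y + of_nat (l * (l - 1)) * X ^ (l - 1) * (q * cnj q)"
      proof (cases l)
        case (Suc m)
        then show ?thesis by (cases m) (simp_all add: E_def algebra_simps)
      qed (simp add: E_def)
      have CC: "q * cnj C + cnj q * C = 2 * of_nat l * X ^ (l - 1) * (q * cnj q)"
        by (simp add: C_def Xr)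
      have "of_nat (l * (l - 1)) + 2 * of_nat l = (of_nat (Suc l * l) :: complex)"
        by (cases l) (simp_all add: algebra_simps)
      then have "of_nat (l * (l - 1)) * X ^ (l - 1) * (q * cnj q) + 2 * of_nat l * X ^ (l - 1) * (q * cnj q) =
        of_nat (Suc l * l) * X ^ (l - 1) * (q * cnj q)"
        by (simp only: distrib_right[symmetric])
      moreover have "Y * X ^ l + of_nat l * X ^ l * Y = of_nat (Suc l) * X ^ l * Y"
        by (simp add: algebra_simps)
      ultimately show ?thesis unfolding XE CC by (simp only: add.assoc[symmetric]) (simp only: add.assoc)
    qed
    have s: "Suc l - 1 = l" "Suc l - 2 = l - 1" "X * X ^ l = X ^ Suc l" by simp_all
    show ?case
      unfolding s using A B D unfolding B2 D2 s by blast
  qed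
  then show "((\<lambda>w. word_prod x w * cnj (word_prod x w)) has_sum X ^ l) (words l)"
    and "((\<lambda>w. word_deriv x y w * cnj (word_prod x w)) has_sum of_nat l * X ^ (l - 1) * q) (words l)"
    and "((\<lambda>w. word_deriv x y w * cnj (word_deriv x y w)) has_sum
      of_nat l * X ^ (l - 1) * Y + of_nat (l * (l - 1)) * X ^ (l - 2) * (q * cnj q)) (words l)"
    by blast+
qed

text \<open>The value on the right is the complex Hessian in direction \<open>y\<close> of minus
  \<open>k\<close> times the logarithm of one minus the squared norm. This potential is the sum over
  \<open>l\<close> of \<open>k / l\<close> times the squared norm of the \<open>l\<close>-th tensor
  power of \<open>x\<close>, hence the weights. The empty word contributes 0.\<close>

lemma word_deriv_log_sum:
  assumes x: "x \<in> ell2" "(ell2_norm x)\<^sup>2 < 1" and y: "y \<in> ell2" and k: "0 \<le> k"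
  shows "((\<lambda>w. (cmod (of_real (sqrt (k / real (length w))) * word_deriv x y w))\<^sup>2) has_sum
    k / (1 - (ell2_norm x)\<^sup>2) * (ell2_norm y)\<^sup>2 + k / (1 - (ell2_norm x)\<^sup>2)\<^sup>2 * (cmod (ell2_inner y x))\<^sup>2) UNIV"
proof -
  define X Y Q where "X = (ell2_norm x)\<^sup>2" and "Y = (ell2_norm y)\<^sup>2" and "Q = (cmod (ell2_inner y x))\<^sup>2"
  have nn: "0 \<le> X" "0 \<le> Y" "0 \<le> Q" "X < 1" using x by (auto simp: X_def Y_def Q_def)
  define T where "T l = k / real l * (real l * X ^ (l - 1) * Y + real (l * (l - 1)) * X ^ (l - 2) * Q)" for l
  define f where "f w = (cmod (of_real (sqrt (k / real (length w))) * word_deriv x y w))\<^sup>2" for w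
  have f: "f w = k / real (length w) * (cmod (word_deriv x y w))\<^sup>2" for w
    using k by (simp add: f_def norm_mult power_mult_distrib)
  have inner: "(f has_sum T l) (words l)" for l
  proof -
    have "((\<lambda>w. complex_of_real ((cmod (word_deriv x y w))\<^sup>2)) has_sum
       of_real (real l * X ^ (l - 1) * Y + real (l * (l - 1)) * X ^ (l - 2) * Q)) (words l)"
      using word_sums(3)[OF x(1) y, of l]
      unfolding complex_norm_square[symmetric] by (simp add: X_def Y_def Q_def)
    then have "((\<lambda>w. (cmod (word_deriv x y w))\<^sup>2) has_sum
       (real l * X ^ (l - 1) * Y + real (l * (l - 1)) * X ^ (l - 2) * Q)) (words l)"
      by (simp only: has_sum_of_real_iff)
    then have "((\<lambda>w. k / real l * (cmod (word_deriv x y w))\<^sup>2) has_sum T l) (words l)"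
      unfolding T_def by (rule has_sum_cmult_right)
    then show ?thesis
      by (rule has_sum_cong[THEN iffD1, rotated]) (auto simp: f words_def)
  qed
  have T_Suc: "T (Suc l) = k * Y * X ^ l + k * Q * (real l * X ^ (l - 1))" for l
  proof -
    have "T (Suc l) = k / real (Suc l) * (real (Suc l) * (X ^ l * Y + real l * X ^ (l - 1) * Q))"
      by (simp add: T_def algebra_simps)
    then show ?thesis by (simp add: algebra_simps del: of_nat_Suc)
  qed
  have "(\<lambda>l. real (Suc l) * X ^ l) sums (1 / (1 - X)\<^sup>2)"
    using geometric_deriv_sums[of X] nn by simp
  then have "(\<lambda>l. real l * X ^ (l - 1)) sums (1 / (1 - X)\<^sup>2)"
    using sums_Suc_iff[of "\<lambda>l. real l * X ^ (l - 1)" "1 / (1 - X)\<^sup>2"] by simp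
  moreover have "(\<lambda>l. X ^ l) sums (1 / (1 - X))" using nn by (intro geometric_sums) auto
  ultimately have "(\<lambda>l. T (Suc l)) sums (k * Y * (1 / (1 - X)) + k * Q * (1 / (1 - X)\<^sup>2))"
    unfolding T_Suc by (intro sums_add sums_mult)
  then have "T sums (k * Y * (1 / (1 - X)) + k * Q * (1 / (1 - X)\<^sup>2))"
    using sums_Suc_iff[of T] by (simp add: T_def)
  moreover have "0 \<le> T l" for l using nn k by (auto simp: T_def)
  ultimately have outer: "(T has_sum (k * Y * (1 / (1 - X)) + k * Q * (1 / (1 - X)\<^sup>2))) UNIV"
    by (intro sums_nonneg_imp_has_sum) auto
  define F where "F = (\<lambda>(l :: nat, w). f w)"
  have "(F has_sum (k * Y * (1 / (1 - X)) + k * Q * (1 / (1 - X)\<^sup>2))) (Sigma UNIV words)"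
  proof (rule has_sum_SigmaI[OF _ outer])
    show "((\<lambda>w. F (l, w)) has_sum T l) (words l)" for l using inner by (simp add: F_def)
    have nf: "norm (f w) = f w" for w by (simp add: f_def)
    have nT: "(\<Sum>\<^sub>\<infinity>w\<in>words l. f w) = T l" for l using inner by (rule infsumI)
    have "(\<lambda>p. norm (F p)) summable_on Sigma UNIV words"
    proof (subst Infinite_Sum.abs_summable_on_Sigma_iff, intro conjI ballI)
      show "(\<lambda>w. norm (F (l, w))) summable_on words l" for l
        using has_sum_imp_summable[OF inner] by (simp only: F_def prod.case nf)
      show "(\<lambda>l. norm (\<Sum>\<^sub>\<infinity>w\<in>words l. norm (F (l, w)))) summable_on UNIV"
        using has_sum_imp_summable[OF outer] \<open>\<And>l. 0 \<le> T l\<close> by (simp only: F_def prod.case nf nT) simp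
    qed
    then show "F summable_on Sigma UNIV words" by (rule abs_summable_summable)
  qed
  moreover have "bij_betw snd (Sigma UNIV words) (UNIV :: nat list set)"
    by (rule bij_betw_byWitness[where f' = "\<lambda>w. (length w, w)"]) (auto simp: words_def)
  from has_sum_reindex_bij_betw[OF this, of f]
  have "(F has_sum S) (Sigma UNIV words) \<longleftrightarrow> (f has_sum S) UNIV" for S by (simp add: F_def case_prod_unfold)
  ultimately have "(f has_sum (k * Y * (1 / (1 - X)) + k * Q * (1 / (1 - X)\<^sup>2))) UNIV" by simp
  also have "k * Y * (1 / (1 - X)) + k * Q * (1 / (1 - X)\<^sup>2) = k / (1 - X) * Y + k / (1 - X)\<^sup>2 * Q" by simp
  finally show ?thesis by (simp only: f_def[abs_def] X_def Y_def Q_def)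
qed

lemma word_prod_has_derivative:
  assumes "\<And>k. ((\<lambda>x. \<phi> x k) has_derivative (\<lambda>h. L h k)) (at z)"
  shows "((\<lambda>x. word_prod (\<phi> x) w) has_derivative (\<lambda>h. word_deriv (\<phi> z) (L h) w)) (at z)"
proof (induction w)
  case (Cons m w)
  from has_derivative_mult[OF assms[of m] this] show ?case by (simp add: add.commute)
qed simp

lemma word_deriv_mult: "word_deriv x (\<lambda>k. a * y k) w = a * word_deriv x y w"
  by (induction w) (simp_all add: algebra_simps)

text \<open>Both cases are brought to one format, scalar functions with complex linear derivatives
  whose squares sum to the metric. In the flat case only one-letter words carry coordinates; in the
  hyperbolic case the weighted tensor powers map the ball isometrically into a flat Hilbert
  space.\<close>

theorem immersion_sum_of_squares:
  fixes M :: "(complex^'n) set"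
  assumes M: "open M" and c: "c \<le> 0" and imm: "kaehler_immersion M H c \<phi>"
  obtains \<Phi> :: "nat list \<Rightarrow> complex^'n \<Rightarrow> complex" and \<Phi>'
  where "\<And>w z. z \<in> M \<Longrightarrow> (\<Phi> w has_derivative \<Phi>' w z) (at z)"
    "\<And>w z a u. z \<in> M \<Longrightarrow> \<Phi>' w z (a *s u) = a * \<Phi>' w z u"
    "\<And>z u. z \<in> M \<Longrightarrow> ((\<lambda>w. (cmod (\<Phi>' w z u))\<^sup>2) has_sum Re (herm (H z) u u)) UNIV"
proof -
  have \<phi>: "\<phi> z \<in> space_form c" if "z \<in> M" for z using imm that by (auto simp: kaehler_immersion_def)
  then have \<phi>ell: "\<phi> z \<in> ell2" if "z \<in> M" for z using that by (force simp: space_form_def split: if_splits)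
  have "\<forall>z\<in>M. \<exists>L. has_ell2_derivative \<phi> L z \<and>
        (\<forall>i j. H z $ i $ j = space_form_metric c (\<phi> z) (L (axis i 1)) (L (axis j 1)))"
    using imm by (simp add: kaehler_immersion_def)
  then obtain L where L: "\<And>z. z \<in> M \<Longrightarrow> has_ell2_derivative \<phi> (L z) z"
    and HL: "\<And>z i j. z \<in> M \<Longrightarrow> H z $ i $ j = space_form_metric c (\<phi> z) (L z (axis i 1)) (L z (axis j 1))"
    by metis
  have lmul: "L z (a *s u) k = a * L z u k" and lell: "L z u \<in> ell2" if "z \<in> M" for z a u k
    using L[OF that] by (auto simp: has_ell2_derivative_def)
  have der: "((\<lambda>x. \<phi> x k) has_derivative (\<lambda>h. L z h k)) (at z)" if "z \<in> M" for z k
    by (rule has_ell2_derivative_component[OF M that \<phi>ell L[OF that]])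
  have hm: "herm (H z) u u = (if c = 0 then of_real ((ell2_norm (L z u))\<^sup>2)
    else of_real (- 1 / c / (1 - (ell2_norm (\<phi> z))\<^sup>2) * (ell2_norm (L z u))\<^sup>2
      + - 1 / c / (1 - (ell2_norm (\<phi> z))\<^sup>2)\<^sup>2 * (cmod (ell2_inner (L z u) (\<phi> z)))\<^sup>2))"
    if "z \<in> M" for z u
    using \<phi>[OF that] L[OF that] HL[OF that]
    by (intro immersion_herm[where \<phi> = \<phi> and L = "L z" and z = z, OF c]) auto
  show thesis
  proof (cases "c = 0")
    case True
    define \<Phi> where "\<Phi> w z = (if length w = 1 then \<phi> z (hd w) else 0)" for w z
    define \<Phi>' where "\<Phi>' w z h = (if length w = 1 then L z h (hd w) else 0)" for w z h
    show thesis
    proof (rule that[of \<Phi> \<Phi>'])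
      fix w z assume z: "z \<in> M"
      show "(\<Phi> w has_derivative \<Phi>' w z) (at z)"
        using der[OF z] unfolding \<Phi>_def[abs_def] \<Phi>'_def[abs_def] by (cases "length w = 1") simp_all
      show "\<Phi>' w z (a *s u) = a * \<Phi>' w z u" for a u
        using lmul[OF z] by (auto simp: \<Phi>'_def)
    next
      fix z u assume z: "z \<in> M"
      have "((\<lambda>w. (cmod (\<Phi>' w z u))\<^sup>2) \<circ> (\<lambda>m. [m]) has_sum (ell2_norm (L z u))\<^sup>2) UNIV"
        using ell2_norm_has_sum[OF lell[OF z]] by (simp add: o_def \<Phi>'_def)
      then have "((\<lambda>w. (cmod (\<Phi>' w z u))\<^sup>2) has_sum (ell2_norm (L z u))\<^sup>2) (range (\<lambda>m. [m]))"
        by (subst has_sum_reindex) (auto simp: inj_on_def)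
      then have "((\<lambda>w. (cmod (\<Phi>' w z u))\<^sup>2) has_sum (ell2_norm (L z u))\<^sup>2) UNIV"
        by (rule has_sum_cong_neutral[THEN iffD1, rotated 3]) (auto simp: \<Phi>'_def length_Suc_conv)
      then show "((\<lambda>w. (cmod (\<Phi>' w z u))\<^sup>2) has_sum Re (herm (H z) u u)) UNIV"
        using hm[OF z, of u] True by simp
    qed
  next
    case False
    define k where "k = - 1 / c"
    have k: "0 \<le> k" using False c by (simp add: k_def divide_nonneg_neg)
    define \<Phi> where "\<Phi> w z = of_real (sqrt (k / real (length w))) * word_prod (\<phi> z) w" for w z
    define \<Phi>' where "\<Phi>' w z h = of_real (sqrt (k / real (length w))) * word_deriv (\<phi> z) (L z h) w" for w z h
    show thesis
    proof (rule that[of \<Phi> \<Phi>'])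
      fix w z assume z: "z \<in> M"
      show "(\<Phi> w has_derivative \<Phi>' w z) (at z)"
        unfolding \<Phi>_def[abs_def] \<Phi>'_def[abs_def]
        by (intro has_derivative_mult_right word_prod_has_derivative der z)
      show "\<Phi>' w z (a *s u) = a * \<Phi>' w z u" for a u
      proof -
        have "L z (a *s u) = (\<lambda>k. a * L z u k)" using lmul[OF z] by (intro ext)
        then show ?thesis by (simp add: \<Phi>'_def word_deriv_mult)
      qed
    next
      fix z u assume z: "z \<in> M"
      have lt: "(ell2_norm (\<phi> z))\<^sup>2 < 1"
      proof -
        have "0 \<le> ell2_norm (\<phi> z)" using \<phi>ell[OF z] by (rule ell2_norm_nonneg)
        moreover have "ell2_norm (\<phi> z) < 1" using \<phi>[OF z] False by (simp add: space_form_def)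
        ultimately show ?thesis by (simp add: power_less_one_iff abs_square_less_1)
      qed
      from word_deriv_log_sum[OF \<phi>ell[OF z] lt lell[OF z] k, of u]
      show "((\<lambda>w. (cmod (\<Phi>' w z u))\<^sup>2) has_sum Re (herm (H z) u u)) UNIV"
        using hm[OF z, of u] False by (simp only: \<Phi>'_def k_def if_False Re_complex_of_real)
    qed
  qed
qed

subsection \<open>Radial metrics induced by a space form\<close>

lemma open_radii:
  fixes M :: "(complex^'n) set"
  assumes "open M"
  shows "open (radii M)"
proof (rule openI)
  fix x assume "x \<in> radii M"
  then obtain z where z: "z \<in> M" "z \<noteq> 0" "x = (norm z)\<^sup>2" by (auto simp: radii_def)
  have x0: "0 < x" using z by simp
  define h where "h y = sqrt (y / x) *\<^sub>R z" for y
  define T where "T = {0<..} \<inter> h -` (M - {0})"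
  have "open T"
    unfolding T_def h_def using assms x0
    by (intro open_Int open_vimage open_Diff continuous_intros) auto
  moreover have "x \<in> T" using x0 z by (simp add: T_def h_def)
  moreover have "T \<subseteq> radii M"
  proof
    fix y assume y: "y \<in> T"
    have "(norm (h y))\<^sup>2 = y"
      using y x0 z(3) by (simp add: T_def h_def power_mult_distrib)
    then show "y \<in> radii M" using y by (auto simp: T_def radii_def intro!: image_eqI[of _ _ "h y"])
  qed
  ultimately show "\<exists>e>0. ball x e \<subseteq> radii M" by (meson open_contains_ball order_trans)
qed

lemma connected_radii:
  fixes M :: "(complex^'n) set"
  assumes "open M" "connected M"
  shows "connected (radii M)"
  unfolding radii_def
proof (rule connected_continuous_image)
  have "1 \<le> CARD('n)" by (simp add: Suc_leI)
  then show "connected (M - {0})"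
    by (intro connected_open_delete assms) simp
qed (intro continuous_intros)

lemma radii_pos: "r \<in> radii M \<Longrightarrow> 0 < r"
  by (auto simp: radii_def)

lemma ex_unit_orthogonal:
  fixes p :: "complex^'n"
  assumes "CARD('n) \<ge> 2"
  obtains v where "norm v = 1" "hinner v p = 0"
proof -
  obtain i j :: 'n where ij: "i \<noteq> j"
    using assms by (metis (full_types) card_2_iff' card_le_Suc0_iff_eq finite UNIV_I not_less_eq_eq numeral_2_eq_2)
  define w where "w = (if p $ i = 0 then axis i 1 else cnj (p $ j) *s axis i 1 - cnj (p $ i) *s axis j 1)"
  have "w \<noteq> 0"
  proof (cases "p $ i = 0")
    case False
    then have "w $ j \<noteq> 0" using ij by (simp add: w_def axis_def)
    then show ?thesis by auto
  qed (simp add: w_def)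
  moreover have "hinner w p = 0"
  proof (cases "p $ i = 0")
    case False
    have "w = cnj (p $ j) *s axis i 1 + (- cnj (p $ i)) *s axis j 1" using False by (simp add: w_def vec_eq_iff)
    then show ?thesis by (simp only: hinner_simps hinner_axis) simp
  qed (simp add: w_def hinner_axis)
  ultimately have w: "w \<noteq> 0" "hinner w p = 0" by auto
  show thesis
  proof (rule that[of "(1 / norm w) *\<^sub>R w"])
    show "norm ((1 / norm w) *\<^sub>R w) = 1" using w by simp
    show "hinner ((1 / norm w) *\<^sub>R w) p = 0" unfolding scaleR_vec_conv_of_real hinner_simps using w by simp
  qed
qed

lemma bounded_linear_vector_scalar_left: "bounded_linear (\<lambda>c::complex. c *s (u :: complex^'n))"
  unfolding linear_conv_bounded_linear[symmetric]
  by (rule linearI) (simp_all add: vec_eq_iff algebra_simps)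

text \<open>Orthogonality of \<open>v\<close> and \<open>p\<close> splits the squared norm of
  \<open>exp \<zeta> *s p + \<eta> *s v\<close>, and the metric on \<open>v\<close> becomes
  \<open>F1 + (cmod \<eta>)\<^sup>2 * F2\<close> there, the expression treated in
  \<open>radial_sos_local\<close>. The existence of \<open>v\<close> is where the dimension
  enters.\<close>

lemma radial_immersion_local:
  fixes M :: "(complex^'n) set"
  assumes dim: "CARD('n) \<ge> 2" and M: "open M" and p: "p \<in> M" "p \<noteq> 0"
    and F1: "\<And>r. r \<in> radii M \<Longrightarrow> (F1 has_real_derivative F2 r) (at r)"
    and F2: "continuous_on (radii M) F2"
    and H: "\<And>z. z \<in> M \<Longrightarrow> z \<noteq> 0 \<Longrightarrow> H z = radial_matrix (F1 ((norm z)\<^sup>2)) (F2 ((norm z)\<^sup>2)) z"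
    and c: "c \<le> 0" "kaehler_immersion M H c \<phi>"
  shows "\<exists>P \<rho>. 0 < \<rho> \<and> P holomorphic_on ball (of_real ((norm p)\<^sup>2)) \<rho> \<and> all_hankel_psd P ((norm p)\<^sup>2) \<and>
      (\<forall>x. \<bar>x - (norm p)\<^sup>2\<bar> < \<rho> \<longrightarrow> P (of_real x) = of_real (F1 x))"
proof -
  obtain \<Phi> :: "nat list \<Rightarrow> complex^'n \<Rightarrow> complex" and \<Phi>' where
    \<Phi>: "\<And>w z. z \<in> M \<Longrightarrow> (\<Phi> w has_derivative \<Phi>' w z) (at z)"
      "\<And>w z a u. z \<in> M \<Longrightarrow> \<Phi>' w z (a *s u) = a * \<Phi>' w z u"
      "\<And>z u. z \<in> M \<Longrightarrow> ((\<lambda>w. (cmod (\<Phi>' w z u))\<^sup>2) has_sum Re (herm (H z) u u)) UNIV"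
    by (rule immersion_sum_of_squares[OF M c]) (rule that, assumption+)
  obtain v where v: "norm v = 1" "hinner v p = 0" by (rule ex_unit_orthogonal[OF dim])
  define r1 where "r1 = (norm p)\<^sup>2"
  have r1: "0 < r1" using p by (simp add: r1_def)
  define Z where "Z = (\<lambda>(\<zeta>, \<eta>). exp \<zeta> *s p + \<eta> *s v)"
  have cs: "continuous_on UNIV (\<lambda>c::complex. c *s u)" for u :: "complex^'n"
    by (rule linear_continuous_on[OF bounded_linear_vector_scalar_left])
  have Zc: "continuous_on UNIV Z"
    unfolding Z_def case_prod_unfold
    by (intro continuous_on_add continuous_on_compose2[OF cs] continuous_intros) auto
  have "open (Z -` (M - {0}))" using M Zc by (intro open_vimage) auto
  moreover have "(0, 0) \<in> Z -` (M - {0})" using p by (simp add: Z_def)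
  ultimately obtain A B where AB: "open A" "open B" "(0, 0) \<in> A \<times> B" "A \<times> B \<subseteq> Z -` (M - {0})"
    by (rule open_prod_elim)
  obtain e1 where e1: "e1 > 0" "cball 0 e1 \<subseteq> A" using AB open_contains_cball by blast
  obtain e2 where e2: "e2 > 0" "cball 0 e2 \<subseteq> B" using AB open_contains_cball by blast
  define e where "e = min e1 e2"
  have e: "0 < e" using e1 e2 by (simp add: e_def)
  \<comment> \<open>Closed discs, so that compactness bounds the metric and each component
    function.\<close>
  define Q where "Q = cball (0::complex) e \<times> cball (0::complex) e"
  have Qsub: "Z q \<in> M - {0}" if "q \<in> Q" for q
    using that AB(4) e1 e2 by (fastforce simp: Q_def e_def)
  have Qc: "compact Q" unfolding Q_def by (intro compact_Times compact_cball)
  have bQ: "(\<zeta>, \<eta>) \<in> Q" if "\<zeta> \<in> ball 0 e" "\<eta> \<in> ball 0 e" for \<zeta> \<eta> using that by (simp add: Q_def)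
  have hvv: "hinner v v = 1" using v by (simp add: hinner_self)
  have hpv: "hinner p v = 0" using v hinner_commute[of p v] by simp
  have norm_Z: "(norm (Z (\<zeta>, \<eta>)))\<^sup>2 = r1 * exp (2 * Re \<zeta>) + (cmod \<eta>)\<^sup>2" for \<zeta> \<eta>
    using norm_plus_two_terms[of 0 "exp \<zeta>" p \<eta> v] v hpv
    by (simp add: Z_def r1_def hinner_def[of _ 0] power2_eq_square exp_add[symmetric] mult_ac flip: mult_2_right)
  have hvZ: "hinner v (Z (\<zeta>, \<eta>)) = cnj \<eta>" "hinner (Z (\<zeta>, \<eta>)) v = \<eta>" for \<zeta> \<eta>
    using v hvv hpv by (simp_all add: Z_def hinner_simps)
  define K where "K q = F1 ((norm (Z q))\<^sup>2) + (cmod (snd q))\<^sup>2 * F2 ((norm (Z q))\<^sup>2)" for q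
  have inJ: "(norm (Z q))\<^sup>2 \<in> radii M" if "q \<in> Q" for q using Qsub[OF that] by (auto simp: radii_def)
  have F1c: "continuous_on (radii M) F1"
    using F1 by (meson DERIV_continuous continuous_at_imp_continuous_on)
  have ZQ: "continuous_on Q (\<lambda>q. (norm (Z q))\<^sup>2)" by (intro continuous_intros continuous_on_subset[OF Zc]) auto
  have "continuous_on Q K"
    unfolding K_def
    by (intro continuous_intros continuous_on_compose2[OF F1c ZQ] continuous_on_compose2[OF F2 ZQ]) (use inJ in auto)
  then have "compact (K ` Q)" using Qc by (rule compact_continuous_image)
  then obtain B where B: "\<And>q. q \<in> Q \<Longrightarrow> norm (K q) \<le> B" by (meson compact_imp_bounded bounded_iff imageI)
  define g where "g w \<zeta> \<eta> = \<Phi> w (Z (\<zeta>, \<eta>))" for w \<zeta> \<eta>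
  have d1: "((\<lambda>\<zeta>. g w \<zeta> \<eta>) has_field_derivative \<Phi>' w (Z (\<zeta>, \<eta>)) (exp \<zeta> *s p)) (at \<zeta>)" if "(\<zeta>, \<eta>) \<in> Q" for w \<zeta> \<eta>
  proof -
    have "((\<lambda>\<zeta>. Z (\<zeta>, \<eta>)) has_derivative (\<lambda>h. (h * exp \<zeta>) *s p)) (at \<zeta>)"
      unfolding Z_def prod.case
      by (auto intro!: derivative_eq_intros bounded_linear.has_derivative[OF bounded_linear_vector_scalar_left])
    from has_derivative_compose[OF this \<Phi>(1)] Qsub[OF that]
    have "((\<lambda>\<zeta>. g w \<zeta> \<eta>) has_derivative (\<lambda>h. \<Phi>' w (Z (\<zeta>, \<eta>)) ((h * exp \<zeta>) *s p))) (at \<zeta>)"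
      by (simp add: g_def)
    moreover have "\<Phi>' w (Z (\<zeta>, \<eta>)) ((h * exp \<zeta>) *s p) = \<Phi>' w (Z (\<zeta>, \<eta>)) (exp \<zeta> *s p) * h" for h
      using \<Phi>(2)[of "Z (\<zeta>, \<eta>)" w h "exp \<zeta> *s p"] Qsub[OF that] by (simp add: mult.commute)
    ultimately show ?thesis by (simp add: has_field_derivative_def)
  qed
  have d2: "(g w \<zeta> has_field_derivative \<Phi>' w (Z (\<zeta>, \<eta>)) v) (at \<eta>)" if "(\<zeta>, \<eta>) \<in> Q" for w \<zeta> \<eta>
  proof -
    have "((\<lambda>\<eta>. Z (\<zeta>, \<eta>)) has_derivative (\<lambda>h. h *s v)) (at \<eta>)"
      unfolding Z_def prod.case
      by (auto intro!: derivative_eq_intros bounded_linear.has_derivative[OF bounded_linear_vector_scalar_left])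
    from has_derivative_compose[OF this \<Phi>(1)] Qsub[OF that]
    have "(g w \<zeta> has_derivative (\<lambda>h. \<Phi>' w (Z (\<zeta>, \<eta>)) (h *s v))) (at \<eta>)"
      by (simp add: g_def[abs_def])
    moreover have "\<Phi>' w (Z (\<zeta>, \<eta>)) (h *s v) = \<Phi>' w (Z (\<zeta>, \<eta>)) v * h" for h
      using \<Phi>(2)[of "Z (\<zeta>, \<eta>)" w h v] Qsub[OF that] by (simp add: mult.commute)
    ultimately show ?thesis by (simp add: has_field_derivative_def)
  qed
  obtain P \<rho> where "0 < \<rho>" "P holomorphic_on ball (of_real r1) \<rho>" "all_hankel_psd P r1"
    "\<And>x. \<bar>x - r1\<bar> < \<rho> \<Longrightarrow> P (of_real x) = of_real (F1 x)"
  proof (rule radial_sos_local[OF r1 e F1, of "radii M" B g])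
    fix \<zeta> \<eta> :: complex assume \<zeta>\<eta>: "\<zeta> \<in> ball 0 e" "\<eta> \<in> ball 0 e"
    show "r1 * exp (2 * Re \<zeta>) + (cmod \<eta>)\<^sup>2 \<in> radii M"
      using inJ[OF bQ[OF \<zeta>\<eta>]] by (simp add: norm_Z)
    show "F1 (r1 * exp (2 * Re \<zeta>) + (cmod \<eta>)\<^sup>2) + (cmod \<eta>)\<^sup>2 * F2 (r1 * exp (2 * Re \<zeta>) + (cmod \<eta>)\<^sup>2) \<le> B"
      using B[OF bQ[OF \<zeta>\<eta>]] by (simp add: K_def norm_Z)
    have z: "Z (\<zeta>, \<eta>) \<in> M" "Z (\<zeta>, \<eta>) \<noteq> 0" using Qsub[OF bQ[OF \<zeta>\<eta>]] by auto
    have "Re (herm (H (Z (\<zeta>, \<eta>))) v v) = F1 (r1 * exp (2 * Re \<zeta>) + (cmod \<eta>)\<^sup>2) + (cmod \<eta>)\<^sup>2 * F2 (r1 * exp (2 * Re \<zeta>) + (cmod \<eta>)\<^sup>2)"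
      unfolding H[OF z] herm_radial_matrix hvv hvZ norm_Z mult.commute[of "cnj \<eta>"] complex_norm_square[symmetric]
      by (simp del: of_real_power add: mult.commute)
    then show "((\<lambda>w. (cmod (deriv (g w \<zeta>) \<eta>))\<^sup>2) has_sum
         (F1 (r1 * exp (2 * Re \<zeta>) + (cmod \<eta>)\<^sup>2) + (cmod \<eta>)\<^sup>2 * F2 (r1 * exp (2 * Re \<zeta>) + (cmod \<eta>)\<^sup>2))) UNIV"
      using \<Phi>(3)[OF z(1), of v] DERIV_imp_deriv[OF d2[OF bQ[OF \<zeta>\<eta>]]] by simp
  next
    fix w and \<eta> :: complex assume "\<eta> \<in> ball 0 e"
    then show "(\<lambda>\<zeta>. g w \<zeta> \<eta>) holomorphic_on ball 0 e"
      unfolding holomorphic_on_open[OF open_ball] using d1[OF bQ] by blast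
  next
    fix w and \<zeta> :: complex assume "\<zeta> \<in> ball 0 e"
    then show "g w \<zeta> holomorphic_on ball 0 e"
      unfolding holomorphic_on_open[OF open_ball] using d2[OF bQ] by blast
  next
    fix w
    have "continuous_on (M - {0}) (\<Phi> w)"
      using \<Phi>(1) by (meson DiffD1 continuous_at_imp_continuous_on has_derivative_continuous)
    then have "continuous_on Q (\<lambda>q. \<Phi> w (Z q))"
      by (rule continuous_on_compose2) (use Qsub continuous_on_subset[OF Zc] in auto)
    then have "compact ((\<lambda>q. \<Phi> w (Z q)) ` Q)" using Qc by (rule compact_continuous_image)
    then obtain C where "\<And>q. q \<in> Q \<Longrightarrow> norm (\<Phi> w (Z q)) \<le> C" by (meson compact_imp_bounded bounded_iff imageI)
    then show "\<exists>C. \<forall>\<zeta>\<in>ball 0 e. \<forall>\<eta>\<in>ball 0 e. norm (g w \<zeta> \<eta>) \<le> C"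
      using bQ unfolding g_def by blast
  qed (assumption, rule that, assumption+)
  then show ?thesis unfolding r1_def by blast
qed

theorem radial_immersion_power_series:
  fixes M :: "(complex^'n) set"
  assumes dim: "CARD('n) \<ge> 2" and M: "open M" "connected M" "radii M \<noteq> {}"
    and F1: "\<And>r. r \<in> radii M \<Longrightarrow> (F1 has_real_derivative F2 r) (at r)"
    and F2: "continuous_on (radii M) F2"
    and H: "\<And>z. z \<in> M \<Longrightarrow> z \<noteq> 0 \<Longrightarrow> H z = radial_matrix (F1 ((norm z)\<^sup>2)) (F2 ((norm z)\<^sup>2)) z"
    and c: "c \<le> 0" "kaehler_immersion M H c \<phi>"
  obtains a where "\<And>k. 0 \<le> a k" "\<And>r. r \<in> radii M \<Longrightarrow> (\<lambda>k. a k * r ^ k) sums F1 r"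
proof (rule power_series_if_locally_hankel_psd[OF connected_radii[OF M(1,2)] M(3) radii_pos])
  fix r assume "r \<in> radii M"
  then obtain p where "p \<in> M" "p \<noteq> 0" "r = (norm p)\<^sup>2" by (auto simp: radii_def)
  then show "\<exists>P \<rho>. 0 < \<rho> \<and> P holomorphic_on ball (of_real r) \<rho> \<and> all_hankel_psd P r \<and>
      (\<forall>x. \<bar>x - r\<bar> < \<rho> \<longrightarrow> P (of_real x) = of_real (F1 x))"
    using radial_immersion_local[OF dim M(1) _ _ F1 F2 H c] by simp
qed (assumption, rule that)

subsection \<open>The soliton equation along a complex line\<close>

lemma wirtinger_cong:
  assumes "\<forall>\<^sub>F h in nhds 0. F h = G h"
  shows "wirtinger F = wirtinger G" and "wirtinger_bar F = wirtinger_bar G"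
proof -
  have "vector_derivative (\<lambda>x. F (c * of_real x)) (at 0) = vector_derivative (\<lambda>x. G (c * of_real x)) (at 0)" for c
  proof (rule vector_derivative_cong_eq)
    have "((\<lambda>x::real. c * of_real x) \<longlongrightarrow> c * of_real 0) (nhds 0)"
      by (intro tendsto_intros) (simp add: tendsto_def filterlim_ident eventually_nhds)
    then have "filterlim (\<lambda>x::real. c * of_real x) (nhds 0) (nhds 0)" by simp
    from eventually_compose_filterlim[OF assms this]
    show "\<forall>\<^sub>F x in nhds 0. x \<in> UNIV \<longrightarrow> F (c * of_real x) = G (c * of_real x)" by simp
  qed auto
  from this[of 1] this[of \<i>] show "wirtinger F = wirtinger G" "wirtinger_bar F = wirtinger_bar G"
    by (simp_all add: wirtinger_def wirtinger_bar_def)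
qed

lemma ddbar_cong:
  fixes p q :: "complex^'n \<Rightarrow> real"
  assumes U: "open U" "z \<in> U" and eq: "\<And>w. w \<in> U \<Longrightarrow> p w = q w"
  shows "ddbar p z = ddbar q z"
proof -
  have ev: "\<forall>\<^sub>F \<alpha> in nhds 0. y + \<alpha> *s u \<in> U" if "y \<in> U" for y u
  proof -
    have "open ((\<lambda>\<alpha>. y + \<alpha> *s u) -` U)"
      by (intro open_vimage U(1) continuous_intros linear_continuous_on[OF bounded_linear_vector_scalar_left])
    then show ?thesis using eventually_nhds_in_open[of _ 0] that by force
  qed
  have "mixed_wirtinger (\<lambda>\<alpha> \<beta>. p (z + \<alpha> *s axis i 1 + \<beta> *s axis j 1)) =
      mixed_wirtinger (\<lambda>\<alpha> \<beta>. q (z + \<alpha> *s axis i 1 + \<beta> *s axis j 1))" for i j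
    unfolding mixed_wirtinger_def
  proof (rule wirtinger_cong(1), rule eventually_mono[OF ev[OF U(2), of "axis i 1"]])
    fix \<alpha> assume "z + \<alpha> *s axis i 1 \<in> U"
    from ev[OF this, of "axis j 1"]
    show "wirtinger_bar (\<lambda>\<beta>. of_real (p (z + \<alpha> *s axis i 1 + \<beta> *s axis j 1))) =
      wirtinger_bar (\<lambda>\<beta>. of_real (q (z + \<alpha> *s axis i 1 + \<beta> *s axis j 1)))"
      by (intro wirtinger_cong(2)) (auto elim!: eventually_mono simp: eq)
  qed
  then show ?thesis by (simp add: ddbar_def)
qed

text \<open>The maximum principle for \<open>exp (P \<eta>)\<close> and
  \<open>exp (- P \<eta>)\<close> gives the two inequalities.\<close>

lemma Re_constant_on_circle:
  assumes P: "P holomorphic_on ball 0 e" and r: "0 < r" "r < e"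
    and k: "\<And>\<eta>. norm \<eta> = r \<Longrightarrow> Re (P \<eta>) = k"
  shows "Re (P 0) = k"
proof -
  have le: "Re (G 0) \<le> c" if G: "G holomorphic_on ball 0 e" and c: "\<And>\<eta>. norm \<eta> = r \<Longrightarrow> Re (G \<eta>) = c" for G c
  proof -
    have "norm (exp (G 0)) \<le> exp c"
    proof (rule maximum_modulus_frontier[of "\<lambda>\<eta>. exp (G \<eta>)" "cball 0 r"])
      have "(\<lambda>\<eta>. exp (G \<eta>)) holomorphic_on ball 0 e" using G by (intro holomorphic_intros)
      then show "(\<lambda>\<eta>. exp (G \<eta>)) holomorphic_on interior (cball 0 r)"
        "continuous_on (closure (cball 0 r)) (\<lambda>\<eta>. exp (G \<eta>))"
        using r by (auto intro: holomorphic_on_subset continuous_on_subset[OF holomorphic_on_imp_continuous_on])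
      show "norm (exp (G \<eta>)) \<le> exp c" if "\<eta> \<in> frontier (cball 0 r)" for \<eta>
        using c[of \<eta>] that r by (simp add: norm_exp_eq_Re)
    qed (use r in auto)
    then show ?thesis by (simp add: norm_exp_eq_Re)
  qed
  have "Re (- P 0) \<le> - k" by (rule le) (use P k in \<open>auto intro: holomorphic_intros\<close>)
  moreover have "Re (P 0) \<le> k" by (rule le[OF P k])
  ultimately show ?thesis by simp
qed

lemma deriv_real_on_reals:
  assumes g: "g field_differentiable at (of_real x)"
    and eq: "\<forall>\<^sub>F y in nhds x. g (of_real y) = complex_of_real (h y)"
    and h: "(h has_real_derivative d) (at x)"
  shows "deriv g (of_real x) = of_real d"
proof -
  have "(g has_derivative (\<lambda>t. deriv g (of_real x) * t)) (at (of_real x))"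
    using field_differentiable_derivI[OF g] by (simp add: has_field_derivative_def)
  from has_derivative_compose[OF has_derivative_of_real[OF has_derivative_ident] this]
  have 1: "((\<lambda>y. g (of_real y)) has_derivative (\<lambda>t. deriv g (of_real x) * of_real t)) (at x)" .
  have "((\<lambda>y. complex_of_real (h y)) has_derivative (\<lambda>t. of_real (d * t))) (at x)"
    using h by (intro has_derivative_of_real) (simp add: has_field_derivative_def)
  then have 2: "((\<lambda>y. g (of_real y)) has_derivative (\<lambda>t. of_real (d * t))) (at x)"
    by (rule has_derivative_transform_eventually)
       (use eq eventually_nhds_x_imp_x[OF eq] in \<open>auto simp: eventually_at_filter elim: eventually_mono\<close>)
  from has_derivative_unique[OF 1 2] have "deriv g (of_real x) * of_real 1 = complex_of_real (d * 1)" by metis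
  then show ?thesis by simp
qed

lemma linear_complex_homogeneous:
  fixes D :: "complex^'n \<Rightarrow> complex^'n"
  assumes "linear D" "\<And>u. D (\<i> *s u) = \<i> *s D u"
  shows "D (c *s u) = c *s D u"
proof -
  have c: "c *s w = Re c *\<^sub>R w + Im c *\<^sub>R (\<i> *s w)" for w :: "complex^'n"
    by (simp add: scaleR_vec_conv_of_real vec_eq_iff complex_eq_iff)
  show ?thesis
    by (subst (1 2) c) (simp add: linear_add[OF assms(1)] linear_scale[OF assms(1)] assms(2))
qed

lemma bounded_linear_hinner_left: "bounded_linear (\<lambda>u. hinner u v)"
  unfolding linear_conv_bounded_linear[symmetric]
  by (rule linearI) (simp_all add: scaleR_vec_conv_of_real hinner_simps scaleR_conv_of_real[where 'a = complex])

lemma bounded_linear_hinner_right: "bounded_linear (\<lambda>u. hinner v u)"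
  unfolding linear_conv_bounded_linear[symmetric]
  by (rule linearI) (simp_all add: scaleR_vec_conv_of_real hinner_simps scaleR_conv_of_real[where 'a = complex])

lemma norm_power2_has_derivative:
  fixes z :: "complex^'n"
  shows "((\<lambda>x. (norm x)\<^sup>2) has_derivative (\<lambda>t. 2 * Re (hinner t z))) (at z)"
proof -
  have "((\<lambda>x. x \<bullet> x) has_derivative (\<lambda>t. z \<bullet> t + t \<bullet> z)) (at z)"
    by (intro has_derivative_inner has_derivative_ident)
  moreover have "t \<bullet> z = Re (hinner t z)" for t
    by (simp add: inner_vec_def hinner_def inner_complex_def)
  ultimately show ?thesis by (simp add: dot_square_norm inner_commute[of z])
qed

lemma form11_i: "form11 A u (\<i> *s v) = (herm A u v + herm A v u) / 2"
  by (simp add: form11_herm herm_simps algebra_simps)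

lemma form11_i_left: "form11 A v (\<i> *s u) = (herm A u v + herm A v u) / 2"
  by (simp add: form11_i add.commute)

text \<open>The soliton equation \<open>\<rho> = \<lambda>\<omega> + L\<^sub>X \<omega>\<close> evaluated on \<open>(v, \<i> v)\<close>, for a unit vector \<open>v\<close>;
  the bracket on the right collects the terms of \<open>L\<^sub>X \<omega>\<close>.\<close>

lemma soliton_equation_on_line:
  fixes M :: "(complex^'n) set"
  assumes M: "open M" and z: "z \<in> M" "z \<noteq> 0"
    and F1: "\<And>r. r \<in> radii M \<Longrightarrow> (F1 has_real_derivative F2 r) (at r)"
    and F2: "\<And>r. r \<in> radii M \<Longrightarrow> (F2 has_real_derivative F3 r) (at r)"
    and F3: "\<And>r. r \<in> radii M \<Longrightarrow> (F3 has_real_derivative F4 r) (at r)"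
    and H: "\<And>z. z \<in> M \<Longrightarrow> z \<noteq> 0 \<Longrightarrow> H z = radial_matrix (F1 ((norm z)\<^sup>2)) (F2 ((norm z)\<^sup>2)) z"
    and pos: "\<And>r. r \<in> radii M \<Longrightarrow> 0 < F1 r" "\<And>r. r \<in> radii M \<Longrightarrow> 0 < F1 r + r * F2 r"
    and X: "(X has_derivative DX) (at z)" "\<And>u. DX (\<i> *s u) = \<i> *s DX u"
    and G: "\<And>r. r \<in> radii M \<Longrightarrow> ((\<lambda>r. ln (F1 r ^ (CARD('n) - 1) * (F1 r + F2 r * r))) has_real_derivative G1 r) (at r)"
       "\<And>r. r \<in> radii M \<Longrightarrow> (G1 has_real_derivative G2 r) (at r)"
    and sol: "\<And>u v. form11 (ricci H z) u v =
        of_real lam * form11 (H z) u v + lie_derivative X (\<lambda>x. form11 (H x)) z u v"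
    and v: "norm v = 1" "hinner z v = \<eta>" and r: "r = (norm z)\<^sup>2" and s: "s = (cmod \<eta>)\<^sup>2"
  shows "- (G1 r + s * G2 r) = lam * (F1 r + s * F2 r)
    + 2 * Re (of_real (F2 r + s * F3 r) * hinner (X z) z + of_real (F2 r) * cnj \<eta> * hinner (X z) v
       + of_real (F1 r) * hinner (DX v) v + of_real (F2 r) * \<eta> * hinner (DX v) z)"
proof -
  define U where "U = M - {0}"
  have U: "open U" "z \<in> U" using M z by (auto simp: U_def)
  have rJ: "(norm w)\<^sup>2 \<in> radii M" if "w \<in> U" for w using that by (auto simp: U_def radii_def)
  have HU: "H w = radial_matrix (F1 ((norm w)\<^sup>2)) (F2 ((norm w)\<^sup>2)) w" if "w \<in> U" for w
    using H that by (simp add: U_def)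
  have hvz: "hinner v z = cnj \<eta>" using v(2) hinner_commute[of v z] by simp
  have hvv: "hinner v v = 1" using v by (simp add: hinner_self)
  have ss: "cnj \<eta> * \<eta> = of_real s" by (simp add: s complex_norm_square mult.commute del: of_real_power)
  have "ricci H z = - radial_matrix (G1 r) (G2 r) z"
  proof -
    have "ddbar (\<lambda>w. ln (Re (det (H w)))) z = ddbar (\<lambda>w. (\<lambda>r. ln (F1 r ^ (CARD('n) - 1) * (F1 r + F2 r * r))) ((norm w)\<^sup>2)) z"
    proof (rule ddbar_cong[OF U])
      fix w assume w: "w \<in> U"
      have "F1 ((norm w)\<^sup>2) \<noteq> 0" using pos(1)[OF rJ[OF w]] by simp
      then show "ln (Re (det (H w))) = ln (F1 ((norm w)\<^sup>2) ^ (CARD('n) - 1) * (F1 ((norm w)\<^sup>2) + F2 ((norm w)\<^sup>2) * (norm w)\<^sup>2))"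
        unfolding HU[OF w] by (simp only: det_radial_matrix[OF \<open>F1 ((norm w)\<^sup>2) \<noteq> 0\<close>] Re_complex_of_real)
    qed
    also have "\<dots> = radial_matrix (G1 ((norm z)\<^sup>2)) (G2 ((norm z)\<^sup>2)) z"
      by (rule ddbar_radial[OF open_radii[OF M] rJ[OF U(2)] G(1) G(2)[OF rJ[OF U(2)]]])
    finally show ?thesis by (simp add: ricci_def r)
  qed
  moreover have "herm (- A) a b = - herm A a b" for A :: "complex^'n^'n" and a b
    by (simp add: herm_def sum_negf)
  ultimately have ric: "form11 (ricci H z) v (\<i> *s v) = of_real (- (G1 r + s * G2 r))"
    by (simp add: form11_i herm_radial_matrix hvz v(2) hvv ss)
  have met: "form11 (H z) v (\<i> *s v) = of_real (F1 r + s * F2 r)"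
    by (simp add: form11_i HU[OF U(2)] herm_radial_matrix hvz v(2) hvv ss r[symmetric])
  have lie1: "frechet_derivative (\<lambda>x. form11 (H x) v (\<i> *s v)) (at z) t =
      of_real (F2 r * (2 * Re (hinner t z)) + (F3 r * (2 * Re (hinner t z)) * s + F2 r * (2 * Re (hinner t v * cnj \<eta>))))" for t
  proof -
    have nd: "((\<lambda>x. (norm x)\<^sup>2) has_derivative (\<lambda>t. 2 * Re (hinner t z))) (at z)" by (rule norm_power2_has_derivative)
    have rz: "(norm z)\<^sup>2 \<in> radii M" using rJ U by blast
    have f1: "((\<lambda>x. F1 ((norm x)\<^sup>2)) has_derivative (\<lambda>t. F2 r * (2 * Re (hinner t z)))) (at z)"
      using has_derivative_compose[OF nd F1[OF rz, unfolded has_field_derivative_def]] by (simp add: r)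
    have f2: "((\<lambda>x. F2 ((norm x)\<^sup>2)) has_derivative (\<lambda>t. F3 r * (2 * Re (hinner t z)))) (at z)"
      using has_derivative_compose[OF nd F2[OF rz, unfolded has_field_derivative_def]] by (simp add: r)
    have q: "((\<lambda>x. hinner v x * hinner x v) has_derivative (\<lambda>t. hinner v z * hinner t v + hinner v t * hinner z v)) (at z)"
      by (intro has_derivative_mult bounded_linear.has_derivative[OF bounded_linear_hinner_left]
          bounded_linear.has_derivative[OF bounded_linear_hinner_right] has_derivative_ident)
    have "((\<lambda>x. of_real (F1 ((norm x)\<^sup>2)) + of_real (F2 ((norm x)\<^sup>2)) * (hinner v x * hinner x v)) has_derivative
      (\<lambda>t. of_real (F2 r * (2 * Re (hinner t z))) + (of_real (F2 ((norm z)\<^sup>2)) * (hinner v z * hinner t v + hinner v t * hinner z v)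
         + of_real (F3 r * (2 * Re (hinner t z))) * (hinner v z * hinner z v)))) (at z)"
      by (intro has_derivative_add has_derivative_mult has_derivative_of_real f1 f2 q)
    then have "((\<lambda>x. form11 (H x) v (\<i> *s v)) has_derivative
      (\<lambda>t. of_real (F2 r * (2 * Re (hinner t z))) + (of_real (F2 ((norm z)\<^sup>2)) * (hinner v z * hinner t v + hinner v t * hinner z v)
         + of_real (F3 r * (2 * Re (hinner t z))) * (hinner v z * hinner z v)))) (at z)"
    proof (rule has_derivative_transform_within_open[OF _ U])
      fix x assume "x \<in> U"
      then show "of_real (F1 ((norm x)\<^sup>2)) + of_real (F2 ((norm x)\<^sup>2)) * (hinner v x * hinner x v) = form11 (H x) v (\<i> *s v)"
        by (simp add: form11_i HU herm_radial_matrix hvv)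
    qed
    from frechet_derivative_at[OF this, symmetric]
    have "frechet_derivative (\<lambda>x. form11 (H x) v (\<i> *s v)) (at z) t =
      of_real (F2 r * (2 * Re (hinner t z))) + (of_real (F2 r) * (hinner v z * hinner t v + hinner v t * hinner z v)
         + of_real (F3 r * (2 * Re (hinner t z))) * (hinner v z * hinner z v))" by (simp only: r)
    also have "hinner v z * hinner t v + hinner v t * hinner z v = of_real (2 * Re (hinner t v * cnj \<eta>))"
      unfolding hvz v(2) hinner_commute[of v t] complex_add_cnj[symmetric] by (simp add: mult.commute)
    also have "hinner v z * hinner z v = of_real s" by (simp add: hvz v(2) ss)
    finally show ?thesis by (simp only: of_real_add of_real_mult) (simp only: add_ac)
  qed
  have DXi: "DX (\<i> *s v) = \<i> *s DX v" by (rule X)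
  have fX: "frechet_derivative X (at z) = DX" using frechet_derivative_at[OF X(1)] by simp
  have lie2: "form11 (H z) (DX v) (\<i> *s v) + form11 (H z) v (DX (\<i> *s v)) =
    of_real (2 * Re (of_real (F1 r) * hinner (DX v) v + of_real (F2 r) * \<eta> * hinner (DX v) z))"
  proof -
    have "form11 (H z) (DX v) (\<i> *s v) + form11 (H z) v (DX (\<i> *s v)) = herm (H z) (DX v) v + herm (H z) v (DX v)"
      unfolding DXi form11_i form11_i_left by (simp add: field_simps)
    also have "herm (H z) v (DX v) = cnj (herm (H z) (DX v) v)"
      unfolding HU[OF U(2)] herm_radial_matrix
      by (simp add: hinner_commute[of _ "DX v"] hinner_commute[of z v] mult.commute)
    also have "herm (H z) (DX v) v + cnj (herm (H z) (DX v) v) = of_real (2 * Re (herm (H z) (DX v) v))"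
      by (rule complex_add_cnj)
    also have "herm (H z) (DX v) v = of_real (F1 r) * hinner (DX v) v + of_real (F2 r) * \<eta> * hinner (DX v) z"
      unfolding HU[OF U(2)] herm_radial_matrix v(2) r[symmetric] by (simp only: mult_ac)
    finally show ?thesis .
  qed
  have "complex_of_real (- (G1 r + s * G2 r)) = of_real lam * of_real (F1 r + s * F2 r) +
     (of_real (F2 r * (2 * Re (hinner (X z) z)) + (F3 r * (2 * Re (hinner (X z) z)) * s + F2 r * (2 * Re (hinner (X z) v * cnj \<eta>))))
     + of_real (2 * Re (of_real (F1 r) * hinner (DX v) v + of_real (F2 r) * \<eta> * hinner (DX v) z)))"
    using sol[of v "\<i> *s v"] unfolding ric met lie_derivative_def lie1 fX add.assoc lie2 .
  then have "- (G1 r + s * G2 r) = lam * (F1 r + s * F2 r) +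
     ((F2 r * (2 * Re (hinner (X z) z)) + (F3 r * (2 * Re (hinner (X z) z)) * s + F2 r * (2 * Re (hinner (X z) v * cnj \<eta>))))
     + 2 * Re (of_real (F1 r) * hinner (DX v) v + of_real (F2 r) * \<eta> * hinner (DX v) z))"
    unfolding of_real_mult[symmetric] of_real_add[symmetric] of_real_eq_iff .
  then show ?thesis by (simp add: algebra_simps)
qed

text \<open>On the circle \<open>\<eta> * cnj \<eta>\<close> is the constant
  \<open>\<rho>\<^sup>2\<close>, which removes the antiholomorphic factors:
  \<open>cnj \<eta> * b \<eta>\<close> becomes
  \<open>cnj \<eta> * b 0 + \<rho>\<^sup>2 * c \<eta>\<close> with a holomorphic quotient
  \<open>c\<close>, and \<open>cnj \<eta> * b 0\<close> has the same real part as
  \<open>cnj (b 0) * \<eta>\<close>. What remains is a holomorphic function with constant real part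
  on the circle, evaluated at its centre.\<close>

lemma soliton_ode_average:
  fixes a b a' b' :: "complex \<Rightarrow> complex"
  assumes e: "0 < e"
    and da: "\<And>\<eta>. \<eta> \<in> ball 0 e \<Longrightarrow> (a has_field_derivative a' \<eta>) (at \<eta>)"
    and db: "\<And>\<eta>. \<eta> \<in> ball 0 e \<Longrightarrow> (b has_field_derivative b' \<eta>) (at \<eta>)"
    and \<rho>: "0 < \<rho>" "\<rho> < e"
    and eq: "\<And>\<eta>. norm \<eta> = \<rho> \<Longrightarrow> k = 2 * Re (of_real (f2 + \<rho>\<^sup>2 * f3) * (a \<eta> + cnj \<eta> * b \<eta>) + of_real f2 * cnj \<eta> * b \<eta>
       + of_real f1 * b' \<eta> + of_real f2 * \<eta> * (a' \<eta> + cnj \<eta> * b' \<eta>))"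
  shows "k = (f2 + \<rho>\<^sup>2 * f3) * (2 * Re (a 0) + \<rho>\<^sup>2 * (2 * Re (b' 0))) + (2 * \<rho>\<^sup>2 * f2 + f1) * (2 * Re (b' 0))"
proof -
  define s where "s = \<rho>\<^sup>2"
  define c where "c \<eta> = (if \<eta> = 0 then deriv b 0 else (b \<eta> - b 0) / (\<eta> - 0))" for \<eta>
  have ah: "a holomorphic_on ball 0 e" and bh: "b holomorphic_on ball 0 e"
    unfolding holomorphic_on_open[OF open_ball] using da db by blast+
  have da': "deriv a \<eta> = a' \<eta>" and db': "deriv b \<eta> = b' \<eta>" if "\<eta> \<in> ball 0 e" for \<eta>
    using da[OF that] db[OF that] by (simp_all add: DERIV_imp_deriv)
  have a'h: "a' holomorphic_on ball 0 e"
    by (rule holomorphic_transform[OF holomorphic_deriv[OF ah]]) (use da' in auto)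
  have b'h: "b' holomorphic_on ball 0 e"
    by (rule holomorphic_transform[OF holomorphic_deriv[OF bh]]) (use db' in auto)
  have ch: "c holomorphic_on ball 0 e"
    unfolding c_def by (rule pole_lemma_open[OF bh]) auto
  have bc: "b \<eta> = b 0 + \<eta> * c \<eta>" for \<eta> by (simp add: c_def)
  have c0: "c 0 = b' 0" using db'[of 0] e by (simp add: c_def)
  define P where "P \<eta> = of_real (f2 + s * f3) * (a \<eta> + of_real s * c \<eta> + cnj (b 0) * \<eta>) + of_real f2 * (of_real s * c \<eta> + cnj (b 0) * \<eta>)
     + of_real f1 * b' \<eta> + of_real f2 * (\<eta> * a' \<eta> + of_real s * b' \<eta>)" for \<eta>
  have "Re (P 0) = k / 2"
  proof (rule Re_constant_on_circle[OF _ \<rho>])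
    show "P holomorphic_on ball 0 e" unfolding P_def by (intro holomorphic_intros ah ch a'h b'h)
    fix \<eta> :: complex assume n: "norm \<eta> = \<rho>"
    have ss: "cnj \<eta> * \<eta> = of_real s" "\<eta> * cnj \<eta> = of_real s"
      using n by (simp_all add: s_def complex_norm_square[symmetric] mult.commute flip: of_real_power)
    have cb: "cnj \<eta> * b \<eta> = cnj \<eta> * b 0 + of_real s * c \<eta>"
      by (subst bc) (simp add: distrib_left ss flip: mult.assoc)
    have eb: "\<eta> * (a' \<eta> + cnj \<eta> * b' \<eta>) = \<eta> * a' \<eta> + of_real s * b' \<eta>"
      by (simp add: distrib_left ss flip: mult.assoc)
    have "Re (cnj \<eta> * b 0) = Re (cnj (b 0) * \<eta>)" by simp
    then have 1: "Re (cnj \<eta> * b \<eta>) = Re (of_real s * c \<eta> + cnj (b 0) * \<eta>)" unfolding cb by simp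
    have Rm: "Re (of_real x * w) = x * Re w" for x w by simp
    have "k / 2 = (f2 + s * f3) * (Re (a \<eta>) + Re (cnj \<eta> * b \<eta>)) + f2 * Re (cnj \<eta> * b \<eta>) + f1 * Re (b' \<eta>)
       + f2 * Re (\<eta> * (a' \<eta> + cnj \<eta> * b' \<eta>))"
      unfolding eq[OF n] s_def[symmetric] by (simp only: Rm mult.assoc plus_complex.simps) simp
    also have "\<dots> = Re (P \<eta>)"
      unfolding 1 eb P_def by (simp only: Rm plus_complex.simps) (simp add: algebra_simps)
    finally show "Re (P \<eta>) = k / 2" by simp
  qed
  then show ?thesis
    by (simp add: P_def c0 s_def[symmetric] algebra_simps)
qed

text \<open>Both sides of the equation are derivatives in \<open>s\<close> of products with the
  factor \<open>s\<close>. Hence \<open>\<Psi>\<close> is constant for positive \<open>s\<close>,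
  and by continuity this constant is its value 0 at \<open>s = 0\<close>.\<close>

lemma soliton_ode_integrate:
  fixes F1 F2 F3 G1 G2 :: "real \<Rightarrow> real"
  assumes E: "0 < E"
    and F1: "\<And>s. 0 \<le> s \<Longrightarrow> s < E \<Longrightarrow> (F1 has_real_derivative F2 (r + s)) (at (r + s))"
    and F2: "\<And>s. 0 \<le> s \<Longrightarrow> s < E \<Longrightarrow> (F2 has_real_derivative F3 (r + s)) (at (r + s))"
    and G1: "\<And>s. 0 \<le> s \<Longrightarrow> s < E \<Longrightarrow> (G1 has_real_derivative G2 (r + s)) (at (r + s))"
    and eq: "\<And>s. 0 < s \<Longrightarrow> s < E \<Longrightarrow> - (G1 (r + s) + s * G2 (r + s)) = lam * (F1 (r + s) + s * F2 (r + s))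
       + ((F2 (r + s) + s * F3 (r + s)) * (A + s * B) + (2 * s * F2 (r + s) + F1 (r + s)) * B)"
    and s: "0 < s" "s < E"
  shows "G1 (r + s) = - (lam * F1 (r + s) + F2 (r + s) * (A + s * B) + F1 (r + s) * B)"
proof -
  define \<Psi> where "\<Psi> x = x * (G1 (r + x) + lam * F1 (r + x) + F2 (r + x) * (A + x * B) + F1 (r + x) * B)" for x
  have sh: "((\<lambda>x. h (r + x)) has_real_derivative h') (at x)" if "(h has_real_derivative h') (at (r + x))" for h h' x
    using that DERIV_shift[of h h' x r] by (simp add: add.commute)
  have d: "(\<Psi> has_real_derivative (G1 (r + x) + lam * F1 (r + x) + F2 (r + x) * (A + x * B) + F1 (r + x) * B)
     + x * (G2 (r + x) + lam * F2 (r + x) + (F3 (r + x) * (A + x * B) + F2 (r + x) * B) + F2 (r + x) * B)) (at x)"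
    if "0 \<le> x" "x < E" for x
    unfolding \<Psi>_def
    by (rule derivative_eq_intros refl sh[OF F1[OF that]] sh[OF F2[OF that]] sh[OF G1[OF that]])+ (simp add: algebra_simps)
  have "\<exists>c. \<forall>x\<in>{0<..<E}. \<Psi> x = c"
  proof (rule has_field_derivative_zero_constant)
    fix x assume x: "x \<in> {0<..<E}"
    have "(G1 (r + x) + lam * F1 (r + x) + F2 (r + x) * (A + x * B) + F1 (r + x) * B)
     + x * (G2 (r + x) + lam * F2 (r + x) + (F3 (r + x) * (A + x * B) + F2 (r + x) * B) + F2 (r + x) * B) = 0"
      using eq[of x] x by (simp add: algebra_simps)
    then show "(\<Psi> has_real_derivative 0) (at x within {0<..<E})"
      using d[of x] x by (simp add: has_field_derivative_at_within)
  qed simp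
  then obtain c where c: "\<And>x. x \<in> {0<..<E} \<Longrightarrow> \<Psi> x = c" by blast
  have "isCont \<Psi> 0" using d[of 0] E by (intro DERIV_isCont) auto
  then have "(\<Psi> \<longlongrightarrow> \<Psi> 0) (at_right 0)" by (simp add: isCont_def filterlim_at_split)
  moreover have "(\<Psi> \<longlongrightarrow> c) (at_right 0)"
  proof (rule tendsto_eventually)
    show "\<forall>\<^sub>F x in at_right 0. \<Psi> x = c"
      using eventually_at_right_less[of "0::real"] eventually_at_right[OF E, THEN iffD2, of "\<lambda>x. x < E"] c E
      by (auto simp: eventually_at_right[OF E])
  qed
  ultimately have "\<Psi> 0 = c" by (intro tendsto_unique[of "at_right (0::real)"]) auto
  then have "\<Psi> s = 0" using c[of s] s by (simp add: \<Psi>_def)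
  then show ?thesis using s by (simp add: \<Psi>_def)
qed

text \<open>The equation is used in the form \<open>deriv D w = - K w * D w\<close>, which makes
  sense where \<open>D\<close> vanishes and continues to the whole disc about 0. Since
  \<open>D w * exp (L w)\<close> is then constant, a zero of \<open>D\<close> at the origin would
  make \<open>D\<close> vanish identically.\<close>

lemma power_series_ode_constant_term:
  fixes a :: "nat \<Rightarrow> real"
  assumes sm: "\<And>x. 0 \<le> x \<Longrightarrow> x < R \<Longrightarrow> summable (\<lambda>k. a k * x ^ k)"
    and r: "0 < r" "r < R"
    and F1: "\<And>x. r < x \<Longrightarrow> x < R \<Longrightarrow> F1 x = (\<Sum>k. a k * x ^ k)"
    and d1: "\<And>x. r < x \<Longrightarrow> x < R \<Longrightarrow> (F1 has_real_derivative F2 x) (at x)"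
    and d2: "\<And>x. r < x \<Longrightarrow> x < R \<Longrightarrow> (F2 has_real_derivative F3 x) (at x)"
    and D: "\<And>x. r < x \<Longrightarrow> x < R \<Longrightarrow> ((\<lambda>x. F1 x ^ m * (F1 x + F2 x * x)) has_real_derivative D1 x) (at x)"
    and nz: "\<And>x. r < x \<Longrightarrow> x < R \<Longrightarrow> F1 x ^ m * (F1 x + F2 x * x) \<noteq> 0"
    and ode: "\<And>x. r < x \<Longrightarrow> x < R \<Longrightarrow> D1 x = - (lam * F1 x + F2 x * (A + (x - r) * B) + F1 x * B) * (F1 x ^ m * (F1 x + F2 x * x))"
  shows "a 0 \<noteq> 0"
proof
  assume a0: "a 0 = 0"
  define S where "S = ball (0::complex) R"
  have inS: "complex_of_real x \<in> S" if "r < x" "x < R" for x using that r by (simp add: S_def)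
  define F where "F w = (\<Sum>k. complex_of_real (a k) * w ^ k)" for w
  have Fh: "F holomorphic_on S"
    using power_series_holomorphic_real[of R a 0] sm by (simp add: F_def[abs_def] S_def)
  have ev: "\<forall>\<^sub>F y in nhds x. r < y \<and> y < R" if "r < x" "x < R" for x
    using eventually_nhds_in_open[of "{r<..<R}" x] that by simp
  have FR: "F (of_real x) = of_real (F1 x)" if "r < x" "x < R" for x
    using higher_deriv_power_series_real(1)[of R a x 0] sm F1[OF that] that r by (simp add: F_def[abs_def])
  have F'h: "deriv F holomorphic_on S" by (rule holomorphic_deriv[OF Fh]) (simp add: S_def)
  have F'R: "deriv F (of_real x) = of_real (F2 x)" if "r < x" "x < R" for x
    by (rule deriv_real_on_reals[where h = F1, OF _ eventually_mono[OF ev[OF that] FR] d1[OF that]])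
       (use inS[OF that] Fh in \<open>auto simp: S_def intro: holomorphic_on_imp_differentiable_at\<close>)
  define D where "D w = F w ^ m * (F w + deriv F w * w)" for w
  have Dh: "D holomorphic_on S" unfolding D_def by (intro holomorphic_intros Fh F'h)
  have D'h: "deriv D holomorphic_on S" by (rule holomorphic_deriv[OF Dh]) (simp add: S_def)
  have DR: "D (of_real x) = of_real (F1 x ^ m * (F1 x + F2 x * x))" if "r < x" "x < R" for x
    using FR[OF that] F'R[OF that] by (simp add: D_def)
  have D'R: "deriv D (of_real x) = of_real (D1 x)" if "r < x" "x < R" for x
    by (rule deriv_real_on_reals[where h = "\<lambda>x. F1 x ^ m * (F1 x + F2 x * x)", OF _ eventually_mono[OF ev[OF that] DR] D[OF that]])
       (use inS[OF that] Dh in \<open>auto simp: S_def intro: holomorphic_on_imp_differentiable_at\<close>)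
  define K where "K w = of_real lam * F w + deriv F w * (of_real A + (w - of_real r) * of_real B) + F w * of_real B" for w
  have Kh: "K holomorphic_on S" unfolding K_def by (intro holomorphic_intros Fh F'h)
  have ode': "deriv D w = - K w * D w" if "w \<in> S" for w
  proof (rule holomorphic_eq_if_eq_on_reals[OF D'h _ _ _ r(2) inS _ that])
    show "(\<lambda>w. - K w * D w) holomorphic_on S" by (intro holomorphic_intros Kh Dh)
    show "deriv D (of_real x) = - K (of_real x) * D (of_real x)" if "r < x" "x < R" for x
      unfolding D'R[OF that] DR[OF that] K_def FR[OF that] F'R[OF that] ode[OF that] by simp
  qed (auto simp: S_def)
  obtain L where L: "\<And>w. w \<in> S \<Longrightarrow> (L has_field_derivative K w) (at w within S)"
    using holomorphic_convex_primitive'[OF _ _ Kh] by (auto simp: S_def)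
  have "\<exists>c. \<forall>w\<in>S. D w * exp (L w) = c"
  proof (rule has_field_derivative_zero_constant)
    fix w assume w: "w \<in> S"
    have "(D has_field_derivative deriv D w) (at w within S)"
      using holomorphic_derivI[OF Dh _ w] by (simp add: S_def has_field_derivative_at_within)
    then have "(D has_field_derivative - K w * D w) (at w within S)" using ode'[OF w] by simp
    then have "((\<lambda>w. D w * exp (L w)) has_field_derivative (- K w * D w) * exp (L w) + (exp (L w) * K w) * D w) (at w within S)"
      by (intro DERIV_mult DERIV_chain2[OF DERIV_exp] L w)
    then show "((\<lambda>w. D w * exp (L w)) has_field_derivative 0) (at w within S)" by (simp add: algebra_simps)
  qed (simp add: S_def)
  then obtain c where c: "\<And>w. w \<in> S \<Longrightarrow> D w * exp (L w) = c" by blast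
  have "F 0 = 0" unfolding F_def using a0 powser_zero[of "\<lambda>k. complex_of_real (a k)"] by simp
  then have "D 0 = 0" by (simp add: D_def)
  moreover have "0 \<in> S" using r by (simp add: S_def)
  ultimately have "c = 0" using c[of 0] by simp
  define x where "x = (r + R) / 2"
  have x: "r < x" "x < R" using r by (auto simp: x_def)
  have "D (of_real x) = 0" using c[OF inS[OF x]] \<open>c = 0\<close> by simp
  then show False using DR[OF x] nz[OF x] by (simp only: of_real_eq_0_iff)
qed

text \<open>On the complex line through \<open>p\<close> in an orthogonal direction
  \<open>v\<close>, circles about \<open>p\<close> consist of points of equal norm. The radial
  functions are constant there, so the soliton equation can be averaged over each circle, and the
  squared radius of the circle becomes the variable of the resulting equation.\<close>

lemma soliton_constant_term:
  fixes M :: "(complex^'n) set" and a :: "nat \<Rightarrow> real"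
  assumes dim: "CARD('n) \<ge> 2" and M: "open M" and p: "p \<in> M" "p \<noteq> 0"
    and F1: "\<And>r. r \<in> radii M \<Longrightarrow> (F1 has_real_derivative F2 r) (at r)"
    and F2: "\<And>r. r \<in> radii M \<Longrightarrow> (F2 has_real_derivative F3 r) (at r)"
    and F3: "\<And>r. r \<in> radii M \<Longrightarrow> (F3 has_real_derivative F4 r) (at r)"
    and H: "\<And>z. z \<in> M \<Longrightarrow> z \<noteq> 0 \<Longrightarrow> H z = radial_matrix (F1 ((norm z)\<^sup>2)) (F2 ((norm z)\<^sup>2)) z"
    and pos: "\<And>r. r \<in> radii M \<Longrightarrow> 0 < F1 r" "\<And>r. r \<in> radii M \<Longrightarrow> 0 < F1 r + r * F2 r"
    and sol: "kaehler_ricci_soliton M H X"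
    and a: "\<And>k. 0 \<le> a k" "\<And>r. r \<in> radii M \<Longrightarrow> (\<lambda>k. a k * r ^ k) sums F1 r"
  shows "a 0 \<noteq> 0"
proof -
  obtain v where v: "norm v = 1" "hinner v p = 0" by (rule ex_unit_orthogonal[OF dim])
  have hvv: "hinner v v = 1" using v by (simp add: hinner_self)
  have hpv: "hinner p v = 0" using v hinner_commute[of p v] by simp
  define r0 where "r0 = (norm p)\<^sup>2"
  have r0: "0 < r0" using p by (simp add: r0_def)
  have line: "((\<lambda>\<eta>. p + \<eta> *s v) has_derivative (\<lambda>h. h *s v)) (at \<eta>)" for \<eta>
    by (auto intro!: derivative_eq_intros bounded_linear.has_derivative[OF bounded_linear_vector_scalar_left])
  have "open ((\<lambda>\<eta>. p + \<eta> *s v) -` (M - {0}))"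
    using M by (intro open_vimage continuous_intros linear_continuous_on[OF bounded_linear_vector_scalar_left]) auto
  moreover have "0 \<in> (\<lambda>\<eta>. p + \<eta> *s v) -` (M - {0})" using p by simp
  ultimately obtain e where e: "0 < e" "ball 0 e \<subseteq> (\<lambda>\<eta>. p + \<eta> *s v) -` (M - {0})" using openE by blast
  have inM: "p + \<eta> *s v \<in> M" "p + \<eta> *s v \<noteq> 0" if "\<eta> \<in> ball 0 e" for \<eta> using e that by auto
  have nrm: "(norm (p + \<eta> *s v))\<^sup>2 = r0 + (cmod \<eta>)\<^sup>2" for \<eta>
    using norm_plus_two_terms[of p 0 v \<eta> v] v by (simp add: r0_def)
  have hz: "hinner u (p + \<eta> *s v) = hinner u p + cnj \<eta> * hinner u v" "hinner (p + \<eta> *s v) v = \<eta>" for u \<eta>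
    by (simp_all add: hinner_simps hpv hvv)
  have inJ: "r0 + s \<in> radii M" if "0 \<le> s" "s < e\<^sup>2" for s
  proof -
    have "sqrt s < e" using that e by (intro real_less_lsqrt) auto
    then have "of_real (sqrt s) \<in> ball (0::complex) e" using that by simp
    from inM[OF this] nrm[of "of_real (sqrt s)"] show ?thesis
      using that by (auto simp: radii_def intro!: image_eqI[of _ _ "p + of_real (sqrt s) *s v"])
  qed
  define m where "m = CARD('n) - 1"
  \<comment> \<open>The determinant of \<open>H\<close> as a function of the squared norm, by
    \<open>det_radial_matrix\<close>.\<close>
  define D where "D r = F1 r ^ m * (F1 r + F2 r * r)" for r
  define D1 where "D1 r = real m * F1 r ^ (m - 1) * F2 r * (F1 r + F2 r * r) + F1 r ^ m * (F2 r + F3 r * r + F2 r)" for r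
  have D1: "(D has_real_derivative D1 r) (at r)" if "r \<in> radii M" for r
    unfolding D_def D1_def
    by (rule derivative_eq_intros refl F1[OF that] F2[OF that])+ (simp add: algebra_simps)
  have Dpos: "0 < D r" if "r \<in> radii M" for r
    unfolding D_def using pos[OF that] by (simp add: mult.commute)
  define G1 where "G1 r = D1 r / D r" for r
  define G2 where "G2 r = deriv G1 r" for r
  have lnD: "((\<lambda>r. ln (D r)) has_real_derivative G1 r) (at r)" if "r \<in> radii M" for r
    unfolding G1_def using DERIV_chain2[OF DERIV_ln[OF Dpos[OF that]] D1[OF that]] by (simp add: field_simps)
  have G2: "(G1 has_real_derivative G2 r) (at r)" if r: "r \<in> radii M" for r
  proof -
    have df: "F1 differentiable (at r)" "F2 differentiable (at r)" "F3 differentiable (at r)"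
      using F1[OF r] F2[OF r] F3[OF r] by (auto simp: real_differentiable_def)
    have "D1 differentiable (at r)"
      unfolding D1_def[abs_def] by (intro derivative_intros df)
    moreover have "D differentiable (at r)" using D1[OF r] by (auto simp: real_differentiable_def)
    ultimately have "G1 differentiable (at r)"
      unfolding G1_def[abs_def] by (rule differentiable_divide) (use Dpos[OF r] in simp)
    then show ?thesis unfolding G2_def by (simp add: DERIV_deriv_iff_real_differentiable)
  qed
  have hol: "real_holomorphic_field M X" using sol by (simp add: kaehler_ricci_soliton_def)
  obtain lam where lam: "\<And>z u v. z \<in> M \<Longrightarrow> form11 (ricci H z) u v =
        of_real lam * form11 (H z) u v + lie_derivative X (\<lambda>x. form11 (H x)) z u v"
    using sol by (auto simp: kaehler_ricci_soliton_def)
  define DX where "DX z = frechet_derivative X (at z)" for z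
  have dX: "(X has_derivative DX z) (at z)" and DXi: "DX z (\<i> *s u) = \<i> *s DX z u" if "z \<in> M" for z u
    using hol that by (auto simp: real_holomorphic_field_def DX_def frechet_derivative_works)
  have DXc: "DX z (c *s u) = c *s DX z u" if "z \<in> M" for z u c
    by (rule linear_complex_homogeneous[OF has_derivative_linear[OF dX[OF that]] DXi[OF that]])
  define a1 where "a1 \<eta> = hinner (X (p + \<eta> *s v)) p" for \<eta>
  define b1 where "b1 \<eta> = hinner (X (p + \<eta> *s v)) v" for \<eta>
  define a1' where "a1' \<eta> = hinner (DX (p + \<eta> *s v) v) p" for \<eta>
  define b1' where "b1' \<eta> = hinner (DX (p + \<eta> *s v) v) v" for \<eta>
  have dl: "((\<lambda>\<eta>. hinner (X (p + \<eta> *s v)) u) has_field_derivative hinner (DX (p + \<eta> *s v) v) u) (at \<eta>)"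
    if "\<eta> \<in> ball 0 e" for \<eta> u
  proof -
    have "((\<lambda>\<eta>. hinner (X (p + \<eta> *s v)) u) has_derivative (\<lambda>h. hinner (DX (p + \<eta> *s v) (h *s v)) u)) (at \<eta>)"
      by (rule bounded_linear.has_derivative[OF bounded_linear_hinner_left has_derivative_compose[OF line dX[OF inM(1)[OF that]]]])
    then show ?thesis
      by (simp add: has_field_derivative_def DXc[OF inM(1)[OF that]] hinner_simps mult_commute_abs)
  qed
  \<comment> \<open>All that averaging keeps of the field: twice the real part of its product with
    \<open>p\<close> at \<open>p\<close>, and of the entry of its differential at \<open>p\<close>
    in direction \<open>v\<close>.\<close>
  define A B where "A = 2 * Re (a1 0)" and "B = 2 * Re (b1' 0)"
  have ode: "G1 (r0 + s) = - (lam * F1 (r0 + s) + F2 (r0 + s) * (A + s * B) + F1 (r0 + s) * B)"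
    if s: "0 < s" "s < e\<^sup>2" for s
  proof (rule soliton_ode_integrate[where E = "e\<^sup>2" and ?F3.0 = F3 and ?G2.0 = G2, OF _ _ _ _ _ s])
    fix s :: real assume s: "0 < s" "s < e\<^sup>2"
    define \<rho> where "\<rho> = sqrt s"
    have \<rho>: "0 < \<rho>" "\<rho> < e" "\<rho>\<^sup>2 = s" using s e by (auto simp: \<rho>_def intro: real_less_lsqrt)
    define r where "r = r0 + s"
    define k where "k = - (G1 r + s * G2 r) - lam * (F1 r + s * F2 r)"
    have "k = (F2 r + \<rho>\<^sup>2 * F3 r) * (2 * Re (a1 0) + \<rho>\<^sup>2 * (2 * Re (b1' 0))) + (2 * \<rho>\<^sup>2 * F2 r + F1 r) * (2 * Re (b1' 0))"
    proof (rule soliton_ode_average[OF e(1) _ _ \<rho>(1,2), of a1 a1' b1])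
      show "(a1 has_field_derivative a1' \<eta>) (at \<eta>)" "(b1 has_field_derivative b1' \<eta>) (at \<eta>)" if "\<eta> \<in> ball 0 e" for \<eta>
        using dl[OF that] unfolding a1_def[abs_def] b1_def[abs_def] a1'_def b1'_def by blast+
      fix \<eta> :: complex assume n: "norm \<eta> = \<rho>"
      then have \<eta>: "\<eta> \<in> ball 0 e" using \<rho> by simp
      note z = inM[OF \<eta>]
      have "- (G1 r + s * G2 r) = lam * (F1 r + s * F2 r)
        + 2 * Re (of_real (F2 r + s * F3 r) * hinner (X (p + \<eta> *s v)) (p + \<eta> *s v) + of_real (F2 r) * cnj \<eta> * hinner (X (p + \<eta> *s v)) v
         + of_real (F1 r) * hinner (DX (p + \<eta> *s v) v) v + of_real (F2 r) * \<eta> * hinner (DX (p + \<eta> *s v) v) (p + \<eta> *s v))"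
        by (rule soliton_equation_on_line[OF M z F1 F2 F3 H pos dX[OF z(1)] DXi[OF z(1)] lnD[unfolded D_def m_def] G2 lam[OF z(1)] v(1) hz(2)])
           (use n \<rho> nrm in \<open>auto simp: r_def\<close>)
      then show "k = 2 * Re (of_real (F2 r + \<rho>\<^sup>2 * F3 r) * (a1 \<eta> + cnj \<eta> * b1 \<eta>) + of_real (F2 r) * cnj \<eta> * b1 \<eta>
       + of_real (F1 r) * b1' \<eta> + of_real (F2 r) * \<eta> * (a1' \<eta> + cnj \<eta> * b1' \<eta>))"
        unfolding k_def \<rho>(3) hz(1) a1_def b1_def a1'_def b1'_def by linarith
    qed
    then show "- (G1 (r0 + s) + s * G2 (r0 + s)) = lam * (F1 (r0 + s) + s * F2 (r0 + s))
       + ((F2 (r0 + s) + s * F3 (r0 + s)) * (A + s * B) + (2 * s * F2 (r0 + s) + F1 (r0 + s)) * B)"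
      unfolding k_def \<rho>(3) A_def[symmetric] B_def[symmetric] r_def by linarith
  qed (use e inJ F1 F2 G2 in auto)
  have J: "x \<in> radii M" if "r0 < x" "x < r0 + e\<^sup>2" for x using inJ[of "x - r0"] that by simp
  show ?thesis
  proof (rule power_series_ode_constant_term[where R = "r0 + e\<^sup>2" and r = r0 and ?F1.0 = F1 and ?F2.0 = F2 and ?F3.0 = F3
        and m = m and ?D1.0 = D1 and lam = lam and A = A and B = B])
    show "summable (\<lambda>k. a k * x ^ k)" if x: "0 \<le> x" "x < r0 + e\<^sup>2" for x
    proof -
      define y where "y = (max x r0 + (r0 + e\<^sup>2)) / 2"
      have e2: "0 < e\<^sup>2" using e by simp
      have y: "r0 < y" "y < r0 + e\<^sup>2" "x < y" using x e2 r0 by (auto simp: y_def max_def)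
      show ?thesis
        by (rule powser_inside[OF sums_summable[OF a(2)[OF J[OF y(1,2)]]]]) (use x y in auto)
    qed
    show "F1 x = (\<Sum>k. a k * x ^ k)" if "r0 < x" "x < r0 + e\<^sup>2" for x
      using a(2)[OF J[OF that]] by (simp add: sums_iff)
    show "((\<lambda>x. F1 x ^ m * (F1 x + F2 x * x)) has_real_derivative D1 x) (at x)" if "r0 < x" "x < r0 + e\<^sup>2" for x
      using D1[OF J[OF that]] by (simp add: D_def[abs_def])
    show "F1 x ^ m * (F1 x + F2 x * x) \<noteq> 0" if "r0 < x" "x < r0 + e\<^sup>2" for x
      using Dpos[OF J[OF that]] unfolding D_def by (rule less_imp_neq[THEN not_sym])
    show "D1 x = - (lam * F1 x + F2 x * (A + (x - r0) * B) + F1 x * B) * (F1 x ^ m * (F1 x + F2 x * x))" if "r0 < x" "x < r0 + e\<^sup>2" for x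
    proof -
      have "D1 x = G1 x * D x" using Dpos[OF J[OF that]] by (simp add: G1_def)
      also have "G1 x = - (lam * F1 x + F2 x * (A + (x - r0) * B) + F1 x * B)" using ode[of "x - r0"] that by simp
      finally show ?thesis by (simp add: D_def)
    qed
  qed (use r0 e F1 F2 J in auto)
qed

subsection \<open>Radial Kaehler metrics on balls\<close>

lemma C_k_on_cong:
  assumes "open U" "\<And>x. x \<in> U \<Longrightarrow> f x = g x"
  shows "C_k_on k U f \<longleftrightarrow> C_k_on k U g"
  using assms(2)
proof (induction k arbitrary: f g)
  case 0
  then show ?case by (auto intro: continuous_on_cong)
next
  case (Suc k)
  have der: "(f has_derivative D) (at x) \<longleftrightarrow> (g has_derivative D) (at x)" if "x \<in> U" for x D
    using has_derivative_transform_within_open[OF _ assms(1) that, of f D UNIV g]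
      has_derivative_transform_within_open[OF _ assms(1) that, of g D UNIV f] Suc.prems by auto
  have "frechet_derivative f (at x) = frechet_derivative g (at x)" if "x \<in> U" for x
    using der[OF that] by (simp add: frechet_derivative_def)
  then have "C_k_on k U (\<lambda>x. frechet_derivative f (at x) v) \<longleftrightarrow> C_k_on k U (\<lambda>x. frechet_derivative g (at x) v)" for v
    by (intro Suc.IH) simp
  moreover have "f differentiable (at x) \<longleftrightarrow> g differentiable (at x)" if "x \<in> U" for x
    using der[OF that] by (simp add: differentiable_def)
  ultimately show ?case by simp
qed

lemma C_k_on_SucI:
  assumes "open U" "\<And>x. x \<in> U \<Longrightarrow> (f has_derivative D x) (at x)" "\<And>v. C_k_on k U (\<lambda>x. D x v)"
  shows "C_k_on (Suc k) U f"
proof -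
  have "frechet_derivative f (at x) = D x" if "x \<in> U" for x
    using frechet_derivative_at[OF assms(2)[OF that]] by simp
  then have "C_k_on k U (\<lambda>x. frechet_derivative f (at x) v)" for v
    using assms(3)[of v] by (subst C_k_on_cong[OF assms(1)]) auto
  moreover have "f differentiable (at x)" if "x \<in> U" for x
    using assms(2)[OF that] by (auto simp: differentiable_def)
  ultimately show ?thesis by simp
qed

lemma C_k_on_SucD:
  assumes "C_k_on (Suc k) U f" "x \<in> U"
  shows "(f has_derivative frechet_derivative f (at x)) (at x)"
  using assms by (simp add: frechet_derivative_works)

lemma C_k_on_Suc_imp: "C_k_on (Suc k) U f \<Longrightarrow> C_k_on k U f"
proof (induction k arbitrary: f)
  case 0
  then show ?case
    by (auto intro!: continuous_at_imp_continuous_on differentiable_imp_continuous_within)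
next
  case (Suc k)
  from Suc.prems have "\<forall>x\<in>U. f differentiable (at x)"
    and c: "\<And>v. C_k_on (Suc k) U (\<lambda>x. frechet_derivative f (at x) v)" by (simp_all del: C_k_on.simps add: C_k_on.simps(2)[of "Suc k"])
  moreover have "C_k_on k U (\<lambda>x. frechet_derivative f (at x) v)" for v by (rule Suc.IH[OF c])
  ultimately show ?case by simp
qed

lemma C_k_on_const: "C_k_on k U (\<lambda>x. c)"
  by (induction k arbitrary: c) (simp_all add: frechet_derivative_const)

lemma C_k_on_add:
  assumes "open U" "C_k_on k U f" "C_k_on k U g"
  shows "C_k_on k U (\<lambda>x. f x + g x)"
  using assms(2,3)
proof (induction k arbitrary: f g)
  case 0
  then show ?case by (auto intro: continuous_on_add)
next
  case (Suc k)
  show ?case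
  proof (rule C_k_on_SucI[OF assms(1)])
    show "((\<lambda>x. f x + g x) has_derivative (\<lambda>v. frechet_derivative f (at x) v + frechet_derivative g (at x) v)) (at x)"
      if "x \<in> U" for x
      by (intro has_derivative_add C_k_on_SucD[OF Suc.prems(1) that] C_k_on_SucD[OF Suc.prems(2) that])
    show "C_k_on k U (\<lambda>x. frechet_derivative f (at x) v + frechet_derivative g (at x) v)" for v
      by (rule Suc.IH) (use Suc.prems in auto)
  qed
qed

lemma C_k_on_bilinear:
  assumes "open U" "bounded_bilinear B" "C_k_on k U f" "C_k_on k U g"
  shows "C_k_on k U (\<lambda>x. B (f x) (g x))"
  using assms(3,4)
proof (induction k arbitrary: f g)
  case 0
  then show ?case using bounded_bilinear.continuous_on[OF assms(2)] by auto
next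
  case (Suc k)
  show ?case
  proof (rule C_k_on_SucI[OF assms(1)])
    show "((\<lambda>x. B (f x) (g x)) has_derivative (\<lambda>v. B (f x) (frechet_derivative g (at x) v) + B (frechet_derivative f (at x) v) (g x))) (at x)"
      if "x \<in> U" for x
      by (intro bounded_bilinear.FDERIV[OF assms(2)] C_k_on_SucD[OF Suc.prems(1) that] C_k_on_SucD[OF Suc.prems(2) that])
    show "C_k_on k U (\<lambda>x. B (f x) (frechet_derivative g (at x) v) + B (frechet_derivative f (at x) v) (g x))" for v
      by (intro C_k_on_add assms(1) Suc.IH C_k_on_Suc_imp[OF Suc.prems(1)] C_k_on_Suc_imp[OF Suc.prems(2)])
         (use Suc.prems in auto)
  qed
qed

lemma C_k_on_linear:
  assumes "open U" "bounded_linear f"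
  shows "C_k_on k U f"
proof (cases k)
  case 0
  then show ?thesis using linear_continuous_on[OF assms(2)] by simp
next
  case (Suc j)
  show ?thesis
    unfolding Suc by (rule C_k_on_SucI[OF assms(1) bounded_linear_imp_has_derivative[OF assms(2)] C_k_on_const])
qed

lemma C_k_on_real_derivatives:
  fixes S :: "nat \<Rightarrow> real \<Rightarrow> real"
  assumes "open U" "\<And>i x. x \<in> U \<Longrightarrow> (S i has_real_derivative S (Suc i) x) (at x)"
  shows "C_k_on k U (S i)"
proof (induction k arbitrary: i)
  case 0
  show ?case using assms(2)[of _ i] by (auto intro!: continuous_at_imp_continuous_on DERIV_isCont)
next
  case (Suc k)
  show ?case
  proof (rule C_k_on_SucI[OF assms(1)])
    show "(S i has_derivative (\<lambda>v. S (Suc i) x * v)) (at x)" if "x \<in> U" for x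
      using assms(2)[OF that] by (simp add: has_field_derivative_def)
    show "C_k_on k U (\<lambda>x. S (Suc i) x * v)" for v
      by (rule C_k_on_bilinear[OF assms(1) bounded_bilinear_mult Suc.IH C_k_on_const])
  qed
qed

text \<open>The derivative of the squared norm at \<open>z\<close> in direction \<open>t\<close> is
  \<open>2 * Re (hinner t z)\<close>, which is real linear in \<open>z\<close>; this closes the
  induction along the sequence of derivatives.\<close>

lemma C_k_on_radial:
  fixes S :: "nat \<Rightarrow> real \<Rightarrow> real" and U :: "(complex^'n) set"
  assumes "open U" "\<And>i z. z \<in> U \<Longrightarrow> (S i has_real_derivative S (Suc i) ((norm z)\<^sup>2)) (at ((norm z)\<^sup>2))"
  shows "C_k_on k U (\<lambda>z. S i ((norm z)\<^sup>2))"
proof (induction k arbitrary: i)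
  case 0
  have "((\<lambda>z. S i ((norm z)\<^sup>2)) has_derivative (\<lambda>t. S (Suc i) ((norm z)\<^sup>2) * (2 * Re (hinner t z)))) (at z)" if "z \<in> U" for z
    using has_derivative_compose[OF norm_power2_has_derivative assms(2)[OF that, unfolded has_field_derivative_def]] .
  then show ?case
    by (auto intro!: continuous_at_imp_continuous_on dest: has_derivative_continuous)
next
  case (Suc k)
  show ?case
  proof (rule C_k_on_SucI[OF assms(1)])
    show "((\<lambda>z. S i ((norm z)\<^sup>2)) has_derivative (\<lambda>t. S (Suc i) ((norm z)\<^sup>2) * (2 * Re (hinner t z)))) (at z)" if "z \<in> U" for z
      using has_derivative_compose[OF norm_power2_has_derivative assms(2)[OF that, unfolded has_field_derivative_def]] .
    have "bounded_linear (\<lambda>z. 2 * Re (hinner t z))" for t :: "complex^'n"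
      by (intro bounded_linear_const_mult bounded_linear_compose[OF bounded_linear_Re bounded_linear_hinner_right])
    then show "C_k_on k U (\<lambda>z. S (Suc i) ((norm z)\<^sup>2) * (2 * Re (hinner t z)))" for t
      by (intro C_k_on_bilinear[OF assms(1) bounded_bilinear_mult Suc.IH] C_k_on_linear assms(1))
  qed
qed

lemma bounded_bilinear_outer:
  "bounded_bilinear (\<lambda>z w :: complex^'n. (\<chi> i j. cnj (z $ i) * w $ j) :: complex^'n^'n)"
  unfolding bilinear_conv_bounded_bilinear[symmetric] bilinear_def
  by (auto intro!: linearI simp: vec_eq_iff algebra_simps)

lemma smooth_on_radial_matrix:
  fixes S :: "nat \<Rightarrow> real \<Rightarrow> real" and U :: "(complex^'n) set"
  assumes U: "open U" and S: "\<And>i z. z \<in> U \<Longrightarrow> (S i has_real_derivative S (Suc i) ((norm z)\<^sup>2)) (at ((norm z)\<^sup>2))"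
  shows "smooth_on U (\<lambda>z. radial_matrix (S i ((norm z)\<^sup>2)) (S j ((norm z)\<^sup>2)) z)"
  unfolding smooth_on_def
proof
  fix k
  have eq: "radial_matrix a b z = a *\<^sub>R mat 1 + b *\<^sub>R (\<chi> i j. cnj (z $ i) * z $ j)" for a b and z :: "complex^'n"
    by (simp add: radial_matrix_def mat_def vec_eq_iff scaleR_conv_of_real[where 'a = complex])
  show "C_k_on k U (\<lambda>z. radial_matrix (S i ((norm z)\<^sup>2)) (S j ((norm z)\<^sup>2)) z)"
    unfolding eq
    by (intro C_k_on_add U C_k_on_bilinear[OF U bounded_bilinear_scaleR] C_k_on_const C_k_on_radial S
        C_k_on_bilinear[OF U bounded_bilinear_outer] C_k_on_linear bounded_linear_ident)
qed

lemma closed_form2_radial_matrix: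
  fixes U :: "(complex^'n) set"
  assumes U: "open U" and H: "\<And>z. z \<in> U \<Longrightarrow> H z = radial_matrix (F1 ((norm z)\<^sup>2)) (F2 ((norm z)\<^sup>2)) z"
    and F1: "\<And>z. z \<in> U \<Longrightarrow> (F1 has_real_derivative F2 ((norm z)\<^sup>2)) (at ((norm z)\<^sup>2))"
    and F2: "\<And>z. z \<in> U \<Longrightarrow> (F2 has_real_derivative F3 ((norm z)\<^sup>2)) (at ((norm z)\<^sup>2))"
  shows "closed_form2 U (\<lambda>z. form11 (H z))"
  unfolding closed_form2_def
proof (intro ballI allI)
  fix z u v t assume z: "z \<in> U"
  define a b c where "a = complex_of_real (F1 ((norm z)\<^sup>2))" and "b = complex_of_real (F2 ((norm z)\<^sup>2))" and "c = complex_of_real (F3 ((norm z)\<^sup>2))"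
  have fd: "frechet_derivative (\<lambda>x. form11 (H x) u v) (at z) t = \<i> / 2 *
     (b * (hinner t z + hinner z t) * (hinner u v - hinner v u)
      + c * (hinner t z + hinner z t) * (hinner u z * hinner z v - hinner v z * hinner z u)
      + b * (hinner u t * hinner z v + hinner u z * hinner t v - hinner v t * hinner z u - hinner v z * hinner t u))" for u v t
  proof -
    have nd: "((\<lambda>x. (norm x)\<^sup>2) has_derivative (\<lambda>t. 2 * Re (hinner t z))) (at z)" by (rule norm_power2_has_derivative)
    have f1: "((\<lambda>x. F1 ((norm x)\<^sup>2)) has_derivative (\<lambda>t. F2 ((norm z)\<^sup>2) * (2 * Re (hinner t z)))) (at z)"
      by (rule has_derivative_compose[OF nd F1[OF z, unfolded has_field_derivative_def]])
    have f2: "((\<lambda>x. F2 ((norm x)\<^sup>2)) has_derivative (\<lambda>t. F3 ((norm z)\<^sup>2) * (2 * Re (hinner t z)))) (at z)"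
      by (rule has_derivative_compose[OF nd F2[OF z, unfolded has_field_derivative_def]])
    have q: "((\<lambda>x. hinner u x * hinner x v) has_derivative (\<lambda>t. hinner u z * hinner t v + hinner u t * hinner z v)) (at z)" for u v
      by (intro has_derivative_mult bounded_linear.has_derivative[OF bounded_linear_hinner_left]
          bounded_linear.has_derivative[OF bounded_linear_hinner_right] has_derivative_ident)
    have "((\<lambda>x. \<i> / 2 * (of_real (F1 ((norm x)\<^sup>2)) * (hinner u v - hinner v u) + of_real (F2 ((norm x)\<^sup>2)) * (hinner u x * hinner x v - hinner v x * hinner x u))) has_derivative
      (\<lambda>t. \<i> / 2 * (of_real (F2 ((norm z)\<^sup>2) * (2 * Re (hinner t z))) * (hinner u v - hinner v u)
         + (of_real (F2 ((norm z)\<^sup>2)) * ((hinner u z * hinner t v + hinner u t * hinner z v) - (hinner v z * hinner t u + hinner v t * hinner z u))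
         + of_real (F3 ((norm z)\<^sup>2) * (2 * Re (hinner t z))) * (hinner u z * hinner z v - hinner v z * hinner z u))))) (at z)"
      by (intro has_derivative_mult_right has_derivative_add has_derivative_mult_left has_derivative_mult has_derivative_of_real has_derivative_diff f1 f2 q)
    then have "((\<lambda>x. form11 (H x) u v) has_derivative
      (\<lambda>t. \<i> / 2 * (of_real (F2 ((norm z)\<^sup>2) * (2 * Re (hinner t z))) * (hinner u v - hinner v u)
         + (of_real (F2 ((norm z)\<^sup>2)) * ((hinner u z * hinner t v + hinner u t * hinner z v) - (hinner v z * hinner t u + hinner v t * hinner z u))
         + of_real (F3 ((norm z)\<^sup>2) * (2 * Re (hinner t z))) * (hinner u z * hinner z v - hinner v z * hinner z u))))) (at z)"
    proof (rule has_derivative_transform_within_open[OF _ U z])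
      fix x assume "x \<in> U"
      then show "\<i> / 2 * (of_real (F1 ((norm x)\<^sup>2)) * (hinner u v - hinner v u) + of_real (F2 ((norm x)\<^sup>2)) * (hinner u x * hinner x v - hinner v x * hinner x u)) = form11 (H x) u v"
        by (simp add: form11_herm H herm_radial_matrix algebra_simps)
    qed
    from frechet_derivative_at[OF this, symmetric]
    have "frechet_derivative (\<lambda>x. form11 (H x) u v) (at z) t = \<i> / 2 * (of_real (F2 ((norm z)\<^sup>2) * (2 * Re (hinner t z))) * (hinner u v - hinner v u)
         + (of_real (F2 ((norm z)\<^sup>2)) * ((hinner u z * hinner t v + hinner u t * hinner z v) - (hinner v z * hinner t u + hinner v t * hinner z u))
         + of_real (F3 ((norm z)\<^sup>2) * (2 * Re (hinner t z))) * (hinner u z * hinner z v - hinner v z * hinner z u)))" by simp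
    moreover have cr: "complex_of_real (x * (2 * Re (hinner t z))) = of_real x * (hinner t z + hinner z t)" for x
      unfolding hinner_commute[of z t] complex_add_cnj by simp
    ultimately show ?thesis
      unfolding cr a_def[symmetric] b_def[symmetric] c_def[symmetric] by (simp add: algebra_simps)
  qed
  show "frechet_derivative (\<lambda>x. form11 (H x) v t) (at z) u
     + frechet_derivative (\<lambda>x. form11 (H x) t u) (at z) v
     + frechet_derivative (\<lambda>x. form11 (H x) u v) (at z) t = 0"
    unfolding fd by (simp add: algebra_simps)
qed

text \<open>\<open>S\<close> lists the successive derivatives of the potential, starting with the
  potential itself. Since \<open>S 2\<close> is nonnegative, the metric on \<open>u\<close> is at
  least \<open>S 1\<close> times the squared norm of \<open>u\<close>, at the origin as
  well.\<close>

lemma kaehler_metric_radial: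
  fixes S :: "nat \<Rightarrow> real \<Rightarrow> real" and U :: "(complex^'n) set"
  assumes U: "open U" and S: "\<And>i z. z \<in> U \<Longrightarrow> (S i has_real_derivative S (Suc i) ((norm z)\<^sup>2)) (at ((norm z)\<^sup>2))"
    and H: "\<And>z. z \<in> U \<Longrightarrow> H z = radial_matrix (S 1 ((norm z)\<^sup>2)) (S 2 ((norm z)\<^sup>2)) z"
    and pos: "\<And>z. z \<in> U \<Longrightarrow> 0 < S 1 ((norm z)\<^sup>2)" "\<And>z. z \<in> U \<Longrightarrow> 0 \<le> S 2 ((norm z)\<^sup>2)"
  shows "kaehler_metric U H"
  unfolding kaehler_metric_def
proof (intro conjI ballI allI impI)
  have "smooth_on U (\<lambda>z. radial_matrix (S 1 ((norm z)\<^sup>2)) (S 2 ((norm z)\<^sup>2)) z)"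
    by (rule smooth_on_radial_matrix[where S = S, OF U]) (rule S)
  then show "smooth_on U H" using C_k_on_cong[OF U H] by (simp add: smooth_on_def)
  show "H z $ i $ j = cnj (H z $ j $ i)" if "z \<in> U" for z i j
    by (simp add: H[OF that] radial_matrix_def)
  show "0 < Re (\<Sum>i\<in>UNIV. \<Sum>j\<in>UNIV. H z $ i $ j * (u $ i * cnj (u $ j)))" if z: "z \<in> U" and u: "u \<noteq> 0" for z u
  proof -
    have "(\<Sum>i\<in>UNIV. \<Sum>j\<in>UNIV. H z $ i $ j * (u $ i * cnj (u $ j))) = herm (H z) u u" by (simp add: herm_def)
    also have "\<dots> = of_real (S 1 ((norm z)\<^sup>2) * (norm u)\<^sup>2 + S 2 ((norm z)\<^sup>2) * (cmod (hinner u z))\<^sup>2)"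
      unfolding H[OF z] herm_radial_matrix hinner_self hinner_commute[of z u] complex_norm_square[symmetric] by simp
    finally show ?thesis
      using pos[OF z] u by (simp add: add_pos_nonneg)
  qed
  show "closed_form2 U (\<lambda>z. form11 (H z))"
    by (rule closed_form2_radial_matrix[where ?F1.0 = "S 1" and ?F2.0 = "S 2" and ?F3.0 = "S 3", OF U H]) (use S[of _ 1] S[of _ 2] in \<open>auto simp: numeral_eq_Suc\<close>)
qed

subsection \<open>Real-analytic continuation of the potential\<close>

lemma summable_of_summable_diffs:
  fixes c :: "nat \<Rightarrow> real"
  assumes "\<And>x. 0 \<le> x \<Longrightarrow> x < r \<Longrightarrow> summable (\<lambda>k. diffs c k * x ^ k)" and x: "norm x < r"
  shows "summable (\<lambda>k. c k * x ^ k)"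
proof -
  define y where "y = (norm x + r) / 2"
  have y: "norm x < y" "y < r" "0 \<le> y" using x by (auto simp: y_def)
  have "summable (\<lambda>k. diffs c k * y ^ k)" using assms(1) y by blast
  then have "summable (\<lambda>k. norm (diffs c k * x ^ k))" by (rule powser_insidea) (use y in auto)
  then have "summable (\<lambda>k. norm x * norm (diffs c k * x ^ k))" by (rule summable_mult)
  then have "summable (\<lambda>k. c (Suc k) * x ^ Suc k)"
  proof (rule summable_comparison_test'[of _ 0])
    fix k :: nat
    have "1 * norm (c (Suc k)) \<le> real (Suc k) * norm (c (Suc k))" by (rule mult_right_mono) auto
    then have "norm (c (Suc k)) \<le> norm (diffs c k)" by (simp add: diffs_def abs_mult)
    then have "norm (c (Suc k)) * norm (x ^ Suc k) \<le> norm (diffs c k) * norm (x ^ Suc k)" by (rule mult_right_mono) simp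
    then show "norm (c (Suc k) * x ^ Suc k) \<le> norm x * norm (diffs c k * x ^ k)"
      by (simp add: abs_mult mult_ac)
  qed
  then show ?thesis by (subst (asm) summable_Suc_iff)
qed

text \<open>Both series live on the same complex disc, where agreement on a short real interval
  spreads by the identity theorem.\<close>

lemma real_analytic_eq_near:
  fixes f g :: "real \<Rightarrow> real"
  assumes e: "0 < e" and f: "\<And>y. \<bar>y - x\<bar> < e \<Longrightarrow> (\<lambda>k. a k * (y - x) ^ k) sums f y"
    and g: "\<And>y. \<bar>y - x\<bar> < e \<Longrightarrow> (\<lambda>k. b k * (y - x) ^ k) sums g y"
    and y: "\<bar>y - x\<bar> < e" "\<forall>\<^sub>F t in nhds y. f t = g t" and t: "\<bar>t - x\<bar> < e"
  shows "f t = g t"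
proof -
  define A where "A c w = (\<Sum>k. complex_of_real (c k) * (w - of_real x) ^ k)" for c w
  have real: "A c (of_real u) = of_real (h u) \<and> A c holomorphic_on ball (of_real x) e"
    if h: "\<And>y. \<bar>y - x\<bar> < e \<Longrightarrow> (\<lambda>k. c k * (y - x) ^ k) sums h y" and u: "\<bar>u - x\<bar> < e" for c h u
  proof
    have "(\<lambda>k. complex_of_real (c k * (u - x) ^ k)) sums of_real (h u)"
      using h[OF u] by (simp only: sums_of_real_iff)
    then show "A c (of_real u) = of_real (h u)" by (simp add: A_def sums_iff)
    show "A c holomorphic_on ball (of_real x) e"
      unfolding A_def
    proof (rule power_series_holomorphic_real)
      fix s :: real assume "0 \<le> s" "s < e"
      then show "summable (\<lambda>k. c k * s ^ k)" using sums_summable[OF h[of "x + s"]] by simp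
    qed
  qed
  obtain d where d: "d > 0" "\<And>s. \<bar>s - y\<bar> < d \<Longrightarrow> f s = g s"
    using y(2) unfolding eventually_nhds_metric dist_real_def by blast
  define d' where "d' = min d (e - \<bar>y - x\<bar>)"
  have d': "0 < d'" "d' \<le> d" "d' \<le> e - \<bar>y - x\<bar>" using d y by (auto simp: d'_def)
  have "A a (of_real t) = A b (of_real t)"
  proof (rule holomorphic_eq_if_eq_on_reals[of "A a" "ball (of_real x) e" "A b" y "y + d'"])
    show "A a holomorphic_on ball (of_real x) e" "A b holomorphic_on ball (of_real x) e"
      using real[OF f t] real[OF g t] by auto
    show "complex_of_real s \<in> ball (of_real x) e" "A a (of_real s) = A b (of_real s)" if "y < s" "s < y + d'" for s
    proof -
      have s: "\<bar>s - x\<bar> < e" "\<bar>s - y\<bar> < d" using that d' by auto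
      show "complex_of_real s \<in> ball (of_real x) e"
        unfolding mem_ball dist_of_real dist_real_def using s by linarith
      show "A a (of_real s) = A b (of_real s)"
        using real[OF f s(1)] real[OF g s(1)] d(2)[OF s(2)] by simp
    qed
    show "complex_of_real t \<in> ball (of_real x) e"
      unfolding mem_ball dist_of_real dist_real_def using t by linarith
  qed (use d' in auto)
  then show ?thesis using real[OF f t] real[OF g t] by simp
qed

text \<open>Agreement near a point is a locally constant property of the point, hence constant on
  the connected set \<open>S\<close>.\<close>

lemma real_analytic_on_identity:
  assumes S: "connected S" and f: "real_analytic_on S f" and g: "real_analytic_on S g"
    and x: "x \<in> S" "\<forall>\<^sub>F t in nhds x. f t = g t" and y: "y \<in> S"
  shows "f y = g y"
proof -
  have "\<exists>e>0. \<forall>y. \<bar>y - x\<bar> < e \<longrightarrow> (\<forall>\<^sub>F t in nhds x. f t = g t) = (\<forall>\<^sub>F t in nhds y. f t = g t)" if x: "x \<in> S" for x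
  proof -
    obtain e1 a where e1: "e1 > 0" "\<And>y. \<bar>y - x\<bar> < e1 \<Longrightarrow> (\<lambda>k. a k * (y - x) ^ k) sums f y"
      using f x unfolding real_analytic_on_def by blast
    obtain e2 b where e2: "e2 > 0" "\<And>y. \<bar>y - x\<bar> < e2 \<Longrightarrow> (\<lambda>k. b k * (y - x) ^ k) sums g y"
      using g x unfolding real_analytic_on_def by blast
    define e where "e = min e1 e2"
    have e: "0 < e" using e1 e2 by (simp add: e_def)
    have all: "\<forall>\<^sub>F t in nhds z. f t = g t" if y: "\<bar>y - x\<bar> < e" "\<forall>\<^sub>F t in nhds y. f t = g t" and z: "\<bar>z - x\<bar> < e" for y z
    proof (rule eventually_mono[OF eventually_nhds_in_open[of "{x - e<..<x + e}"]])
      show "f t = g t" if "t \<in> {x - e<..<x + e}" for t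
        by (rule real_analytic_eq_near[OF e _ _ y, where a = a and b = b]) (use e1 e2 that in \<open>auto simp: e_def\<close>)
    qed (use z in auto)
    have x0: "\<bar>x - x\<bar> < e" using e by simp
    show ?thesis
    proof (intro exI conjI allI impI)
      fix y assume y: "\<bar>y - x\<bar> < e"
      show "(\<forall>\<^sub>F t in nhds x. f t = g t) = (\<forall>\<^sub>F t in nhds y. f t = g t)"
        using all[OF x0 _ y] all[OF y _ x0] by (rule iffI)
    qed (rule e)
  qed
  then have "\<forall>a\<in>S. \<forall>\<^sub>F b in at a within S. (\<forall>\<^sub>F t in nhds a. f t = g t) = (\<forall>\<^sub>F t in nhds b. f t = g t)"
    unfolding eventually_at dist_real_def by blast
  from connected_local_const[OF S x(1) y this] x(2) have "\<forall>\<^sub>F t in nhds y. f t = g t" by blast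
  then show ?thesis by (rule eventually_nhds_x_imp_x)
qed

lemma real_analytic_on_subset: "real_analytic_on S f \<Longrightarrow> T \<subseteq> S \<Longrightarrow> real_analytic_on T f"
  by (auto simp: real_analytic_on_def)

lemma open_radial_interval: "open (radial_interval a b)"
proof -
  have "radial_interval a b = {a<..} \<inter> ereal -` {..<b}" by (auto simp: radial_interval_def)
  moreover have "open (ereal -` {..<b})" by (intro open_vimage continuous_on_ereal continuous_on_id) auto
  ultimately show ?thesis by auto
qed

lemma connected_radial_interval: "connected (radial_interval a b)"
proof (rule convex_connected, subst is_interval_convex_1[symmetric], unfold is_interval_1, intro ballI allI impI)
  fix x y z assume "x \<in> radial_interval a b" "y \<in> radial_interval a b" "x \<le> z \<and> z \<le> y"
  then show "z \<in> radial_interval a b"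
    by (auto simp: radial_interval_def intro: le_less_trans[of "ereal z" "ereal y"])
qed

definition iter_deriv :: "(nat \<Rightarrow> real) \<Rightarrow> nat \<Rightarrow> real \<Rightarrow> real" where
  "iter_deriv c i x = (\<Sum>k. (diffs ^^ i) c k * x ^ k)"

context
  fixes c :: "nat \<Rightarrow> real" and F :: "real \<Rightarrow> real" and R :: ereal
  assumes sm: "\<And>x. ereal (norm x) < R \<Longrightarrow> summable (\<lambda>k. c k * x ^ k)"
    and F: "\<And>x. F x = (\<Sum>k. c k * x ^ k)"
begin

lemma iter_deriv_0: "iter_deriv c 0 = F"
  by (auto simp: iter_deriv_def F)

lemma ex_real_radius:
  assumes "ereal (norm x) < R"
  obtains r where "norm x < r" "ereal r < R"
  using ereal_dense2[OF assms] by auto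

lemma summable_inside:
  assumes "norm x < r" "ereal r < R"
  shows "summable (\<lambda>k. c k * x ^ k)"
proof (rule sm)
  have "ereal (norm x) < ereal r" using assms(1) by simp
  then show "ereal (norm x) < R" using assms(2) by (rule less_trans)
qed

lemma iter_deriv_has_derivative:
  assumes "ereal (norm x) < R"
  shows "(iter_deriv c i has_real_derivative iter_deriv c (Suc i) x) (at x)"
proof -
  obtain r where r: "norm x < r" "ereal r < R" by (rule ex_real_radius[OF assms])
  have "summable (\<lambda>k. (diffs ^^ i) c k * z ^ k)" if "norm z < r" for z
    by (rule summable_diffs_funpow[where r = r]) (use summable_inside[OF _ r(2)] that in blast)+
  from termdiffs_strong'[OF this r(1)] show ?thesis by (simp add: iter_deriv_def[abs_def])
qed

lemma real_analytic_power_series: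
  assumes "\<And>x. x \<in> S \<Longrightarrow> ereal (norm x) < R"
  shows "real_analytic_on S F"
  unfolding real_analytic_on_def
proof
  fix x assume "x \<in> S"
  then have "ereal (norm x) < R" by (rule assms)
  then obtain r where r: "norm x < r" "ereal r < R" by (rule ex_real_radius)
  have smr: "summable (\<lambda>k. c k * x ^ k)" if "norm x < r" for x
    by (rule summable_inside[OF that r(2)])
  define G where "G w = (\<Sum>k. complex_of_real (c k) * w ^ k)" for w
  have G: "G holomorphic_on ball 0 r"
    using power_series_holomorphic_real[of r c 0] smr by (simp add: G_def[abs_def])
  have GR: "G (of_real y) = of_real (F y)" if "norm y < r" for y
  proof -
    have "(\<lambda>k. complex_of_real (c k * y ^ k)) sums of_real (F y)"
      using smr[OF that] by (subst sums_of_real_iff) (simp add: F summable_sums)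
    then show ?thesis by (simp add: G_def sums_iff)
  qed
  define e where "e = r - norm x"
  have sub: "ball (complex_of_real x) e \<subseteq> ball 0 r"
  proof
    fix w assume "w \<in> ball (complex_of_real x) e"
    then have "norm (w - of_real x) < e" by (simp add: dist_norm norm_minus_commute)
    then show "w \<in> ball 0 r" using norm_triangle_sub[of w "of_real x"] by (simp add: e_def)
  qed
  show "\<exists>e>0. \<exists>a. \<forall>y. \<bar>y - x\<bar> < e \<longrightarrow> (\<lambda>k. a k * (y - x) ^ k) sums F y"
  proof (intro exI conjI allI impI)
    show "0 < e" using r by (simp add: e_def)
    fix y assume y: "\<bar>y - x\<bar> < e"
    have "complex_of_real y \<in> ball (of_real x) e"
      unfolding mem_ball dist_of_real dist_real_def using y by linarith
    from holomorphic_power_series[OF holomorphic_on_subset[OF G sub] this]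
    have "(\<lambda>n. (deriv ^^ n) G (of_real x) / fact n * of_real ((y - x) ^ n)) sums G (of_real y)" by simp
    from sums_Re[OF this] have "(\<lambda>n. Re ((deriv ^^ n) G (of_real x) / fact n) * (y - x) ^ n) sums Re (G (of_real y))"
      by (simp only: times_complex.simps Re_complex_of_real Im_complex_of_real mult_zero_right diff_zero)
    moreover have "\<bar>y\<bar> < r" using y by (auto simp: e_def)
    ultimately show "(\<lambda>n. Re ((deriv ^^ n) G (of_real x) / fact n) * (y - x) ^ n) sums F y" using GR[of y] by simp
  qed
qed

end

section \<open>The potential at the origin\<close>

theorem corollary1:
  fixes M :: "(complex^'n) set"
    and H :: "complex^'n \<Rightarrow> complex^'n^'n"
    and X :: "complex^'n \<Rightarrow> complex^'n"
    and f :: "real \<Rightarrow> real"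
  assumes dim: "CARD('n) \<ge> 2"
    and manifold: "open M" "connected M" "M \<noteq> {}"
    and soliton: "kaehler_ricci_soliton M H X"
    and radial: "radial_potential M H f"
    and induced: "\<exists>c \<phi>. c \<le> 0 \<and> kaehler_immersion M H c \<phi>"
  shows "potential_defined_at_origin TYPE('n) f (radii M)"
proof -
  define J where "J = radii M"
  have Jo: "open J" and Jc: "connected J" and Jp: "\<And>r. r \<in> J \<Longrightarrow> 0 < r"
    unfolding J_def using open_radii connected_radii radii_pos manifold by blast+
  have "M \<noteq> {0}" using manifold(1) not_open_singleton by metis
  then obtain p where p: "p \<in> M" "p \<noteq> 0" using manifold(3) by blast
  define r0 where "r0 = (norm p)\<^sup>2"
  have r0: "r0 \<in> J" using p by (auto simp: J_def radii_def r0_def)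

  have "smooth_on J f" using radial by (simp add: radial_potential_def J_def)
  then obtain F1 where F1: "smooth_on J F1" "\<And>r. r \<in> J \<Longrightarrow> (f has_real_derivative F1 r) (at r)"
    by (rule smooth_on_imp_derivatives) (rule that, assumption+)
  obtain F2 where F2: "smooth_on J F2" "\<And>r. r \<in> J \<Longrightarrow> (F1 has_real_derivative F2 r) (at r)"
    by (rule smooth_on_imp_derivatives[OF F1(1)]) (rule that, assumption+)
  obtain F3 where F3: "smooth_on J F3" "\<And>r. r \<in> J \<Longrightarrow> (F2 has_real_derivative F3 r) (at r)"
    by (rule smooth_on_imp_derivatives[OF F2(1)]) (rule that, assumption+)
  obtain F4 where F4: "\<And>r. r \<in> J \<Longrightarrow> (F3 has_real_derivative F4 r) (at r)"
    by (rule smooth_on_imp_derivatives[OF F3(1)]) (rule that, assumption)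
  have H: "H z = radial_matrix (F1 ((norm z)\<^sup>2)) (F2 ((norm z)\<^sup>2)) z" if z: "z \<in> M" "z \<noteq> 0" for z
  proof -
    have zJ: "(norm z)\<^sup>2 \<in> J" using z by (auto simp: J_def radii_def)
    have "H z = ddbar (\<lambda>w. f ((norm w)\<^sup>2)) z" using radial z by (simp add: radial_potential_def)
    also have "\<dots> = radial_matrix (F1 ((norm z)\<^sup>2)) (F2 ((norm z)\<^sup>2)) z"
      by (rule ddbar_radial[OF Jo zJ F1(2) F2(2)[OF zJ]])
    finally show ?thesis .
  qed
  have kaehler: "kaehler_metric M H" using soliton by (simp add: kaehler_ricci_soliton_def)
  \<comment> \<open>The eigenvalues of the radial matrix: \<open>F1 r\<close> on vectors orthogonal
    to \<open>z\<close>, and \<open>F1 r + r * F2 r\<close> along \<open>z\<close>.\<close>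
  have pos: "0 < F1 r" "0 < F1 r + r * F2 r" if r: "r \<in> J" for r
  proof -
    obtain z where z: "z \<in> M" "z \<noteq> 0" "r = (norm z)\<^sup>2" using r by (auto simp: J_def radii_def)
    have h: "0 < Re (herm (H z) u u)" if "u \<noteq> 0" for u
      using kaehler z(1) that unfolding kaehler_metric_def herm_def by blast
    obtain v where v: "norm v = 1" "hinner v z = 0" by (rule ex_unit_orthogonal[OF dim])
    have "v \<noteq> 0" using v(1) by auto
    from h[OF this] show "0 < F1 r"
      using v by (simp add: H[OF z(1,2)] herm_radial_matrix hinner_self z(3))
    have "herm (H z) z z = of_real (r * (F1 r + r * F2 r))"
      by (simp add: H[OF z(1,2)] herm_radial_matrix hinner_self z(3) algebra_simps)
    then have "0 < r * (F1 r + r * F2 r)" using h[OF z(2)] by simp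
    then show "0 < F1 r + r * F2 r" using Jp[OF r] by (simp add: zero_less_mult_iff)
  qed
  have F2c: "continuous_on J F2" using F3(2) by (meson DERIV_continuous continuous_at_imp_continuous_on)
  obtain c' \<phi> where imm: "c' \<le> 0" "kaehler_immersion M H c' \<phi>" using induced by blast
  obtain a where a: "\<And>k. 0 \<le> a k" and "\<And>r. r \<in> radii M \<Longrightarrow> (\<lambda>k. a k * r ^ k) sums F1 r"
  proof (rule radial_immersion_power_series[OF dim manifold(1,2) _ F2(2)[unfolded J_def] F2c[unfolded J_def] H imm])
    show "radii M \<noteq> {}" using r0 by (auto simp: J_def)
  qed (assumption+, rule that, assumption+)
  note a = a this(2)[folded J_def]
  have "a 0 \<noteq> 0"
    by (rule soliton_constant_term[OF dim manifold(1) p, where ?F1.0 = F1 and ?F2.0 = F2 and ?F3.0 = F3 and ?F4.0 = F4 and H = H and X = X])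
       (use F2(2) F3(2) F4 H pos soliton a in \<open>auto simp: J_def\<close>)
  with a(1)[of 0] have a0: "0 < a 0" by simp

  \<comment> \<open>A termwise antiderivative of the series of \<open>F1\<close>. The constant term
    makes it agree with \<open>f\<close> at \<open>r0\<close>, and then on all of \<open>J\<close>,
    where both have the derivative \<open>F1\<close>.\<close>
  define c where "c k = (case k of 0 \<Rightarrow> f r0 - (\<Sum>j. a j / real (Suc j) * r0 ^ Suc j) | Suc j \<Rightarrow> a j / real (Suc j))" for k
  have dc: "diffs c = a" by (simp add: diffs_def c_def fun_eq_iff)
  have cS: "c (Suc k) = a k / real (Suc k)" for k by (simp add: c_def)
  define R where "R = conv_radius a"
  have ma: "summable (\<lambda>k. a k * x ^ k)" if "ereal (norm x) < R" for x
    using summable_in_conv_radius[of x a] that by (simp add: R_def)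
  have sm: "summable (\<lambda>k. c k * x ^ k)" if x: "ereal (norm x) < R" for x
  proof -
    obtain r where r: "norm x < r" "ereal r < R" using ereal_dense2[OF x] by auto
    show ?thesis
    proof (rule summable_of_summable_diffs[OF _ r(1)])
      fix y assume "0 \<le> y" "y < r"
      then show "summable (\<lambda>k. diffs c k * y ^ k)"
        unfolding dc using r(2) by (intro ma) (auto intro: less_trans[of "ereal y" "ereal r"])
    qed
  qed
  define F where "F x = (\<Sum>k. c k * x ^ k)" for x
  have head: "F x = c 0 + (\<Sum>k. c (Suc k) * x ^ Suc k)" if "ereal (norm x) < R" for x
    using suminf_split_head[OF sm[OF that]] by (simp add: F_def)
  note series = sm F_def
  have der: "(iter_deriv c i has_real_derivative iter_deriv c (Suc i) x) (at x)" if "ereal (norm x) < R" for i x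
    by (rule iter_deriv_has_derivative[of R c F, OF series that])
  have S0: "iter_deriv c 0 = F" by (rule iter_deriv_0[of R c F, OF series])
  have S1: "iter_deriv c 1 x = (\<Sum>k. a k * x ^ k)" for x by (simp add: iter_deriv_def dc)
  \<comment> \<open>The inequality is strict because \<open>J\<close> is open: the series also
    converges at a slightly larger radius.\<close>
  have JR: "ereal r < R" if r: "r \<in> J" for r
  proof -
    obtain d where d: "d > 0" "ball r d \<subseteq> J" using Jo r openE by blast
    have "r + d / 2 \<in> J" using d by (intro subsetD[OF d(2)]) (simp add: dist_real_def)
    from sums_summable[OF a(2)[OF this]] have "ereal (norm (r + d / 2)) \<le> R"
      unfolding R_def by (rule conv_radius_geI)
    moreover have "ereal r < ereal (norm (r + d / 2))" using Jp[OF r] d(1) by simp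
    ultimately show ?thesis by (rule less_le_trans[rotated])
  qed
  have JR': "ereal (norm r) < R" if "r \<in> J" for r using JR[OF that] Jp[OF that] by simp
  have Ff: "F r = f r" if r: "r \<in> J" for r
  proof -
    have "\<exists>C. \<forall>x\<in>J. F x - f x = C"
    proof (rule has_field_derivative_zero_constant)
      show "convex J" using Jc by (simp add: is_interval_convex_1[symmetric] is_interval_connected_1)
      fix x assume x: "x \<in> J"
      have "iter_deriv c 1 x = F1 x" unfolding S1 using a(2)[OF x] by (simp add: sums_iff)
      then have "(F has_real_derivative F1 x) (at x)"
        using der[OF JR'[OF x], of 0] by (simp add: S0)
      from DERIV_diff[OF this F1(2)[OF x]]
      show "((\<lambda>x. F x - f x) has_real_derivative 0) (at x within J)"
        by (simp add: has_field_derivative_at_within)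
    qed
    then have "F r - f r = F r0 - f r0" using r r0 by metis
    moreover have "F r0 = f r0" using head[OF JR'[OF r0]] unfolding cS by (simp add: c_def)
    ultimately show ?thesis by simp
  qed
  have JI: "J \<subseteq> radial_interval 0 R" using Jp JR by (auto simp: radial_interval_def)
  have ran: "real_analytic_on S F" if "\<And>x. x \<in> S \<Longrightarrow> ereal (norm x) < R" for S
    by (rule real_analytic_power_series[of R c F, OF series]) (assumption, rule that)
  have cont: "continuation f J F 0 R"
    unfolding continuation_def
  proof (intro conjI ballI JI Ff)
    show "real_analytic_on (radial_interval 0 R) F" by (rule ran) (auto simp: radial_interval_def)
  qed auto

  \<comment> \<open>Left ends are nonnegative by definition, so only the right end needs an
    argument. A continuation past \<open>R\<close> would agree with \<open>F\<close> to the left of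
    \<open>R\<close> and be analytic at \<open>R\<close>, which Pringsheim's theorem
    excludes.\<close>
  have maximal: "\<beta> \<le> R" if c': "continuation f J F' \<alpha> \<beta>" for F' \<alpha> \<beta>
  proof (rule ccontr)
    assume "\<not> \<beta> \<le> R"
    then have R\<beta>: "R < \<beta>" by simp
    have r0R: "ereal r0 < R" by (rule JR[OF r0])
    with R\<beta> obtain \<rho> where \<rho>: "R = ereal \<rho>" by (cases R) auto
    have \<rho>0: "r0 < \<rho>" "0 < \<rho>" using r0R \<rho> Jp[OF r0] by auto
    have \<alpha>: "0 \<le> \<alpha>" "\<alpha> < r0" using c' r0 by (auto simp: continuation_def radial_interval_def)
    define T where "T = radial_interval \<alpha> R"
    have F'F: "F' x = F x" if "x \<in> T" for x
    proof (rule real_analytic_on_identity[where S = T and f = F' and g = F and x = r0])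
      show "connected T" unfolding T_def by (rule connected_radial_interval)
      show "real_analytic_on T F'"
        using c' R\<beta> by (auto simp: continuation_def T_def radial_interval_def
            elim!: real_analytic_on_subset intro: less_trans)
      show "real_analytic_on T F" by (rule ran) (use \<alpha> in \<open>auto simp: T_def radial_interval_def\<close>)
      show "r0 \<in> T" using \<alpha> r0R by (simp add: T_def radial_interval_def)
      show "\<forall>\<^sub>F t in nhds r0. F' t = F t"
        by (rule eventually_mono[OF eventually_nhds_in_open[OF Jo r0]])
           (use c' Ff in \<open>simp add: continuation_def\<close>)
    qed (rule that)
    have "\<rho> \<in> radial_interval \<alpha> \<beta>" using \<alpha> \<rho>0 R\<beta> \<rho> by (simp add: radial_interval_def)
    moreover have "real_analytic_on (radial_interval \<alpha> \<beta>) F'" using c' by (simp add: continuation_def)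
    ultimately obtain e1 b where e1: "0 < e1" "\<And>y. \<bar>y - \<rho>\<bar> < e1 \<Longrightarrow> (\<lambda>k. b k * (y - \<rho>) ^ k) sums F' y"
      unfolding real_analytic_on_def by blast
    define e where "e = min e1 (\<rho> - \<alpha>)"
    have e: "0 < e" "e \<le> e1" "e \<le> \<rho> - \<alpha>" using e1 \<alpha> \<rho>0 by (auto simp: e_def)
    define g where "g w = (\<Sum>k. complex_of_real (b k) * (w - of_real \<rho>) ^ k) - of_real (c 0)" for w
    \<comment> \<open>The constant term of \<open>F\<close>, a constant of integration, may be
      negative. It is dropped here and subtracted in \<open>g\<close>, so that all coefficients are
      nonnegative.\<close>
    define d where "d = c(0 := 0)"
    have dS: "d (Suc k) = c (Suc k)" for k by (simp add: d_def)
    have d0: "d 0 = 0" by (simp add: d_def)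
    have dn: "0 \<le> d k" for k using a(1) by (cases k) (simp_all add: d_def cS)
    have dsm: "summable (\<lambda>k. d k * x ^ k)" if "0 \<le> x" "x < \<rho>" for x
    proof -
      have "summable (\<lambda>k. c k * x ^ k)" by (rule sm) (use that \<rho> in simp)
      then have "summable (\<lambda>k. d (Suc k) * x ^ Suc k)" unfolding dS by (subst summable_Suc_iff)
      then show ?thesis by (subst (asm) summable_Suc_iff)
    qed
    have "\<exists>x>\<rho>. summable (\<lambda>k. d k * x ^ k)"
    proof (rule pringsheim_boundary_point[OF dn \<rho>0(2) dsm e(1)])
      have "summable (\<lambda>k. b k * s ^ k)" if "0 \<le> s" "s < e" for s
        using sums_summable[OF e1(2)[of "\<rho> + s"]] that e by simp
      then have "(\<lambda>w. \<Sum>k. complex_of_real (b k) * (w - of_real \<rho>) ^ k) holomorphic_on ball (of_real \<rho>) e"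
        by (rule power_series_holomorphic_real)
      then show "g holomorphic_on ball (of_real \<rho>) e" unfolding g_def by (intro holomorphic_intros)
      fix x assume x: "0 < x" "\<rho> - e < x" "x < \<rho>"
      have "(\<lambda>k. complex_of_real (b k * (x - \<rho>) ^ k)) sums of_real (F' x)"
        using e1(2)[of x] x e by (subst sums_of_real_iff) auto
      then have "g (of_real x) = of_real (F' x - c 0)" by (simp add: g_def sums_iff)
      also have "F' x = F x" using x e \<rho> by (intro F'F) (simp add: T_def radial_interval_def)
      also have "F x - c 0 = (\<Sum>k. d k * x ^ k)"
        using head[of x] suminf_split_head[OF dsm[of x]] x \<rho> by (simp add: dS d0)
      finally show "g (of_real x) = of_real (\<Sum>k. d k * x ^ k)" .
    qed auto
    then obtain x where x: "x > \<rho>" "summable (\<lambda>k. d k * x ^ k)" by blast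
    have dd: "diffs d = a" unfolding dc[symmetric] by (simp add: diffs_def dS)
    \<comment> \<open>Convergence of the series at \<open>x\<close> gives convergence of the
      differentiated series strictly inside, so an intermediate point still beyond \<rho> is
      taken.\<close>
    define y where "y = (\<rho> + x) / 2"
    have y: "\<rho> < y" "y < x" "0 < y" using x(1) \<rho>0 by (auto simp: y_def)
    have "summable (\<lambda>k. diffs d k * y ^ k)"
      by (rule termdiff_converges[of y x]) (use x y powser_inside[OF x(2)] in auto)
    then have "ereal (norm y) \<le> R" unfolding dd R_def by (rule conv_radius_geI)
    then show False using y \<rho> by simp
  qed

  obtain e where e: "0 < e" "ereal e < R"
    using ereal_dense2[of 0 R] less_trans[of 0 "ereal r0" R] Jp[OF r0] JR[OF r0] by (auto simp: zero_ereal_def)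
  have smooth: "smooth_on (radial_interval (- e) R) F"
    unfolding smooth_on_def
  proof
    fix k
    have "ereal (norm x) < R" if "x \<in> radial_interval (- e) R" for x
    proof (cases "0 \<le> x")
      case False
      then have "ereal (norm x) < ereal e" using that by (simp add: radial_interval_def)
      then show ?thesis using e(2) by (rule less_trans)
    qed (use that in \<open>simp add: radial_interval_def\<close>)
    then have "C_k_on k (radial_interval (- e) R) (iter_deriv c 0)"
      by (intro C_k_on_real_derivatives open_radial_interval der)
    then show "C_k_on k (radial_interval (- e) R) F" by (simp add: S0)
  qed
  define U where "U = {z::complex^'n. ereal ((norm z)\<^sup>2) < R}"
  \<comment> \<open>A two-sided interval: derivatives at \<open>(norm z)\<^sup>2 = 0\<close> require
    a full neighbourhood of 0.\<close>
  define I where "I = {x::real. ereal (norm x) < R}"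
  have Io: "open I"
  proof -
    have "I = (\<lambda>x. ereal (norm x)) -` {..<R}" by (auto simp: I_def)
    moreover have "continuous_on UNIV (\<lambda>x::real. ereal (norm x))"
      by (rule continuous_on_ereal[OF continuous_on_norm[OF continuous_on_id]])
    from open_vimage[OF open_lessThan this] have "open ((\<lambda>x::real. ereal (norm x)) -` {..<R})" .
    ultimately show ?thesis by simp
  qed
  have UI: "(norm z)\<^sup>2 \<in> I" if "z \<in> U" for z using that by (simp add: U_def I_def)
  have Uo: "open U"
  proof -
    have "U = (\<lambda>z. (norm z)\<^sup>2) -` I" by (auto simp: U_def I_def)
    moreover have "continuous_on UNIV (\<lambda>z::complex^'n. (norm z)\<^sup>2)" by (intro continuous_intros)
    from open_vimage[OF Io this] have "open ((\<lambda>z::complex^'n. (norm z)\<^sup>2) -` I)" .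
    ultimately show ?thesis by simp
  qed
  have derI: "(iter_deriv c i has_real_derivative iter_deriv c (Suc i) x) (at x)" if "x \<in> I" for i x
    using der that by (simp add: I_def)
  have "kaehler_metric U (ddbar (\<lambda>w. F ((norm w)\<^sup>2)))"
  proof (rule kaehler_metric_radial[where S = "iter_deriv c", OF Uo])
    fix z assume z: "z \<in> U"
    define x where "x = (norm z)\<^sup>2"
    have x: "0 \<le> x" "ereal (norm x) < R" using UI[OF z] by (auto simp: x_def I_def)
    show "(iter_deriv c i has_real_derivative iter_deriv c (Suc i) ((norm z)\<^sup>2)) (at ((norm z)\<^sup>2))" for i
      by (rule derI[OF UI[OF z]])
    \<comment> \<open>The series is bounded below by its constant term, with equality at the origin;
      positivity there is exactly \<open>a0\<close>.\<close>
    have "(\<Sum>k\<in>{0}. a k * x ^ k) \<le> (\<Sum>k. a k * x ^ k)"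
      by (rule sum_le_suminf[OF ma[OF x(2)]]) (use a(1) x(1) in auto)
    then show "0 < iter_deriv c 1 ((norm z)\<^sup>2)" unfolding S1 x_def[symmetric] using a0 by simp
    obtain r where r: "norm x < r" "ereal r < R" using ereal_dense2[OF x(2)] by auto
    have "summable (\<lambda>k. (diffs ^^ 1) a k * x ^ k)"
    proof (rule summable_diffs_funpow[OF _ r(1)])
      show "summable (\<lambda>k. a k * y ^ k)" if "norm y < r" for y
      proof (rule ma)
        have "ereal (norm y) < ereal r" using that by simp
        then show "ereal (norm y) < R" using r(2) by (rule less_trans)
      qed
    qed
    then have "0 \<le> (\<Sum>k. diffs a k * x ^ k)"
      by (intro suminf_nonneg) (use a(1) x(1) in \<open>auto simp: diffs_def\<close>)
    then show "0 \<le> iter_deriv c 2 ((norm z)\<^sup>2)"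
      by (simp add: iter_deriv_def numeral_2_eq_2 dc x_def)
    have "((\<lambda>x. iter_deriv c 0 x) has_real_derivative iter_deriv c 1 y) (at y)" if "y \<in> I" for y
      using derI[OF that, of 0] by simp
    moreover have "(iter_deriv c 1 has_real_derivative iter_deriv c 2 ((norm z)\<^sup>2)) (at ((norm z)\<^sup>2))"
      using derI[OF UI[OF z], of 1] by (simp add: numeral_2_eq_2)
    ultimately show "ddbar (\<lambda>w. F ((norm w)\<^sup>2)) z = radial_matrix (iter_deriv c 1 ((norm z)\<^sup>2)) (iter_deriv c 2 ((norm z)\<^sup>2)) z"
      unfolding S0[symmetric] by (rule ddbar_radial[OF Io UI[OF z]])
  qed
  then have "maximal_continuation f J F 0 R \<and> (\<exists>e>0. smooth_on (radial_interval (- e) R) F) \<and>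
      kaehler_metric {z::complex^'n. ereal ((norm z)\<^sup>2) < R} (ddbar (\<lambda>w. F ((norm w)\<^sup>2)))"
    using cont maximal smooth e(1) unfolding maximal_continuation_def U_def
    by (auto simp: continuation_def)
  then show ?thesis
    unfolding potential_defined_at_origin_def J_def by blast
qed

end
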